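(* Let $\phi:\mathbb{Z}^d\rightarrow\mathbb{C}$ be finitely supported and such that $\sup_{\xi}|\hat\phi(\xi)|=1$. Suppose additionally that each $\xi\in\Omega(\phi)$ is of positive homogeneous type for $\hat\phi$. Then there exists a positive constant $C$ for which $$\|\phi^{(n)}\|_1=\sum_{x\in\mathbb{Z}^d}|\phi^{(n)}(x)|\leq C$$ for all $n\in\mathbb{N}_+=\{1,2,\dots\}$.
   Context: Let $d\ge 1$. For finitely supported $\phi:\mathbb{Z}^d\to\mathbb{C}$, set $\phi^{(1)}=\phi$ and $\phi^{(n)}=\phi^{(n-1)}*\phi$, where $(\psi*\phi)(x)=\sum_{y\in\mathbb{Z}^d}\psi(x-y)\phi(y)$. The Fourier transform is $\hat\phi(\xi)=\sum_{x\in\mathbb{Z}^d}\phi(x)e^{ix\cdot\xi}$, $\xi\in\mathbb{R}^d$. Let $\mathbb{T}^d=(-\pi,\pi]^d$. For $E\in M_d(\mathbb{R})$ and $t>0$, $t^E=\exp((\log t)E)$. For a continuous $P:\mathbb{R}^d\to\mathbb{C}$, $\mathrm{Exp}(P)$ is the set of $E\in M_d(\mathbb{R})$ with $tP(\xi)=P(t^E\xi)$ for all $t>0$, $\xi\in\mathbb{R}^d$. $P$ is positive homogeneous if $R=\operatorname{Re}P$ is positive definite ($R(\xi)\ge 0$, with $R(\xi)=0$ only when $\xi=0$) and $\mathrm{Exp}(P)$ contains a matrix with real spectrum. When $\sup|\hat\phi|=1$, $\Omega(\phi)=\{\xi\in\mathbb{T}^d:|\hat\phi(\xi)|=1\}$.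 For $\xi_0\in\Omega(\phi)$ put $\Gamma_{\xi_0}(\xi)=\log\big(\hat\phi(\xi+\xi_0)/\hat\phi(\xi_0)\big)$ (principal branch) on a sufficiently small convex open neighborhood $\mathcal{U}$ of $0$. The point $\xi_0$ is of positive homogeneous type for $\hat\phi$ if the Taylor expansion of $\Gamma_{\xi_0}$ about $0$ is of the form $\Gamma_{\xi_0}(\xi)=i\alpha_{\xi_0}\cdot\xi-P_{\xi_0}(\xi)+\Upsilon_{\xi_0}(\xi)$, where $\alpha_{\xi_0}\in\mathbb{R}^d$, $P_{\xi_0}$ is a positive homogeneous polynomial (complex coefficients, $d$ real variables), and $\Upsilon_{\xi_0}(\xi)=o(\operatorname{Re}P_{\xi_0}(\xi))$ as $\xi\to 0$. *)

theory Defs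
  imports "HOL-Analysis.Analysis" "HOL-Library.Landau_Symbols"
begin

section \<open>Convolution powers and the Fourier transform on the integer lattice\<close>

text \<open>
  The lattice of dimension \<open>d \<ge> 1\<close> is \<^typ>\<open>int ^ 'd\<close>, with \<open>d = CARD('d)\<close>.  Sums over the
  lattice are unordered infinite sums; for finitely supported functions they are finite sums.
\<close>

definition finitely_supported :: "(int ^ 'd \<Rightarrow> complex) \<Rightarrow> bool" where
  "finitely_supported \<phi> \<longleftrightarrow> finite {x. \<phi> x \<noteq> 0}"

definition conv :: "(int ^ 'd \<Rightarrow> complex) \<Rightarrow> (int ^ 'd \<Rightarrow> complex) \<Rightarrow> int ^ 'd \<Rightarrow> complex" where
  "conv \<psi> \<phi> x = (\<Sum>\<^sub>\<infinity>y. \<psi> (x - y) * \<phi> y)"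

text \<open>The powers of interest are those with \<open>n \<ge> 1\<close>; the value at \<open>0\<close> is the convolution unit.\<close>

fun conv_pow :: "(int ^ 'd \<Rightarrow> complex) \<Rightarrow> nat \<Rightarrow> int ^ 'd \<Rightarrow> complex" where
  "conv_pow \<phi> 0 = (\<lambda>x. of_bool (x = 0))"
| "conv_pow \<phi> (Suc 0) = \<phi>"
| "conv_pow \<phi> (Suc (Suc n)) = conv (conv_pow \<phi> (Suc n)) \<phi>"

definition l1_norm :: "(int ^ 'd \<Rightarrow> complex) \<Rightarrow> real" where
  "l1_norm \<phi> = (\<Sum>\<^sub>\<infinity>x. cmod (\<phi> x))"

definition real_vec :: "int ^ 'd \<Rightarrow> real ^ 'd" where
  "real_vec x = (\<chi> i. of_int (x $ i))"

definition fourier :: "(int ^ 'd \<Rightarrow> complex) \<Rightarrow> real ^ 'd \<Rightarrow> complex" where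
  "fourier \<phi> \<xi> = (\<Sum>\<^sub>\<infinity>x. \<phi> x * exp (\<i> * complex_of_real (real_vec x \<bullet> \<xi>)))"

definition torus :: "(real ^ 'd) set" where
  "torus = {\<xi>. \<forall>i. - pi < \<xi> $ i \<and> \<xi> $ i \<le> pi}"

definition Omega :: "(int ^ 'd \<Rightarrow> complex) \<Rightarrow> (real ^ 'd) set" where
  "Omega \<phi> = {\<xi> \<in> torus. cmod (fourier \<phi> \<xi>) = 1}"

text \<open>
  Convolution powers of a finitely supported function are finitely supported, so the infinite
  sums above never take the default value \<open>0\<close> of a divergent sum.
\<close>

lemma finitely_supported_conv:
  assumes "finitely_supported \<psi>" "finitely_supported \<phi>"
  shows "finitely_supported (conv \<psi> \<phi>)"
proof -
  let ?S = "(\<lambda>(a, b). a + b) ` ({x. \<psi> x \<noteq> 0} \<times> {x. \<phi> x \<noteq> 0})"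
  have "conv \<psi> \<phi> x = 0" if "x \<notin> ?S" for x
  proof -
    have "\<psi> (x - y) * \<phi> y = 0" for y
    proof (rule ccontr)
      assume "\<psi> (x - y) * \<phi> y \<noteq> 0"
      then have "(x - y, y) \<in> {x. \<psi> x \<noteq> 0} \<times> {x. \<phi> x \<noteq> 0}" by simp
      then have "(\<lambda>(a, b). a + b) (x - y, y) \<in> ?S" by (rule imageI)
      with that show False by simp
    qed
    then show ?thesis unfolding conv_def by (intro infsum_0)
  qed
  then have "{x. conv \<psi> \<phi> x \<noteq> 0} \<subseteq> ?S" by blast
  moreover have "finite ?S"
    using assms unfolding finitely_supported_def by blast
  ultimately show ?thesis
    unfolding finitely_supported_def by (rule finite_subset)
qed

lemma finitely_supported_conv_pow:
  "finitely_supported \<phi> \<Longrightarrow> finitely_supported (conv_pow \<phi> n)"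
  by (induction \<phi> n rule: conv_pow.induct)
    (auto simp: finitely_supported_conv, simp add: finitely_supported_def)


section \<open>Positive homogeneous functions\<close>

text \<open>
  The ring structure on \<^typ>\<open>real ^ 'd ^ 'd\<close>, and with it \<open>^\<close>, is componentwise; the powers in the
  exponential series are iterates of the matrix product \<open>**\<close>.
\<close>

definition mat_exp :: "real ^ 'd ^ 'd \<Rightarrow> real ^ 'd ^ 'd" where
  "mat_exp A = (\<Sum>k. (((**) A ^^ k) (mat 1)) /\<^sub>R fact k)"

definition mat_rpow :: "real \<Rightarrow> real ^ 'd ^ 'd \<Rightarrow> real ^ 'd ^ 'd" where
  "mat_rpow t E = mat_exp (ln t *\<^sub>R E)"

definition Exp_set :: "(real ^ 'd \<Rightarrow> complex) \<Rightarrow> (real ^ 'd ^ 'd) set" where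
  "Exp_set P = {E. \<forall>t>0. \<forall>\<xi>. complex_of_real t * P \<xi> = P (mat_rpow t E *v \<xi>)}"

text \<open>The spectrum of a real matrix is taken over the complex numbers.\<close>

definition spectrum :: "real ^ 'd ^ 'd \<Rightarrow> complex set" where
  "spectrum E = {z. \<not> invertible (mat z - (\<chi> i j. complex_of_real (E $ i $ j)))}"

definition positive_homogeneous :: "(real ^ 'd \<Rightarrow> complex) \<Rightarrow> bool" where
  "positive_homogeneous P \<longleftrightarrow>
     continuous_on UNIV P \<and>
     (\<forall>\<xi>. Re (P \<xi>) \<ge> 0 \<and> (Re (P \<xi>) = 0 \<longrightarrow> \<xi> = 0)) \<and>
     (\<exists>E \<in> Exp_set P. spectrum E \<subseteq> \<real>)"


section \<open>Points of positive homogeneous type\<close>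

definition Gamma_log :: "(int ^ 'd \<Rightarrow> complex) \<Rightarrow> real ^ 'd \<Rightarrow> real ^ 'd \<Rightarrow> complex" where
  "Gamma_log \<phi> \<xi>\<^sub>0 \<xi> = Ln (fourier \<phi> (\<xi> + \<xi>\<^sub>0) / fourier \<phi> \<xi>\<^sub>0)"

text \<open>
  ``Sufficiently small'' for the neighbourhood \<open>U\<close> means that the quotient avoids the branch cut
  \<^term>\<open>\<real>\<^sub>\<le>\<^sub>0 :: complex set\<close> of the logarithm on \<open>U\<close>.  As the logarithm is then real-analytic
  on \<open>U\<close>, so is the remainder \<open>\<Upsilon>\<close>.  The polynomial \<open>P\<close> need not be a partial sum
  of the Taylor series in the standard coordinates: \<open>x\<^sup>2 + y\<^sup>4\<close> and \<open>x\<^sup>2 + (x - y)\<^sup>4\<close> differ by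
  \<open>o(x\<^sup>2 + y\<^sup>4)\<close>, and both are positive homogeneous.
\<close>

definition positive_homogeneous_type :: "(int ^ 'd \<Rightarrow> complex) \<Rightarrow> real ^ 'd \<Rightarrow> bool" where
  "positive_homogeneous_type \<phi> \<xi>\<^sub>0 \<longleftrightarrow>
     (\<exists>U \<alpha> P \<Upsilon>.
        open U \<and> convex U \<and> 0 \<in> U \<and>
        (\<forall>\<xi>\<in>U. fourier \<phi> (\<xi> + \<xi>\<^sub>0) / fourier \<phi> \<xi>\<^sub>0 \<notin> \<real>\<^sub>\<le>\<^sub>0) \<and>
        polynomial_function P \<and> positive_homogeneous P \<and>
        (\<forall>\<xi>\<in>U. Gamma_log \<phi> \<xi>\<^sub>0 \<xi> = \<i> * complex_of_real (\<alpha> \<bullet> \<xi>) - P \<xi> + \<Upsilon> \<xi>) \<and>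
        \<Upsilon> \<in> o[at 0](\<lambda>\<xi>. complex_of_real (Re (P \<xi>))))"

end

theory Submission
  imports Defs "HOL-Complex_Analysis.Cauchy_Integral_Formula"
begin

text \<open>
  Write \<open>F\<close> for the Fourier transform of \<open>\<phi>\<close>.  The transform of the \<open>n\<close>-th convolution power is \<open>F\<^sup>n\<close>,
  which for large \<open>n\<close> is concentrated near the finitely many points \<open>q\<close> of \<open>\<Omega>\<close>.  Near \<open>q\<close> it looks like
  \<open>exp (i n \<alpha>\<^sub>q \<bullet> (\<xi> - q) - n P\<^sub>q (\<xi> - q))\<close>, the transform of a packet that has travelled to
  \<open>n \<alpha>\<^sub>q\<close> and has spread anisotropically, in the proportions dictated by the homogeneity of \<open>P\<^sub>q\<close>.
  The packets at different \<open>q\<close> live in different places and have different shapes, so they are separated first.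
  Each is then estimated by the Cauchy--Schwarz inequality with a weight adapted to its centre and shape.

  Scaling.  A single matrix \<open>t\<^sup>E\<close> with small \<open>t\<close> already gives all the homogeneity that is needed: it is a linear
  contraction \<open>L\<close> with \<open>P (L \<xi>) = \<tau> P \<xi>\<close> (lemma \<open>positive_homogeneous_imp_scaling\<close>), and \<open>B = L\<^sup>k\<close> with
  \<open>\<tau>\<^sup>k\<close> of size \<open>1 / n\<close> is the shape of the packet at time \<open>n\<close>.

  Separation.  Lemma \<open>trig_partition_of_unity\<close> writes \<open>1 = \<Sum>\<^sub>q h\<^sub>q\<close> with trigonometric polynomials
  \<open>h\<^sub>q\<close> that vanish to high order at the other points of \<open>\<Omega>\<close>.  No smooth cut-off occurs, so all functions have
  finitely supported coefficients and are entire in the frequency variable.  As \<open>|F|\<^sup>n\<close> decays like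
  \<open>exp (- c n |\<xi> - p|\<^sup>K)\<close> near \<open>p\<close>, a zero of \<open>h\<^sub>q\<close> of high enough order at \<open>p\<close> makes \<open>h\<^sub>q F\<^sup>n\<close> smaller than any prescribed power of
  \<open>1 / n\<close> away from \<open>q\<close> (lemma \<open>small_away_vanishing\<close>).

  One packet.  Let \<open>c\<close> be the coefficients of \<open>h\<^sub>q F\<^sup>n\<close> and \<open>s = d + 2\<close>.  With the weight
  \<open>W (x) = 1 + \<Sum>\<^sub>j |(x - n \<alpha>) \<bullet> B e\<^sub>j|\<^bsup>2s\<^esup>\<close> one has \<open>(\<Sum> |c|)\<^sup>2 \<le> (\<Sum> |c|\<^sup>2 W) (\<Sum> 1 / W)\<close>.  The second
  factor is \<open>O (1 / |det B|)\<close>, by counting lattice points in linear images of balls.  The first one is, by Parseval's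
  identity, a mean square of \<open>h\<^sub>q F\<^sup>n\<close> (with the modulation \<open>exp (- i n \<alpha> \<bullet> \<xi>)\<close>) and of its derivatives of order \<open>s\<close> in the directions
  \<open>B e\<^sub>j\<close>.  Those derivatives are bounded by Cauchy's inequality, because \<open>|exp (- i \<alpha> \<bullet> \<zeta>) F (q + \<zeta>)|\<^sup>n\<close> is at most
  \<open>C exp (- n Re P \<xi> / 2)\<close> also for \<open>\<zeta> = \<xi> + z B v\<close> with small complex \<open>z\<close> (lemma \<open>power_estimate_near_maximum\<close>).
  After the substitution \<open>\<xi> = B \<eta>\<close> the mean square is \<open>O (|det B|)\<close>, and the two powers of the determinant cancel
  (lemma \<open>uniform_l1_bound_one_packet\<close>).

  Parseval's identity is used on a fine finite grid of the torus, so that both factors reduce to the same lattice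
  sum, once for the adjoint of \<open>B\<close> and once for a multiple of its inverse (lemma \<open>lattice_sum\<close>).
\<close>

section \<open>Linear contractions that rescale a positive homogeneous function\<close>

lemma power_le_fact_mult_exp:
  fixes x :: real
  assumes "0 \<le> x"
  shows "x ^ m \<le> fact m * exp x"
proof -
  have "(\<Sum>n\<in>{m}. x ^ n /\<^sub>R fact n) \<le> (\<Sum>n. x ^ n /\<^sub>R fact n)"
    using assms by (intro sum_le_suminf summable_exp_generic) auto
  then have "x ^ m / fact m \<le> exp x" by (simp add: exp_def divide_inverse mult.commute)
  then show ?thesis by (simp add: field_simps)
qed

text \<open>
  One contraction \<open>L\<close> replaces the whole one-parameter group \<open>t\<^sup>E\<close>: its powers give the scales
  \<open>t = \<tau>\<^sup>k\<close>, which are as good as all scales up to constants.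
\<close>

locale contracting_scaling =
  fixes L :: "real ^ 'd \<Rightarrow> real ^ 'd" and \<tau> \<rho> \<mu> :: real and P :: "real ^ 'd \<Rightarrow> complex"
  assumes linear_L: "linear L"
    and tau_pos: "0 < \<tau>" and tau_less_1: "\<tau> < 1"
    and mu_pos: "0 < \<mu>" and rho_less_1: "\<rho> < 1"
    and L_lower: "\<And>x. \<mu> * norm x \<le> norm (L x)"
    and L_upper: "\<And>x. norm (L x) \<le> \<rho> * norm x"
    and P_L: "\<And>x. P (L x) = of_real \<tau> * P x"
    and P_cont: "continuous_on UNIV P"
    and Re_P_nonneg: "\<And>x. 0 \<le> Re (P x)"
    and Re_P_definite: "\<And>x. Re (P x) = 0 \<Longrightarrow> x = 0"

text \<open>Positivity of \<open>Re P\<close> keeps a homogeneity matrix with small parameter off the unit sphere,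
  so by the intermediate value theorem it is uniformly contracting or uniformly expanding; the latter
  is impossible, as \<open>Re P\<close> blows up along the inverse iterates.\<close>

lemma positive_homogeneous_imp_scaling:
  fixes P :: "real ^ 'd \<Rightarrow> complex"
  assumes "positive_homogeneous P"
  shows "\<exists>L \<tau> \<rho> \<mu>. contracting_scaling L \<tau> \<rho> \<mu> P"
proof -
  from assms obtain E where cont: "continuous_on UNIV P"
    and nonneg: "\<And>x. 0 \<le> Re (P x)" and definite: "\<And>x. Re (P x) = 0 \<Longrightarrow> x = 0"
    and E: "\<And>t x. t > 0 \<Longrightarrow> complex_of_real t * P x = P (mat_rpow t E *v x)"
    unfolding positive_homogeneous_def Exp_set_def by blast
  define S where "S = sphere (0 :: real ^ 'd) 1"
  have S: "compact S" "S \<noteq> {}" by (auto simp: S_def)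
  have contR: "continuous_on A (\<lambda>x. Re (P x))" for A
    using cont continuous_on_subset by (intro continuous_on_Re) blast
  obtain x0 where x0: "x0 \<in> S" "\<And>x. x \<in> S \<Longrightarrow> Re (P x0) \<le> Re (P x)"
    using continuous_attains_inf[OF S contR] by blast
  obtain x1 where x1: "x1 \<in> S" "\<And>x. x \<in> S \<Longrightarrow> Re (P x) \<le> Re (P x1)"
    using continuous_attains_sup[OF S contR] by blast
  define c where "c = Re (P x0)"
  define C where "C = Re (P x1)"
  have c: "c > 0"
    using definite[of x0] nonneg[of x0] x0(1) unfolding c_def S_def by fastforce
  have cC: "c \<le> C" using x0(2) x1(1) by (auto simp: c_def C_def)
  define \<tau> where "\<tau> = c / (2 * C)"
  have tau: "0 < \<tau>" "\<tau> < 1" "\<tau> * C < c" using c cC by (auto simp: \<tau>_def field_simps)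
  define L where "L = (\<lambda>x. mat_rpow \<tau> E *v x)"
  have lin: "linear L" unfolding L_def by simp
  have PL: "P (L x) = of_real \<tau> * P x" for x using E[OF tau(1), of x] by (simp add: L_def)
  have RL: "Re (P (L x)) = \<tau> * Re (P x)" for x by (simp add: PL)
  have P0: "P 0 = 0" using PL[of 0] linear_0[OF lin] tau by simp
  have L_eq_0: "x = 0" if "L x = 0" for x
  proof (rule definite)
    have "\<tau> * Re (P x) = 0" using RL[of x] that P0 by simp
    then show "Re (P x) = 0" using tau by simp
  qed
  have norm_ne: "norm (L x) \<noteq> norm x" if "x \<noteq> 0" for x
  proof
    assume eq: "norm (L x) = norm x"
    define u where "u = x /\<^sub>R norm x"
    have "u \<in> S" using that by (simp add: u_def S_def)
    moreover have "L u \<in> S" using eq that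
      by (simp add: u_def S_def linear_scale[OF lin])
    ultimately have "Re (P (L u)) \<ge> c" "Re (P u) \<le> C" using x0 x1 by (auto simp: c_def C_def)
    moreover have "\<tau> * Re (P u) \<le> \<tau> * C" using calculation(2) tau by simp
    ultimately show False using RL[of u] tau by linarith
  qed
  \<comment> \<open>Join a contracted and an expanded vector by a segment: it avoids the origin because
    opposite vectors are stretched by the same factor.\<close>
  have dichotomy: "\<not> (norm (L x) < norm x \<and> norm y < norm (L y))" for x y
  proof
    assume xy: "norm (L x) < norm x \<and> norm y < norm (L y)"
    define h where "h = (\<lambda>t::real. norm (L ((1 - t) *\<^sub>R x + t *\<^sub>R y)) - norm ((1 - t) *\<^sub>R x + t *\<^sub>R y))"
    have "continuous_on UNIV L" using lin by (simp add: linear_continuous_on linear_conv_bounded_linear)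
    then have "continuous_on {0..1} (\<lambda>t::real. L ((1 - t) *\<^sub>R x + t *\<^sub>R y))"
      by (rule continuous_on_compose2) (auto intro!: continuous_intros)
    then have "continuous_on {0..1} h"
      unfolding h_def by (intro continuous_on_diff continuous_on_norm continuous_on_add
        continuous_on_scaleR continuous_on_id continuous_on_const)
    then obtain t where t: "0 \<le> t" "t \<le> 1" "h t = 0"
      using IVT'[of h 0 0 1] xy by (auto simp: h_def)
    then have *: "(1 - t) *\<^sub>R x + t *\<^sub>R y = 0" using norm_ne unfolding h_def by fastforce
    have "t \<noteq> 0" using * xy by auto
    have "t *\<^sub>R y = - ((1 - t) *\<^sub>R x)" using * by (metis add.commute eq_neg_iff_add_eq_0)
    then have "(1 / t) *\<^sub>R (t *\<^sub>R y) = (1 / t) *\<^sub>R (- ((1 - t) *\<^sub>R x))" by (rule arg_cong)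
    then have "y = (- ((1 - t) / t)) *\<^sub>R x" using \<open>t \<noteq> 0\<close> by simp
    then obtain r where "y = r *\<^sub>R x" by blast
    then have "norm y = \<bar>r\<bar> * norm x" "norm (L y) = \<bar>r\<bar> * norm (L x)"
      by (simp_all add: linear_scale[OF lin])
    with xy show False using mult_left_mono[of "norm (L x)" "norm x" "\<bar>r\<bar>"] by simp
  qed
  have contr: "norm (L x) < norm x" if x: "x \<noteq> 0" for x
  proof (rule ccontr)
    assume "\<not> ?thesis"
    then have "norm x < norm (L x)" using norm_ne[OF x] by simp
    then have expand: "norm y \<le> norm (L y)" for y using dichotomy[of y x] by force
    obtain L' where L': "linear L'" "\<And>y. L (L' y) = y"
      using linear_injective_isomorphism[OF lin] L_eq_0 linear_injective_0[OF lin] by metis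
    have L'n: "norm ((L' ^^ j) x1) \<le> 1" for j
    proof (induction j)
      case 0 then show ?case using x1 by (simp add: S_def)
    next
      case (Suc j)
      have "norm ((L' ^^ Suc j) x1) \<le> norm (L (L' ((L' ^^ j) x1)))" using expand by simp
      then show ?case using Suc L' by simp
    qed
    have R': "Re (P x1) = \<tau> ^ j * Re (P ((L' ^^ j) x1))" for j
    proof (induction j)
      case (Suc j)
      then show ?case using RL[of "L' ((L' ^^ j) x1)"] L' by (simp add: mult_ac)
    qed simp
    have "compact (cball (0 :: real ^ 'd) 1)" by simp
    then have "bounded ((\<lambda>x. Re (P x)) ` cball (0 :: real ^ 'd) 1)"
      using compact_continuous_image[OF contR] compact_imp_bounded by blast
    then obtain K where K: "\<And>x. norm x \<le> 1 \<Longrightarrow> \<bar>Re (P x)\<bar> \<le> K" by (force simp: bounded_iff)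
    have Kpos: "K > 0" using K[of x1] x1 c cC by (force simp: S_def C_def)
    obtain j where "\<tau> ^ j < C / K" using real_arch_pow_inv[of "C / K" \<tau>] tau c cC Kpos by auto
    then have "\<tau> ^ j * K < C" using Kpos by (simp add: field_simps)
    moreover have "Re (P x1) \<le> \<tau> ^ j * K"
      using R'[of j] K[OF L'n[of j]] tau by (simp add: mult_left_mono)
    ultimately show False by (simp add: C_def)
  qed
  have contL: "continuous_on S (\<lambda>x. norm (L x))"
    by (intro continuous_on_norm linear_continuous_on) (use lin in \<open>simp add: linear_conv_bounded_linear\<close>)
  obtain u where u: "u \<in> S" "\<And>x. x \<in> S \<Longrightarrow> norm (L x) \<le> norm (L u)"
    using continuous_attains_sup[OF S contL] by blast
  obtain w where w: "w \<in> S" "\<And>x. x \<in> S \<Longrightarrow> norm (L w) \<le> norm (L x)"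
    using continuous_attains_inf[OF S contL] by blast
  have S_scale: "norm (L x) = norm x * norm (L (x /\<^sub>R norm x))" "x /\<^sub>R norm x \<in> S" if "x \<noteq> 0" for x
    using that by (auto simp: linear_scale[OF lin] S_def)
  show ?thesis
  proof (intro exI)
    show "contracting_scaling L \<tau> (norm (L u)) (norm (L w)) P"
    proof (rule contracting_scaling.intro)
      show "norm (L u) < 1" using contr[of u] u by (force simp: S_def)
      show "0 < norm (L w)" using L_eq_0[of w] w by (force simp: S_def)
      show "norm (L w) * norm x \<le> norm (L x)" for x
        using S_scale[of x] w(2)[of "x /\<^sub>R norm x"] linear_0[OF lin]
        by (cases "x = 0") (auto simp: mult_ac mult_left_mono)
      show "norm (L x) \<le> norm (L u) * norm x" for x
        using S_scale[of x] u(2)[of "x /\<^sub>R norm x"] linear_0[OF lin]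
        by (cases "x = 0") (auto simp: mult_ac mult_left_mono)
    qed (use lin tau PL cont nonneg definite in auto)
  qed
qed


context contracting_scaling
begin

lemma rho_pos: "0 < \<rho>"
proof -
  obtain b :: "real ^ 'd" where "b \<in> Basis" using nonempty_Basis by blast
  then show ?thesis using L_lower[of b] L_upper[of b] mu_pos by simp
qed

lemma linear_pow: "linear (L ^^ m)"
proof (induction m)
  case 0 then show ?case using linear_id by (simp add: id_def)
next
  case (Suc m) then show ?case using linear_compose[OF Suc linear_L] by (simp add: o_def)
qed

lemma norm_pow_le: "norm ((L ^^ m) x) \<le> \<rho> ^ m * norm x"
proof (induction m)
  case (Suc m)
  have "norm ((L ^^ Suc m) x) \<le> \<rho> * norm ((L ^^ m) x)" using L_upper by simp
  also have "\<dots> \<le> \<rho> * (\<rho> ^ m * norm x)" using Suc rho_pos by simp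
  finally show ?case by simp
qed simp

lemma norm_pow_ge: "\<mu> ^ m * norm x \<le> norm ((L ^^ m) x)"
proof (induction m)
  case (Suc m)
  have "\<mu> * (\<mu> ^ m * norm x) \<le> \<mu> * norm ((L ^^ m) x)" using Suc mu_pos by simp
  also have "\<dots> \<le> norm ((L ^^ Suc m) x)" using L_lower by simp
  finally show ?case by simp
qed simp

lemma norm_pow_le_norm: "norm ((L ^^ m) x) \<le> norm x"
proof -
  have "\<rho> ^ m * norm x \<le> 1 * norm x"
    using rho_pos rho_less_1 by (intro mult_right_mono power_le_one) auto
  then show ?thesis using norm_pow_le[of m x] by simp
qed

lemma P_pow: "P ((L ^^ m) x) = of_real (\<tau> ^ m) * P x"
  by (induction m) (simp_all add: P_L)

lemma P_0: "P 0 = 0"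
  using P_L[of 0] linear_0[OF linear_L] tau_less_1 by simp

lemma mu_less_1: "\<mu> < 1"
proof -
  obtain b :: "real ^ 'd" where "b \<in> Basis" using nonempty_Basis by blast
  then show ?thesis using L_lower[of b] L_upper[of b] rho_less_1 by simp
qed

lemma inj_pow: "inj (L ^^ m)"
proof -
  have "x = 0" if "(L ^^ m) x = 0" for x
  proof (rule ccontr)
    assume "x \<noteq> 0"
    then have "0 < \<mu> ^ m * norm x" using mu_pos by simp
    then show False using norm_pow_ge[of m x] that by simp
  qed
  then show ?thesis by (simp add: linear_injective_0[OF linear_pow])
qed

lemma bij_pow: "bij (L ^^ m)"
  using inj_pow linear_injective_imp_surjective[OF linear_pow inj_pow] by (simp add: bij_def)

text \<open>Every nonzero vector can be moved along its \<open>L\<close>-orbit into the fundamental shell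
  \<open>\<mu> \<le> |\<theta>| \<le> 1\<close>.\<close>

lemma shell_decomposition_small:
  assumes "x \<noteq> 0" "norm x \<le> 1"
  obtains m \<theta> where "x = (L ^^ m) \<theta>" "\<mu> \<le> norm \<theta>" "norm \<theta> \<le> 1"
proof -
  define y where "y = (\<lambda>m. inv (L ^^ m) x)"
  have y: "(L ^^ m) (y m) = x" for m
    unfolding y_def using bij_pow[of m] by (simp add: bij_is_surj surj_f_inv_f)
  have ySuc: "L (y (Suc m)) = y m" for m
  proof -
    have "(L ^^ m) (L (y (Suc m))) = (L ^^ m) (y m)"
      using y[of "Suc m"] y[of m] by (simp add: funpow_swap1)
    then show ?thesis using inj_pow[of m] by (simp add: inj_eq)
  qed
  obtain m where "\<rho> ^ m < norm x"
    using real_arch_pow_inv[of "norm x" \<rho>] assms rho_less_1 by auto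
  moreover have "norm x \<le> \<rho> ^ m * norm (y m)" using norm_pow_le[of m "y m"] y by simp
  ultimately have "\<rho> ^ m * 1 < \<rho> ^ m * norm (y m)" by simp
  then have ex: "\<exists>m. norm (y m) > 1" using rho_pos by (metis mult_less_cancel_left_pos zero_less_power)
  define M where "M = (LEAST m. norm (y m) > 1)"
  have M: "norm (y M) > 1" "\<And>m. m < M \<Longrightarrow> norm (y m) \<le> 1"
    unfolding M_def using LeastI_ex[OF ex] not_less_Least by (auto simp: not_less[symmetric])
  have "y 0 = x" by (simp add: y_def)
  then obtain m where m: "M = Suc m" using M(1) assms by (cases M) auto
  show ?thesis
  proof
    show "x = (L ^^ m) (y m)" by (simp add: y)
    show "norm (y m) \<le> 1" using M m by simp
    have "\<mu> * 1 \<le> \<mu> * norm (y M)" using M mu_pos by simp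
    then show "\<mu> \<le> norm (y m)" using L_lower[of "y M"] ySuc[of m] m by simp
  qed
qed

lemma shell_decomposition_large:
  assumes "1 < norm x"
  obtains m where "\<mu> \<le> norm ((L ^^ m) x)" "norm ((L ^^ m) x) \<le> 1"
proof -
  obtain m where "\<rho> ^ m < 1 / norm x"
    using real_arch_pow_inv[of "1 / norm x" \<rho>] assms rho_less_1 by fastforce
  then have "\<rho> ^ m * norm x < 1 / norm x * norm x" using assms by (intro mult_strict_right_mono) auto
  then have "\<rho> ^ m * norm x < 1" using assms by (auto split: if_splits)
  then have ex: "\<exists>m. norm ((L ^^ m) x) \<le> 1" using norm_pow_le[of m x] by (intro exI[of _ m]) linarith
  define M where "M = (LEAST m. norm ((L ^^ m) x) \<le> 1)"
  have M: "norm ((L ^^ M) x) \<le> 1" "\<And>m. m < M \<Longrightarrow> norm ((L ^^ m) x) > 1"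
    unfolding M_def using LeastI_ex[OF ex] not_less_Least by (auto simp: not_le[symmetric])
  obtain m where m: "M = Suc m" using M(1) assms by (cases M) auto
  have "\<mu> * 1 \<le> \<mu> * norm ((L ^^ m) x)" using M(2)[of m] m mu_pos by simp
  then have "\<mu> \<le> norm ((L ^^ M) x)" using L_lower[of "(L ^^ m) x"] m by simp
  with M show ?thesis using that by blast
qed

lemma Re_P_shell:
  obtains c where "0 < c" "\<And>\<theta>. \<mu> \<le> norm \<theta> \<Longrightarrow> norm \<theta> \<le> 1 \<Longrightarrow> c \<le> Re (P \<theta>)"
proof -
  define S where "S = cball (0 :: real ^ 'd) 1 - ball 0 \<mu>"
  have "compact S" unfolding S_def by (intro compact_diff) auto
  obtain b :: "real ^ 'd" where "b \<in> Basis" using nonempty_Basis by blast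
  then have "b \<in> S" using mu_less_1 by (simp add: S_def)
  moreover have "continuous_on S (\<lambda>x. Re (P x))"
    using P_cont continuous_on_subset by (intro continuous_on_Re) blast
  ultimately obtain w where w: "w \<in> S" "\<And>x. x \<in> S \<Longrightarrow> Re (P w) \<le> Re (P x)"
    using continuous_attains_inf[of S "\<lambda>x. Re (P x)"] \<open>compact S\<close> by blast
  have "w \<noteq> 0" using w mu_pos by (auto simp: S_def)
  then have "0 < Re (P w)" using Re_P_nonneg[of w] Re_P_definite[of w] by linarith
  with w show ?thesis using that[of "Re (P w)"] by (auto simp: S_def)
qed

lemma P_bounded:
  obtains C where "0 < C" "\<And>x. norm x \<le> r \<Longrightarrow> norm (P x) \<le> C"
proof -
  have "compact (P ` cball 0 r)"
    using P_cont continuous_on_subset by (intro compact_continuous_image) auto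
  then obtain C where "0 < C" "\<forall>x\<in>P ` cball 0 r. norm x \<le> C"
    using compact_imp_bounded bounded_pos by metis
  then show ?thesis using that by auto
qed

text \<open>
  A vector in the \<open>m\<close>-th shell has norm at most \<open>\<rho>\<^sup>m\<close>, while \<open>Re P\<close> is comparable to \<open>\<tau>\<^sup>m\<close> there;
  hence any \<open>K\<close> with \<open>\<rho>\<^sup>K \<le> \<tau>\<close> will do.  The next lemma is the same comparison on the outer shells.
\<close>

lemma Re_P_power_lower_bound:
  obtains c K where "0 < c" "1 \<le> K" "\<And>x. norm x \<le> 1 \<Longrightarrow> c * norm x ^ K \<le> Re (P x)"
proof -
  obtain c where c: "0 < c" "\<And>\<theta>. \<mu> \<le> norm \<theta> \<Longrightarrow> norm \<theta> \<le> 1 \<Longrightarrow> c \<le> Re (P \<theta>)"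
    using Re_P_shell by blast
  obtain K where K: "\<rho> ^ K < \<tau>" using real_arch_pow_inv[OF tau_pos rho_less_1] by blast
  have "K \<noteq> 0" using K tau_less_1 by (cases K) auto
  have "c * norm x ^ K \<le> Re (P x)" if x: "norm x \<le> 1" for x
  proof (cases "x = 0")
    case True then show ?thesis using \<open>K \<noteq> 0\<close> P_0 by (simp add: power_0_left)
  next
    case False
    then obtain m \<theta> where m: "x = (L ^^ m) \<theta>" "\<mu> \<le> norm \<theta>" "norm \<theta> \<le> 1"
      using shell_decomposition_small x by blast
    have "norm x \<le> \<rho> ^ m * 1"
      using norm_pow_le[of m \<theta>] m rho_pos mult_left_mono[of "norm \<theta>" 1 "\<rho> ^ m"]
      by (auto intro: order_trans)
    then have "norm x ^ K \<le> (\<rho> ^ m) ^ K" by (intro power_mono) auto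
    also have "\<dots> = (\<rho> ^ K) ^ m" by (simp add: power_mult[symmetric] mult.commute)
    also have "\<dots> \<le> \<tau> ^ m" using K rho_pos by (intro power_mono) auto
    finally have "c * norm x ^ K \<le> c * \<tau> ^ m" using c by simp
    also have "\<dots> \<le> Re (P \<theta>) * \<tau> ^ m" using c m tau_pos by (intro mult_right_mono) auto
    also have "\<dots> = Re (P x)" using m by (simp add: P_pow mult.commute flip: of_real_power)
    finally show ?thesis .
  qed
  with c \<open>K \<noteq> 0\<close> show ?thesis using that[of c K] by simp
qed

lemma Re_P_growth:
  obtains C b where "0 < C" "\<And>x. 1 + norm x \<le> C * (1 + Re (P x)) ^ b"
proof -
  obtain c where c: "0 < c" "\<And>\<theta>. \<mu> \<le> norm \<theta> \<Longrightarrow> norm \<theta> \<le> 1 \<Longrightarrow> c \<le> Re (P \<theta>)"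
    using Re_P_shell by blast
  obtain b where b: "\<tau> ^ b < \<mu>" using real_arch_pow_inv[OF mu_pos tau_less_1] by blast
  define C where "C = 2 + 2 * (1 / c) ^ b"
  have C: "2 \<le> C" using c by (simp add: C_def)
  have "1 + norm x \<le> C * (1 + Re (P x)) ^ b" for x
  proof (cases "norm x \<le> 1")
    case True
    have "2 * 1 \<le> C * (1 + Re (P x)) ^ b"
      using C Re_P_nonneg[of x] by (intro mult_mono one_le_power) auto
    then show ?thesis using True by simp
  next
    case False
    then obtain m where m: "\<mu> \<le> norm ((L ^^ m) x)" "norm ((L ^^ m) x) \<le> 1"
      using shell_decomposition_large by (metis not_le)
    have "(\<tau> ^ b) ^ m * norm x \<le> \<mu> ^ m * norm x"
      using b tau_pos by (intro mult_right_mono power_mono) auto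
    also have "\<dots> \<le> 1" using norm_pow_ge[of m x] m by simp
    finally have 1: "(\<tau> ^ m) ^ b * norm x \<le> 1" by (simp add: power_mult[symmetric] mult.commute)
    have "c \<le> \<tau> ^ m * Re (P x)" using c(2)[OF m] by (simp add: P_pow flip: of_real_power)
    then have "c ^ b \<le> (\<tau> ^ m * Re (P x)) ^ b" using c by (intro power_mono) auto
    then have "c ^ b * norm x \<le> (\<tau> ^ m) ^ b * norm x * Re (P x) ^ b"
      using mult_right_mono[of "c ^ b" "(\<tau> ^ m * Re (P x)) ^ b" "norm x"]
      by (simp add: power_mult_distrib mult_ac)
    also have "\<dots> \<le> 1 * Re (P x) ^ b" using 1 Re_P_nonneg by (intro mult_right_mono) auto
    finally have "norm x \<le> (1 / c) ^ b * Re (P x) ^ b" using c by (simp add: field_simps)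
    also have "\<dots> \<le> (1 / c) ^ b * (1 + Re (P x)) ^ b"
      using c Re_P_nonneg by (intro mult_left_mono power_mono) auto
    finally have "2 * norm x \<le> 2 * (1 / c) ^ b * (1 + Re (P x)) ^ b" by simp
    also have "\<dots> \<le> C * (1 + Re (P x)) ^ b"
      using Re_P_nonneg[of x] by (intro mult_right_mono) (auto simp: C_def)
    finally show ?thesis using False by simp
  qed
  with C show ?thesis using that[of C b] by force
qed

text \<open>
  The polynomial growth of \<open>Re P\<close> in the power \<open>b\<close> makes its exponential decay faster than any power of the norm.
  In sums over lattice points this plays the role of integrability.
\<close>

lemma exp_Re_P_decay:
  assumes c: "0 < c"
  obtains C where "0 < C" "\<And>x. exp (- (c * Re (P x))) \<le> C / (1 + norm x) ^ k"
proof -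
  obtain A b where A: "0 < A" "\<And>x. 1 + norm x \<le> A * (1 + Re (P x)) ^ b" using Re_P_growth by blast
  define m where "m = b * k"
  define C where "C = A ^ k * (fact m * exp c / c ^ m)"
  have "exp (- (c * Re (P x))) \<le> C / (1 + norm x) ^ k" for x
  proof -
    have R: "0 \<le> Re (P x)" by (rule Re_P_nonneg)
    have "(1 + norm x) ^ k \<le> (A * (1 + Re (P x)) ^ b) ^ k" by (intro power_mono A) simp
    also have "\<dots> = A ^ k * (1 + Re (P x)) ^ m"
      by (simp add: power_mult_distrib m_def power_mult)
    also have "\<dots> = A ^ k / c ^ m * (c * (1 + Re (P x))) ^ m"
      using c by (simp add: power_mult_distrib)
    also have "\<dots> \<le> A ^ k / c ^ m * (fact m * exp (c * (1 + Re (P x))))"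
      using A c R by (intro mult_left_mono power_le_fact_mult_exp) auto
    also have "\<dots> = C * exp (c * Re (P x))"
      by (simp add: C_def ring_distribs exp_add)
    finally have "(1 + norm x) ^ k * exp (- (c * Re (P x))) \<le> C"
      by (simp add: exp_minus field_simps)
    moreover have "0 < (1 + norm x) ^ k" by (simp add: add_pos_nonneg)
    ultimately show ?thesis by (simp add: field_simps)
  qed
  moreover have "0 < C" using A c by (simp add: C_def)
  ultimately show ?thesis using that by blast
qed

end

section \<open>Polynomials and exponential sums off the real axis\<close>

lemma poly_Lipschitz_at_0:
  fixes q :: "complex poly"
  obtains K where "0 < K" "\<And>z. norm z \<le> 1 \<Longrightarrow> norm (poly q z - poly q 0) \<le> K * norm z"
proof (cases q)
  case (pCons a r)
  have "compact (poly r ` cball 0 1)" by (intro compact_continuous_image continuous_intros) auto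
  then obtain K where K: "0 < K" "\<forall>x\<in>poly r ` cball 0 1. norm x \<le> K"
    using compact_imp_bounded bounded_pos by metis
  have "norm (poly q z - poly q 0) \<le> K * norm z" if "norm z \<le> 1" for z
  proof -
    have "poly q z - poly q 0 = poly r z * z" using pCons by simp
    then show ?thesis using K that by (auto simp: norm_mult intro!: mult_right_mono)
  qed
  with K show ?thesis using that by blast
qed

text \<open>Lagrange interpolation at nodes of \<open>[0, 1]\<close> turns a bound on that interval into bounds at complex
  points, with a constant that depends on the degree only.\<close>

lemma poly_Lipschitz_from_interval:
  obtains K :: real where "0 < K"
    "\<And>p M z. degree p \<le> N \<Longrightarrow> (\<And>s. 0 \<le> s \<Longrightarrow> s \<le> 1 \<Longrightarrow> norm (poly p (complex_of_real s)) \<le> M) \<Longrightarrow>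
      norm z \<le> 1 \<Longrightarrow> norm (poly p z - poly p 0) \<le> K * M * norm z"
proof -
  define s :: "nat \<Rightarrow> real" where "s = (\<lambda>j. real j / real (Suc N))"
  have s_inj: "s i = s j \<longleftrightarrow> i = j" for i j by (simp add: s_def)
  have s_range: "0 \<le> s j" "s j \<le> 1" if "j \<le> N" for j using that by (auto simp: s_def)
  define l :: "nat \<Rightarrow> complex poly" where
    "l = (\<lambda>j. \<Prod>i\<in>{..N} - {j}. smult (1 / (of_real (s j) - of_real (s i))) [:- of_real (s i), 1:])"
  have l_deg: "degree (l j) \<le> N" if "j \<le> N" for j
  proof -
    have lin: "degree (smult a [:b, 1:]) \<le> 1" for a b :: complex
      by (rule order_trans[OF degree_smult_le]) simp
    have "degree (l j) \<le> (\<Sum>i\<in>{..N} - {j}. 1)"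
      unfolding l_def
      by (rule order_trans[OF degree_prod_sum_le], simp, unfold o_def, rule sum_mono, rule lin)
    also have "\<dots> \<le> N" using that by simp
    finally show ?thesis .
  qed
  have l_self: "poly (l j) (of_real (s j)) = 1" for j
    unfolding l_def poly_prod by (intro prod.neutral) (auto simp: s_inj field_simps simp flip: of_real_diff)
  have l_other: "poly (l j) (of_real (s i)) = 0" if "i \<noteq> j" "i \<le> N" for i j
    unfolding l_def poly_prod using that by (intro prod_zero) (auto intro!: bexI[of _ i])
  have "\<forall>j. \<exists>K>0. \<forall>z. norm z \<le> 1 \<longrightarrow> norm (poly (l j) z - poly (l j) 0) \<le> K * norm z"
    using poly_Lipschitz_at_0 by metis
  then obtain K where K: "\<And>j. 0 < K j"
    "\<And>j z. norm z \<le> 1 \<Longrightarrow> norm (poly (l j) z - poly (l j) 0) \<le> K j * norm z" by metis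
  have "norm (poly p z - poly p 0) \<le> (\<Sum>j\<le>N. K j) * M * norm z"
    if p: "degree p \<le> N" and M: "\<And>t. 0 \<le> t \<Longrightarrow> t \<le> 1 \<Longrightarrow> norm (poly p (complex_of_real t)) \<le> M"
      and z: "norm z \<le> 1" for p M z
  proof -
    define q where "q = (\<Sum>j\<le>N. smult (poly p (of_real (s j))) (l j))"
    have "p = q"
    proof (rule poly_eqI_degree[of "(\<lambda>j. of_real (s j)) ` {..N}"])
      have card: "card ((\<lambda>j. complex_of_real (s j)) ` {..N}) = Suc N"
        by (subst card_image) (auto simp: inj_on_def s_inj)
      show "degree p < card ((\<lambda>j. complex_of_real (s j)) ` {..N})" using p card by simp
      have "degree q \<le> N" unfolding q_def
        by (intro degree_sum_le) (auto intro: order_trans[OF degree_smult_le] l_deg)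
      then show "degree q < card ((\<lambda>j. complex_of_real (s j)) ` {..N})" using card by simp
      fix x assume "x \<in> (\<lambda>j. complex_of_real (s j)) ` {..N}"
      then obtain i where i: "i \<le> N" "x = of_real (s i)" by auto
      have "poly q x = (\<Sum>j\<le>N. poly p (of_real (s j)) * poly (l j) x)"
        by (simp add: q_def poly_sum)
      also have "\<dots> = (\<Sum>j\<le>N. if j = i then poly p x else 0)"
        using i by (intro sum.cong) (auto simp: l_self l_other)
      also have "\<dots> = poly p x" using i by simp
      finally show "poly p x = poly q x" by simp
    qed
    have pu: "poly p u = (\<Sum>j\<le>N. poly p (of_real (s j)) * poly (l j) u)" for u
    proof -
      have "poly p u = poly q u" using \<open>p = q\<close> by simp
      then show ?thesis by (simp add: q_def poly_sum)
    qed
    have "poly p z - poly p 0 = (\<Sum>j\<le>N. poly p (of_real (s j)) * (poly (l j) z - poly (l j) 0))"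
      unfolding pu[of z] pu[of 0] by (simp add: sum_subtractf right_diff_distrib)
    also have "norm \<dots> \<le> (\<Sum>j\<le>N. M * (K j * norm z))"
    proof (intro sum_norm_le)
      fix j assume "j \<in> {..N}"
      then have "norm (poly p (of_real (s j))) \<le> M" using M[of "s j"] s_range[of j] by simp
      then show "norm (poly p (of_real (s j)) * (poly (l j) z - poly (l j) 0)) \<le> M * (K j * norm z)"
        unfolding norm_mult using K(2)[OF z, of j]
        by (intro mult_mono) (auto intro: order_trans[OF norm_ge_zero])
    qed
    also have "\<dots> = (\<Sum>j\<le>N. K j) * M * norm z"
      by (simp add: sum_distrib_left sum_distrib_right mult_ac)
    finally show ?thesis .
  qed
  moreover have "0 < (\<Sum>j\<le>N. K j)" using K by (intro sum_pos) auto
  ultimately show ?thesis using that by blast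
qed

text \<open>
  Points of complex space occur only on complex lines \<open>\<xi> + z v\<close> with real \<open>\<xi>\<close> and \<open>v\<close>.  Functions there are
  written as functions of \<open>\<xi>\<close>, \<open>v\<close> and the complex number \<open>z\<close>, and all complex analysis is in one variable.
\<close>

abbreviation wave :: "real ^ 'd \<Rightarrow> real ^ 'd \<Rightarrow> real ^ 'd \<Rightarrow> complex \<Rightarrow> complex" where
  "wave y \<xi> v z \<equiv> exp (\<i> * (of_real (y \<bullet> \<xi>) + z * of_real (y \<bullet> v)))"

abbreviation character :: "real ^ 'd \<Rightarrow> real ^ 'd \<Rightarrow> complex" where
  "character y \<xi> \<equiv> exp (\<i> * of_real (y \<bullet> \<xi>))"

abbreviation drift :: "real ^ 'd \<Rightarrow> real ^ 'd \<Rightarrow> real ^ 'd \<Rightarrow> complex \<Rightarrow> complex" where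
  "drift \<alpha> \<xi> v z \<equiv> exp (- (\<i> * (of_real (\<alpha> \<bullet> \<xi>) + z * of_real (\<alpha> \<bullet> v))))"

definition expsum :: "'a set \<Rightarrow> ('a \<Rightarrow> complex) \<Rightarrow> ('a \<Rightarrow> real ^ 'd) \<Rightarrow> real ^ 'd \<Rightarrow> real ^ 'd \<Rightarrow> complex \<Rightarrow> complex"
  where "expsum S a y \<xi> v z =
    (\<Sum>x\<in>S. a x * wave (y x) \<xi> v z)"

lemma expsum_of_real: "expsum S a y \<xi> v (of_real s) = expsum S a y (\<xi> + s *\<^sub>R v) 0 0"
  by (simp add: expsum_def inner_add_right)

text \<open>
  Both \<open>\<xi>\<close> and \<open>v\<close> are of size \<open>t\<close>, so the degree \<open>N\<close> Taylor polynomial of every exponential, taken jointly in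
  \<open>\<xi>\<close> and \<open>v\<close>, is a polynomial in \<open>z\<close> of degree at most \<open>N\<close> with an error \<open>O (t\<^bsup>N+1\<^esup>)\<close> on the unit disc.
\<close>

lemma expsum_Taylor:
  assumes "finite S"
  obtains C where "0 < C"
    "\<And>\<xi> v t. norm \<xi> \<le> t \<Longrightarrow> norm v \<le> t \<Longrightarrow> t \<le> 1 \<Longrightarrow>
      \<exists>p. degree p \<le> N \<and> (\<forall>z. norm z \<le> 1 \<longrightarrow> norm (expsum S a y \<xi> v z - poly p z) \<le> C * t ^ Suc N)"
proof -
  obtain Y where Y: "0 < Y" "\<And>x. x \<in> S \<Longrightarrow> norm (y x) \<le> Y"
  proof -
    have "bounded (y ` S)" using assms by (simp add: finite_imp_bounded)
    then show ?thesis using that bounded_pos by (metis imageI)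
  qed
  define D where "D = exp (2 * Y) * (2 * Y) ^ Suc N / fact N"
  define C where "C = 1 + (\<Sum>x\<in>S. norm (a x) * D)"
  have "D > 0" using Y by (simp add: D_def)
  show ?thesis
  proof
    show "0 < C" unfolding C_def using \<open>D > 0\<close> by (intro add_pos_nonneg sum_nonneg) auto
    fix \<xi> v :: "real ^ 'b" and t :: real assume t: "norm \<xi> \<le> t" "norm v \<le> t" "t \<le> 1"
    then have "0 \<le> t" using norm_ge_zero order_trans by blast
    define p where "p = (\<Sum>x\<in>S. smult (a x) (\<Sum>j\<le>N. smult (1 / fact j)
      ([:\<i> * of_real (y x \<bullet> \<xi>), \<i> * of_real (y x \<bullet> v):] ^ j)))"
    have "degree ([:b, c:] ^ j) \<le> N" if "j \<le> N" for b c :: complex and j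
    proof -
      have "degree ([:b, c:] ^ j) \<le> degree [:b, c:] * j" by (rule degree_power_le)
      also have "\<dots> \<le> 1 * j" by (intro mult_right_mono) auto
      finally show ?thesis using that by simp
    qed
    then have "degree p \<le> N" unfolding p_def
      by (intro degree_sum_le order_trans[OF degree_smult_le]) (auto simp: assms)
    moreover have "norm (expsum S a y \<xi> v z - poly p z) \<le> C * t ^ Suc N" if z: "norm z \<le> 1" for z
    proof -
      define w where "w = (\<lambda>x. \<i> * (of_real (y x \<bullet> \<xi>) + z * of_real (y x \<bullet> v)))"
      have w: "norm (w x) \<le> 2 * Y * t" if "x \<in> S" for x
      proof -
        have *: "\<bar>y x \<bullet> u\<bar> \<le> Y * t" if "norm u \<le> t" for u
          using Cauchy_Schwarz_ineq2[of "y x" u] Y that \<open>x \<in> S\<close> \<open>0 \<le> t\<close>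
          by (meson mult_mono norm_ge_zero order_trans)
        have "norm (w x) \<le> \<bar>y x \<bullet> \<xi>\<bar> + norm z * \<bar>y x \<bullet> v\<bar>"
          unfolding w_def norm_mult by (simp add: norm_mult) (metis norm_mult norm_of_real norm_triangle_ineq)
        also have "\<dots> \<le> Y * t + 1 * (Y * t)" using * t z Y \<open>0 \<le> t\<close> by (intro add_mono mult_mono) auto
        finally show ?thesis by simp
      qed
      have "expsum S a y \<xi> v z - poly p z = (\<Sum>x\<in>S. a x * (exp (w x) - (\<Sum>j\<le>N. w x ^ j / fact j)))"
        by (simp add: expsum_def p_def poly_sum w_def sum_subtractf ring_distribs mult_ac)
      also have "norm \<dots> \<le> (\<Sum>x\<in>S. norm (a x) * D * t ^ Suc N)"
      proof (intro sum_norm_le)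
        fix x assume x: "x \<in> S"
        have "norm (exp (w x) - (\<Sum>j\<le>N. w x ^ j / fact j)) \<le> exp (norm (w x)) * norm (w x) ^ Suc N / fact N"
          by (rule Taylor_exp_field)
        also have "\<dots> \<le> exp (2 * Y) * (2 * Y * t) ^ Suc N / fact N"
        proof (intro divide_right_mono mult_mono power_mono)
          have "2 * Y * t \<le> 2 * Y * 1" using t Y by (intro mult_left_mono) auto
          then show "exp (norm (w x)) \<le> exp (2 * Y)" using w[OF x] by simp
        qed (use w[OF x] in auto)
        also have "\<dots> = D * t ^ Suc N" by (simp add: D_def power_mult_distrib)
        finally show "norm (a x * (exp (w x) - (\<Sum>j\<le>N. w x ^ j / fact j))) \<le> norm (a x) * D * t ^ Suc N"
          unfolding norm_mult by (simp add: mult_left_mono mult.assoc)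
      qed
      also have "\<dots> \<le> C * t ^ Suc N"
        using \<open>0 \<le> t\<close> by (simp add: C_def ring_distribs sum_distrib_right)
      finally show ?thesis .
    qed
    ultimately show "\<exists>p. degree p \<le> N \<and>
        (\<forall>z. norm z \<le> 1 \<longrightarrow> norm (expsum S a y \<xi> v z - poly p z) \<le> C * t ^ Suc N)" by blast
  qed
qed

lemma expsum_has_field_derivative:
  "(expsum S a y \<xi> v has_field_derivative expsum S (\<lambda>x. a x * (\<i> * of_real (y x \<bullet> v))) y \<xi> v z) (at z)"
  unfolding expsum_def by (auto intro!: derivative_eq_intros sum.cong simp: mult_ac)

lemma expsum_higher_deriv:
  "(deriv ^^ s) (expsum S a y \<xi> v) = expsum S (\<lambda>x. a x * (\<i> * of_real (y x \<bullet> v)) ^ s) y \<xi> v"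
proof (induction s)
  case (Suc s)
  have "(deriv ^^ Suc s) (expsum S a y \<xi> v) = deriv (expsum S (\<lambda>x. a x * (\<i> * of_real (y x \<bullet> v)) ^ s) y \<xi> v)"
    using Suc by simp
  also have "\<dots> = expsum S (\<lambda>x. a x * (\<i> * of_real (y x \<bullet> v)) ^ Suc s) y \<xi> v"
    using DERIV_imp_deriv[OF expsum_has_field_derivative, of S "\<lambda>x. a x * (\<i> * of_real (y x \<bullet> v)) ^ s" y \<xi> v]
    by (auto simp: mult_ac)
  finally show ?case .
qed simp

text \<open>
  The coefficients on the left are those of the \<open>s\<close>-th directional derivative along \<open>v\<close>.  A bound on a circle in the
  complexified direction \<open>v\<close> thus controls sums that carry a polynomial weight.
\<close>

lemma expsum_Cauchy:
  assumes "0 < r" "\<And>z. norm z = r \<Longrightarrow> norm (expsum S a y \<xi> v z) \<le> B"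
  shows "norm (expsum S (\<lambda>x. a x * (\<i> * of_real (y x \<bullet> v)) ^ s) y \<xi> v 0) \<le> fact s * B / r ^ s"
proof -
  have hol: "expsum S a y \<xi> v holomorphic_on A" for A
    using expsum_has_field_derivative by (meson field_differentiable_at_within field_differentiable_def holomorphic_on_def)
  have "norm ((deriv ^^ s) (expsum S a y \<xi> v) 0) \<le> fact s * B / r ^ s"
    using assms by (intro Cauchy_inequality hol holomorphic_on_imp_continuous_on) auto
  then show ?thesis by (simp add: expsum_higher_deriv)
qed

section \<open>Powers of an exponential sum near a maximum of its modulus\<close>

context contracting_scaling
begin

text \<open>
  By homogeneity \<open>\<tau>\<^bsup>-m\<^esup> P (L\<^sup>m \<theta>) = P \<theta>\<close>, the remainder contributes \<open>\<tau>\<^bsup>-m\<^esup> o (\<tau>\<^sup>m)\<close>, and replacing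
  \<open>1 - exp w\<close> by \<open>- w\<close> costs \<open>O (\<tau>\<^bsup>2m\<^esup>)\<close> before rescaling.
\<close>

lemma rescaled_real_limit:
  assumes U: "open U" "0 \<in> U"
    and G: "\<And>x. x \<in> U \<Longrightarrow> G x = exp (\<Upsilon> x - P x)"
    and G0: "G 0 = 1"
    and o: "\<Upsilon> \<in> o[at 0](\<lambda>x. complex_of_real (Re (P x)))"
    and e: "0 < \<epsilon>"
  shows "\<exists>m0. \<forall>m\<ge>m0. \<forall>\<theta>. norm \<theta> \<le> 2 \<longrightarrow>
    norm ((1 - G ((L ^^ m) \<theta>)) / of_real (\<tau> ^ m) - P \<theta>) \<le> \<epsilon>"
proof -
  obtain C where C: "0 < C" "\<And>x. norm x \<le> 2 \<Longrightarrow> norm (P x) \<le> C" using P_bounded[of 2] by blast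
  define e' where "e' = min 1 (\<epsilon> / (2 * C))"
  have e': "0 < e'" "e' \<le> 1" "e' * C \<le> \<epsilon> / 2" using e C by (auto simp: e'_def min_def field_simps)
  have "eventually (\<lambda>x. norm (\<Upsilon> x) \<le> e' * norm (complex_of_real (Re (P x)))) (at 0)"
    using landau_o.smallD[OF o e'(1)] by simp
  moreover have "eventually (\<lambda>x. x \<in> U) (at 0)" using U by (simp add: eventually_at_topological) blast
  ultimately have "eventually (\<lambda>x. x \<in> U \<and> norm (\<Upsilon> x) \<le> e' * Re (P x)) (at 0)"
    by eventually_elim (simp add: Re_P_nonneg)
  then obtain r where r: "0 < r"
    "\<And>x. x \<noteq> 0 \<Longrightarrow> norm x < r \<Longrightarrow> x \<in> U \<and> norm (\<Upsilon> x) \<le> e' * Re (P x)"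
    unfolding eventually_at by (auto simp: dist_norm)
  obtain m1 where m1: "\<rho> ^ m1 < r / 2" using real_arch_pow_inv[of "r / 2" \<rho>] r rho_less_1 by auto
  obtain m2 where m2: "\<tau> ^ m2 < min (1 / (2 * C)) (\<epsilon> / (24 * C\<^sup>2))"
    using real_arch_pow_inv[of "min (1 / (2 * C)) (\<epsilon> / (24 * C\<^sup>2))" \<tau>] e C tau_less_1 by auto
  have "norm ((1 - G ((L ^^ m) \<theta>)) / of_real (\<tau> ^ m) - P \<theta>) \<le> \<epsilon>"
    if m: "max m1 m2 \<le> m" and th: "norm \<theta> \<le> 2" for m \<theta>
  proof (cases "\<theta> = 0")
    case True
    then show ?thesis using linear_0[OF linear_pow] G0 P_0 e by simp
  next
    case False
    define x where "x = (L ^^ m) \<theta>"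
    define T where "T = \<tau> ^ m"
    have T: "0 < T" using tau_pos by (simp add: T_def)
    have "T \<le> \<tau> ^ m2" unfolding T_def using m tau_pos tau_less_1 by (intro power_decreasing) auto
    then have "T \<le> 1 / (2 * C)" "T \<le> \<epsilon> / (24 * C\<^sup>2)" using m2 by auto
    then have T2: "2 * C * T \<le> 1" "12 * C\<^sup>2 * T \<le> \<epsilon> / 2" using C by (auto simp: field_simps)
    have "norm x \<le> \<rho> ^ m * norm \<theta>" unfolding x_def by (rule norm_pow_le)
    also have "\<dots> \<le> \<rho> ^ m1 * 2"
      using m th rho_pos rho_less_1 by (intro mult_mono power_decreasing) auto
    finally have "norm x < r" using m1 by simp
    moreover have "x \<noteq> 0" using False inj_eq[OF inj_pow[of m], of \<theta> 0] linear_0[OF linear_pow, of m]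
      by (simp add: x_def)
    ultimately have xU: "x \<in> U" and Ux: "norm (\<Upsilon> x) \<le> e' * Re (P x)" using r by auto
    have Px: "P x = of_real T * P \<theta>" by (simp add: x_def P_pow T_def)
    have P\<theta>: "norm (P \<theta>) \<le> C" using C th by simp
    then have R\<theta>: "Re (P \<theta>) \<le> C" using complex_Re_le_cmod order_trans by blast
    have Ux': "norm (\<Upsilon> x) \<le> T * (e' * C)"
    proof -
      have "e' * Re (P x) = T * (e' * Re (P \<theta>))" by (simp add: Px)
      also have "\<dots> \<le> T * (e' * C)" using T e' R\<theta> by (intro mult_left_mono) auto
      finally show ?thesis using Ux by linarith
    qed
    define w where "w = \<Upsilon> x - P x"
    have "norm w \<le> T * (e' * C) + T * C"
      unfolding w_def using Ux' P\<theta> T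
      by (intro order_trans[OF norm_triangle_ineq4] add_mono) (auto simp: Px norm_mult)
    also have "\<dots> \<le> 2 * C * T" using e' C T by (simp add: algebra_simps)
    finally have w: "norm w \<le> 2 * C * T" .
    have "norm (exp w - (\<Sum>i\<le>1. w ^ i / fact i)) \<le> exp (norm w) * norm w ^ Suc 1 / fact 1"
      by (rule Taylor_exp_field)
    then have "norm (exp w - (1 + w)) \<le> exp (norm w) * norm w ^ 2" by (simp add: power2_eq_square)
    also have "\<dots> \<le> 3 * (2 * C * T) ^ 2"
    proof (intro mult_mono power_mono w)
      have "exp (norm w) \<le> exp 1" using w T2 by simp
      then show "exp (norm w) \<le> 3" using exp_le by linarith
    qed auto
    finally have 1: "norm (exp w - (1 + w)) \<le> 12 * C\<^sup>2 * T * T" by (simp add: power2_eq_square mult_ac)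
    have "(1 - G x) / of_real T - P \<theta> = (- (exp w - (1 + w)) - \<Upsilon> x) / of_real T"
      using T G[OF xU] Px by (simp add: w_def field_simps)
    also have "norm \<dots> = norm (- (exp w - (1 + w)) - \<Upsilon> x) / T" using T by (simp add: norm_divide)
    also have "\<dots> \<le> (12 * C\<^sup>2 * T * T + T * (e' * C)) / T"
      using T 1 Ux' by (intro divide_right_mono order_trans[OF norm_triangle_ineq4] add_mono) (auto simp: norm_minus_commute)
    also have "\<dots> = 12 * C\<^sup>2 * T + e' * C" using T by (simp add: field_simps)
    also have "\<dots> \<le> \<epsilon>" using T2 e' by linarith
    finally show ?thesis by (simp add: x_def T_def)
  qed
  then show ?thesis by blast
qed

text \<open>
  The remainder \<open>\<Upsilon>\<close> is known to be small on real vectors only.  To reach complex points, \<open>1 - G\<close> is replaced by its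
  Taylor polynomial of a degree \<open>N\<close> with \<open>\<rho>\<^bsup>N+1\<^esup> < \<tau>\<close>, whose error stays small after division by \<open>\<tau>\<^sup>m\<close>.  The rescaled
  polynomials have bounded degree and are bounded on real segments by the preceding lemma, hence they vary by \<open>O (|z|)\<close>
  on a complex disc, uniformly in \<open>m\<close>.
\<close>

lemma rescaled_complex_limit:
  fixes y :: "'a \<Rightarrow> real ^ 'd"
  assumes S: "finite S"
    and U: "open U" "0 \<in> U"
    and G: "\<And>x. x \<in> U \<Longrightarrow> expsum S a y x 0 0 = exp (\<Upsilon> x - P x)"
    and G0: "expsum S a y 0 0 0 = 1"
    and o: "\<Upsilon> \<in> o[at 0](\<lambda>x. complex_of_real (Re (P x)))"
    and e: "0 < \<epsilon>"
  shows "\<exists>m0. \<exists>\<kappa>>0. \<kappa> \<le> 1 \<and> (\<forall>m\<ge>m0. \<forall>\<theta> v z. norm \<theta> \<le> 1 \<longrightarrow> norm v \<le> 1 \<longrightarrow> norm z \<le> \<kappa> \<longrightarrow>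
    norm ((1 - expsum S a y ((L ^^ m) \<theta>) ((L ^^ m) v) z) / of_real (\<tau> ^ m) - P \<theta>) \<le> \<epsilon>)"
proof -
  obtain C where C: "0 < C" "\<And>x. norm x \<le> 2 \<Longrightarrow> norm (P x) \<le> C" using P_bounded[of 2] by blast
  obtain N where N: "\<rho> ^ N < \<tau>" using real_arch_pow_inv[OF tau_pos rho_less_1] by blast
  define q where "q = \<rho> ^ Suc N / \<tau>"
  have "\<rho> ^ Suc N < \<tau>" using N rho_pos rho_less_1 by (simp add: mult_less_cancel_right1 le_less_trans[OF mult_left_le_one_le])
  then have q: "0 < q" "q < 1" using rho_pos tau_pos by (auto simp: q_def)
  obtain D where D: "0 < D"
    "\<And>\<xi> v t. norm \<xi> \<le> t \<Longrightarrow> norm v \<le> t \<Longrightarrow> t \<le> 1 \<Longrightarrow>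
      \<exists>p. degree p \<le> N \<and> (\<forall>z. norm z \<le> 1 \<longrightarrow> norm (expsum S a y \<xi> v z - poly p z) \<le> D * t ^ Suc N)"
    using expsum_Taylor[OF S, where a = a and y = y and N = N] by blast
  obtain K where K: "0 < K"
    "\<And>p M z. degree p \<le> N \<Longrightarrow> (\<And>s. 0 \<le> s \<Longrightarrow> s \<le> 1 \<Longrightarrow> norm (poly p (complex_of_real s)) \<le> M) \<Longrightarrow>
      norm z \<le> 1 \<Longrightarrow> norm (poly p z - poly p 0) \<le> K * M * norm z"
    using poly_Lipschitz_from_interval[where N = N] by blast
  define M where "M = C + \<epsilon> / 2"
  have M: "0 < M" using C e by (simp add: M_def)
  define \<kappa> where "\<kappa> = min 1 (\<epsilon> / (4 * K * M))"
  have \<kappa>: "0 < \<kappa>" "\<kappa> \<le> 1" "K * M * \<kappa> \<le> \<epsilon> / 4"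
    using K M e by (auto simp: \<kappa>_def min_def field_simps)
  obtain m1 where m1: "q ^ m1 < \<epsilon> / (4 * D)" using real_arch_pow_inv[of "\<epsilon> / (4 * D)" q] q e D by auto
  obtain m2 where m2: "\<And>m \<theta>. m \<ge> m2 \<Longrightarrow> norm \<theta> \<le> 2 \<Longrightarrow>
     norm ((1 - expsum S a y ((L ^^ m) \<theta>) 0 0) / of_real (\<tau> ^ m) - P \<theta>) \<le> \<epsilon> / 4"
    using rescaled_real_limit[OF U, of "\<lambda>x. expsum S a y x 0 0" \<Upsilon> "\<epsilon> / 4"] G G0 o e by auto
  have "norm ((1 - expsum S a y ((L ^^ m) \<theta>) ((L ^^ m) v) z) / of_real (\<tau> ^ m) - P \<theta>) \<le> \<epsilon>"
    if m: "max m1 m2 \<le> m" and th: "norm \<theta> \<le> 1" and v: "norm v \<le> 1" and z: "norm z \<le> \<kappa>" for m \<theta> v z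
  proof -
    define F where "F = (\<lambda>z. expsum S a y ((L ^^ m) \<theta>) ((L ^^ m) v) z)"
    define T where "T = complex_of_real (\<tau> ^ m)"
    have T: "T \<noteq> 0" "norm T = \<tau> ^ m" using tau_pos by (auto simp: T_def norm_power)
    have small: "norm ((L ^^ m) u) \<le> \<rho> ^ m" if "norm u \<le> 1" for u
      using norm_pow_le[of m u] mult_left_mono[OF that, of "\<rho> ^ m"] rho_pos
      by (auto intro: order_trans)
    have "\<rho> ^ m \<le> 1" using rho_pos rho_less_1 by (intro power_le_one) auto
    then obtain p where p: "degree p \<le> N"
      "\<And>z. norm z \<le> 1 \<Longrightarrow> norm (F z - poly p z) \<le> D * (\<rho> ^ m) ^ Suc N"
      using D(2)[OF small[OF th] small[OF v]] unfolding F_def by blast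
    define r where "r = smult (1 / T) (1 - p)"
    have r_deg: "degree r \<le> N"
      unfolding r_def by (intro order_trans[OF degree_smult_le] degree_diff_le p) simp
    have r: "norm ((1 - F z) / T - poly r z) \<le> \<epsilon> / 4" if "norm z \<le> 1" for z
    proof -
      have "(1 - F z) / T - poly r z = - (F z - poly p z) / T"
        using T by (simp add: r_def field_simps)
      also have "norm \<dots> = norm (F z - poly p z) / \<tau> ^ m" by (simp add: norm_divide T(2) norm_minus_commute)
      also have "\<dots> \<le> D * (\<rho> ^ m) ^ Suc N / \<tau> ^ m"
        using p(2)[OF that] tau_pos by (intro divide_right_mono) auto
      also have "(\<rho> ^ m) ^ Suc N = (\<rho> ^ Suc N) ^ m" by (simp only: power_mult[symmetric] mult.commute)
      also have "D * (\<rho> ^ Suc N) ^ m / \<tau> ^ m = D * q ^ m" by (simp add: q_def power_divide)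
      also have "\<dots> \<le> D * q ^ m1" using D q m by (intro mult_left_mono power_decreasing) auto
      also have "\<dots> \<le> \<epsilon> / 4" using m1 D by (simp add: field_simps)
      finally show ?thesis .
    qed
    have r0: "norm (poly r 0 - P \<theta>) \<le> \<epsilon> / 4 + \<epsilon> / 4"
    proof -
      have "F 0 = expsum S a y ((L ^^ m) \<theta>) 0 0" by (simp add: F_def expsum_def)
      then have "norm ((1 - F 0) / T - P \<theta>) \<le> \<epsilon> / 4" using m2[of m \<theta>] m th by (simp add: T_def)
      moreover have "norm ((1 - F 0) / T - poly r 0) \<le> \<epsilon> / 4" using r[of 0] by simp
      ultimately show ?thesis by norm
    qed
    have "norm (poly r z - poly r 0) \<le> K * M * norm z"
    proof (rule K(2)[OF r_deg])
      fix s :: real assume s: "0 \<le> s" "s \<le> 1"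
      have "F (of_real s) = expsum S a y ((L ^^ m) (\<theta> + s *\<^sub>R v)) 0 0"
        by (simp add: F_def expsum_of_real linear_add[OF linear_pow] linear_scale[OF linear_pow])
      moreover have 2: "norm (\<theta> + s *\<^sub>R v) \<le> 2"
      proof -
        have "norm (\<theta> + s *\<^sub>R v) \<le> norm \<theta> + s * norm v" using s by (metis abs_of_nonneg norm_scaleR norm_triangle_ineq)
        moreover have "s * norm v \<le> 1" using s v by (simp add: mult_le_one)
        ultimately show ?thesis using th by linarith
      qed
      ultimately have "norm ((1 - F (of_real s)) / T - P (\<theta> + s *\<^sub>R v)) \<le> \<epsilon> / 4"
        using m2[of m "\<theta> + s *\<^sub>R v"] m by (simp add: T_def)
      moreover have "norm (P (\<theta> + s *\<^sub>R v)) \<le> C" using C 2 by simp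
      moreover have "norm ((1 - F (of_real s)) / T - poly r (of_real s)) \<le> \<epsilon> / 4" using r s by simp
      ultimately show "norm (poly r (of_real s)) \<le> M"
        unfolding M_def by norm
    qed (use z \<kappa> in auto)
    also have "\<dots> \<le> K * M * \<kappa>" using K M z by (intro mult_left_mono) auto
    finally have "norm (poly r z - poly r 0) \<le> \<epsilon> / 4" using \<kappa> by linarith
    moreover have "norm ((1 - F z) / T - poly r z) \<le> \<epsilon> / 4" using r z \<kappa> by simp
    ultimately have "norm ((1 - F z) / T - P \<theta>) \<le> \<epsilon>" using r0 by norm
    then show ?thesis by (simp add: F_def T_def)
  qed
  with \<kappa> show ?thesis by blast
qed

text \<open>
  A vector \<open>\<xi>\<close> is written as \<open>L\<^sup>m \<theta>\<close> with \<open>\<theta>\<close> in the fundamental shell, unless this needs more than \<open>k\<close>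
  steps; then \<open>m = k\<close> and \<open>\<theta>\<close> is merely in the unit ball.  In the first case \<open>Re P \<theta>\<close> dominates the error in
  \<open>|G| \<le> 1 - \<tau>\<^sup>m (Re P \<theta> - 2 \<epsilon>)\<close>.  In the second case the error \<open>n \<tau>\<^sup>k \<epsilon>\<close> in the exponent is bounded.  In both cases
  the complex displacement \<open>z L\<^sup>k v\<close> equals \<open>z L\<^sup>m v'\<close> with \<open>|v'| \<le> 1\<close>, so it is small on the scale \<open>m\<close>.
\<close>

lemma power_estimate_near_maximum:
  fixes y :: "'a \<Rightarrow> real ^ 'd"
  assumes S: "finite S"
    and U: "open U" "0 \<in> U"
    and G: "\<And>x. x \<in> U \<Longrightarrow> expsum S a y x 0 0 = exp (\<Upsilon> x - P x)"
    and G0: "expsum S a y 0 0 0 = 1"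
    and o: "\<Upsilon> \<in> o[at 0](\<lambda>x. complex_of_real (Re (P x)))"
  shows "\<exists>\<delta>>0. \<exists>\<kappa>>0. \<exists>C>0. \<exists>k0. \<kappa> \<le> 1 \<and> (\<forall>k\<ge>k0. \<forall>n \<xi> v z.
    real n * \<tau> ^ Suc k \<le> 1 \<longrightarrow> norm \<xi> < \<delta> \<longrightarrow> norm v \<le> 1 \<longrightarrow> norm z \<le> \<kappa> \<longrightarrow>
    norm (expsum S a y \<xi> ((L ^^ k) v) z) ^ n \<le> C * exp (- (real n * Re (P \<xi>) / 2)))"
proof -
  obtain c where c: "0 < c" "\<And>\<theta>. \<mu> \<le> norm \<theta> \<Longrightarrow> norm \<theta> \<le> 1 \<Longrightarrow> c \<le> Re (P \<theta>)"
    using Re_P_shell by blast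
  obtain C where C: "0 < C" "\<And>x. norm x \<le> 1 \<Longrightarrow> norm (P x) \<le> C" using P_bounded[of 1] by blast
  \<comment> \<open>On the shell \<open>2 \<epsilon>\<close> is half of the lower bound \<open>c\<close> of \<open>Re P\<close>.\<close>
  define \<epsilon> where "\<epsilon> = c / 4"
  have e: "0 < \<epsilon>" using c by (simp add: \<epsilon>_def)
  obtain m1 \<kappa> where \<kappa>: "0 < \<kappa>" "\<kappa> \<le> 1" and m1: "\<And>m \<theta> v z. m \<ge> m1 \<Longrightarrow> norm \<theta> \<le> 1 \<Longrightarrow> norm v \<le> 1 \<Longrightarrow>
    norm z \<le> \<kappa> \<Longrightarrow> norm ((1 - expsum S a y ((L ^^ m) \<theta>) ((L ^^ m) v) z) / of_real (\<tau> ^ m) - P \<theta>) \<le> \<epsilon>"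
    using rescaled_complex_limit[OF S U G G0 o e] by blast
  obtain m2 where m2: "\<tau> ^ m2 < min (1 / C) (2 * \<epsilon> / C\<^sup>2)"
    using real_arch_pow_inv[of "min (1 / C) (2 * \<epsilon> / C\<^sup>2)" \<tau>] e C tau_less_1 by auto
  define m0 where "m0 = max m1 m2"
  have core: "norm (expsum S a y ((L ^^ m) \<theta>) ((L ^^ m) v) z) \<le> exp (- (\<tau> ^ m * (Re (P \<theta>) - 2 * \<epsilon>)))"
    if m: "m \<ge> m0" and th: "norm \<theta> \<le> 1" and v: "norm v \<le> 1" and z: "norm z \<le> \<kappa>" for m \<theta> v z
  proof -
    define F where "F = expsum S a y ((L ^^ m) \<theta>) ((L ^^ m) v) z"
    define T where "T = \<tau> ^ m"
    have T: "0 < T" using tau_pos by (simp add: T_def)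
    have "T \<le> \<tau> ^ m2" unfolding T_def using m tau_pos tau_less_1 by (intro power_decreasing) (auto simp: m0_def)
    then have "T \<le> 1 / C" "T \<le> 2 * \<epsilon> / C\<^sup>2" using m2 by auto
    then have T2: "T * C \<le> 1" "T * C\<^sup>2 \<le> 2 * \<epsilon>" using C by (auto simp: field_simps)
    define w where "w = of_real T * P \<theta>"
    have nw: "norm w \<le> T * C" using C(2)[OF th] T by (simp add: w_def norm_mult)
    have "norm ((1 - F) / of_real T - P \<theta>) \<le> \<epsilon>"
      using m1[of m \<theta> v z] m th v z by (simp add: F_def T_def m0_def)
    moreover have "(1 - F) / of_real T - P \<theta> = - (F - (1 - w)) / of_real T"
      using T by (simp add: w_def field_simps)
    ultimately have "norm (F - (1 - w)) / T \<le> \<epsilon>" using T by (simp add: norm_divide norm_minus_commute)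
    then have F1: "norm (F - (1 - w)) \<le> T * \<epsilon>" using T by (simp add: field_simps)
    have F2: "norm (1 - w) \<le> 1 - Re w + (T * C)\<^sup>2 / 2"
    proof (rule power2_le_imp_le)
      define h where "h = - Re w + (T * C)\<^sup>2 / 2"
      have h1: "1 + h = 1 - Re w + (T * C)\<^sup>2 / 2" by (simp add: h_def)
      have "(norm (1 - w))\<^sup>2 = 1 - 2 * Re w + (norm w)\<^sup>2"
        unfolding cmod_power2 by (simp add: power2_eq_square algebra_simps)
      also have "\<dots> \<le> 1 - 2 * Re w + (T * C)\<^sup>2" using nw by (simp add: power_mono)
      also have "\<dots> = 1 + 2 * h" by (simp add: h_def)
      also have "\<dots> \<le> (1 + h)\<^sup>2" by (simp add: power2_eq_square algebra_simps)
      finally show "(norm (1 - w))\<^sup>2 \<le> (1 - Re w + (T * C)\<^sup>2 / 2)\<^sup>2"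
        by (simp only: h1)
      have "Re w \<le> 1" using nw T2 complex_Re_le_cmod[of w] by linarith
      then show "0 \<le> 1 - Re w + (T * C)\<^sup>2 / 2" by simp
    qed
    have "norm F \<le> norm (1 - w) + norm (F - (1 - w))" by norm
    also have "\<dots> \<le> 1 - Re w + (T * C)\<^sup>2 / 2 + T * \<epsilon>" using F1 F2 by linarith
    also have "(T * C)\<^sup>2 / 2 = T * (T * C\<^sup>2) / 2" by (simp add: power2_eq_square)
    also have "1 - Re w + T * (T * C\<^sup>2) / 2 + T * \<epsilon> \<le> 1 - Re w + T * (2 * \<epsilon>) / 2 + T * \<epsilon>"
      using T2 T by simp
    also have "\<dots> = 1 + (- (T * (Re (P \<theta>) - 2 * \<epsilon>)))" by (simp add: w_def algebra_simps)
    also have "\<dots> \<le> exp (- (T * (Re (P \<theta>) - 2 * \<epsilon>)))" by (rule exp_ge_add_one_self)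
    finally show ?thesis by (simp add: F_def T_def)
  qed
  define \<delta> where "\<delta> = \<mu> ^ Suc m0"
  have \<delta>: "0 < \<delta>" "\<delta> \<le> 1" using mu_pos mu_less_1 by (auto simp: \<delta>_def power_le_one simp del: power_Suc)
  define D where "D = exp (2 * \<epsilon> / \<tau>)"
  have D: "1 \<le> D" using e tau_pos by (simp add: D_def)
  have "norm (expsum S a y \<xi> ((L ^^ k) v) z) ^ n \<le> D * exp (- (real n * Re (P \<xi>) / 2))"
    if k: "m0 \<le> k" and n: "real n * \<tau> ^ Suc k \<le> 1" and \<xi>: "norm \<xi> < \<delta>"
      and v: "norm v \<le> 1" and z: "norm z \<le> \<kappa>" for k n \<xi> v z
  proof -
    have "\<exists>m \<theta>. \<xi> = (L ^^ m) \<theta> \<and> m0 \<le> m \<and> m \<le> k \<and> norm \<theta> \<le> 1 \<and> (m = k \<or> \<mu> \<le> norm \<theta>)"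
    proof (cases "\<xi> = 0")
      case True
      then have "\<xi> = (L ^^ k) 0" using linear_0[OF linear_pow] by simp
      then show ?thesis using k by (intro exI[of _ k] exI[of _ 0]) auto
    next
      case False
      then obtain m \<theta> where m: "\<xi> = (L ^^ m) \<theta>" "\<mu> \<le> norm \<theta>" "norm \<theta> \<le> 1"
        using shell_decomposition_small \<xi> \<delta> by (metis less_imp_le order_trans)
      have "\<mu> ^ m * \<mu> \<le> \<mu> ^ m * norm \<theta>" using m mu_pos by (intro mult_left_mono) auto
      also have "\<dots> < \<mu> ^ Suc m0" using norm_pow_ge[of m \<theta>] \<xi> m by (simp add: \<delta>_def)
      finally have "\<mu> ^ Suc m < \<mu> ^ Suc m0" by (simp add: mult.commute)
      then have "m0 < m" using mu_pos mu_less_1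
        by (metis Suc_less_eq not_less power_decreasing less_imp_le)
      show ?thesis
      proof (cases "m \<le> k")
        case True
        with m \<open>m0 < m\<close> show ?thesis by (intro exI[of _ m] exI[of _ \<theta>]) auto
      next
        case False
        then have "\<xi> = (L ^^ k) ((L ^^ (m - k)) \<theta>)"
          using m(1) by (metis add_diff_inverse_nat comp_apply funpow_add nat_less_le not_le)
        moreover have "norm ((L ^^ (m - k)) \<theta>) \<le> 1" using norm_pow_le_norm m order_trans by blast
        ultimately show ?thesis using k by blast
      qed
    qed
    then obtain m \<theta> where m: "\<xi> = (L ^^ m) \<theta>" "m0 \<le> m" "m \<le> k" "norm \<theta> \<le> 1" "m = k \<or> \<mu> \<le> norm \<theta>"
      by blast
    define v' where "v' = (L ^^ (k - m)) v"
    have v': "norm v' \<le> 1" unfolding v'_def using norm_pow_le_norm v order_trans by blast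
    have Lk: "(L ^^ k) v = (L ^^ m) v'" unfolding v'_def
      using m(3) by (metis comp_apply funpow_add le_add_diff_inverse)
    have nonneg: "0 \<le> real n * \<tau> ^ m" using tau_pos by simp
    have "norm (expsum S a y \<xi> ((L ^^ k) v) z) ^ n \<le> exp (- (\<tau> ^ m * (Re (P \<theta>) - 2 * \<epsilon>))) ^ n"
      unfolding m(1) Lk using core[OF m(2) m(4) v' z] by (intro power_mono) auto
    also have "\<dots> = exp (- (real n * \<tau> ^ m * (Re (P \<theta>) - 2 * \<epsilon>)))"
      by (simp add: exp_of_nat_mult[symmetric] mult.assoc)
    also have "\<dots> \<le> exp (2 * \<epsilon> / \<tau> + - (real n * \<tau> ^ m * (Re (P \<theta>) / 2)))"
    proof -
      have "- (real n * \<tau> ^ m * (Re (P \<theta>) - 2 * \<epsilon>)) \<le> 2 * \<epsilon> / \<tau> + - (real n * \<tau> ^ m * (Re (P \<theta>) / 2))"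
      proof (cases "\<mu> \<le> norm \<theta>")
        case True
        then have "Re (P \<theta>) / 2 \<le> Re (P \<theta>) - 2 * \<epsilon>" using c(2)[of \<theta>] m by (simp add: \<epsilon>_def)
        then have "real n * \<tau> ^ m * (Re (P \<theta>) / 2) \<le> real n * \<tau> ^ m * (Re (P \<theta>) - 2 * \<epsilon>)"
          using nonneg by (rule mult_left_mono)
        moreover have "0 \<le> 2 * \<epsilon> / \<tau>" using e tau_pos by simp
        ultimately show ?thesis by linarith
      next
        case False
        then have "m = k" using m by simp
        then have "real n * \<tau> ^ m * (2 * \<epsilon>) \<le> 1 / \<tau> * (2 * \<epsilon>)"
          using n tau_pos e by (intro mult_right_mono) (auto simp: field_simps)
        moreover have "0 \<le> real n * \<tau> ^ m * (Re (P \<theta>) / 2)" using nonneg Re_P_nonneg[of \<theta>] by simp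
        ultimately show ?thesis by (simp add: algebra_simps)
      qed
      then show ?thesis by simp
    qed
    also have "\<dots> = D * exp (- (real n * Re (P \<xi>) / 2))"
      unfolding D_def exp_add m(1) P_pow by (simp add: mult_ac flip: of_real_power)
    finally show ?thesis .
  qed
  with \<delta> \<kappa> D show ?thesis by (intro exI[of _ \<delta>] conjI exI[of _ \<kappa>] exI[of _ D] exI[of _ m0]) auto
qed

end

section \<open>Trigonometric polynomials and convolution\<close>

text \<open>
  The holomorphic extension of the Fourier transform, evaluated at \<open>\<xi> + z v\<close>.
\<close>

definition ft :: "(int ^ 'd \<Rightarrow> complex) \<Rightarrow> real ^ 'd \<Rightarrow> real ^ 'd \<Rightarrow> complex \<Rightarrow> complex" where
  "ft \<psi> = expsum {x. \<psi> x \<noteq> 0} \<psi> real_vec"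

lemma real_vec_add: "real_vec (x + y) = real_vec x + real_vec y"
  by (simp add: real_vec_def vec_eq_iff)

lemma real_vec_diff: "real_vec (x - y) = real_vec x - real_vec y"
  by (simp add: real_vec_def vec_eq_iff)

lemma expsum_mono_neutral:
  assumes "finite S" "{x. a x \<noteq> 0} \<subseteq> S"
  shows "expsum {x. a x \<noteq> 0} a y \<xi> v z = expsum S a y \<xi> v z"
  unfolding expsum_def using assms by (intro sum.mono_neutral_left) auto

lemma ft_eq_expsum:
  assumes "finite S" "{x. \<psi> x \<noteq> 0} \<subseteq> S"
  shows "ft \<psi> \<xi> v z = expsum S \<psi> real_vec \<xi> v z"
  unfolding ft_def by (rule expsum_mono_neutral[OF assms])

lemma infsum_finite_support:
  fixes f :: "'a \<Rightarrow> 'b :: {topological_comm_monoid_add, t2_space}"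
  assumes "finite S" "\<And>x. x \<notin> S \<Longrightarrow> f x = 0"
  shows "(\<Sum>\<^sub>\<infinity>x. f x) = sum f S"
proof -
  have "(\<Sum>\<^sub>\<infinity>x. f x) = (\<Sum>\<^sub>\<infinity>x\<in>S. f x)"
    using assms(2) by (intro infsum_cong_neutral) auto
  then show ?thesis using assms(1) by simp
qed

lemma fourier_eq_ft:
  assumes "finitely_supported \<psi>"
  shows "fourier \<psi> \<xi> = ft \<psi> \<xi> 0 0"
  unfolding fourier_def ft_def expsum_def
  using assms by (subst infsum_finite_support[where S = "{x. \<psi> x \<noteq> 0}"]) (auto simp: finitely_supported_def)

lemma l1_norm_eq_sum:
  assumes "finite S" "{x. \<psi> x \<noteq> 0} \<subseteq> S"
  shows "l1_norm \<psi> = (\<Sum>x\<in>S. cmod (\<psi> x))"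
  unfolding l1_norm_def using assms by (intro infsum_finite_support) auto

lemma ft_conv:
  assumes "finitely_supported \<psi>" "finitely_supported \<phi>"
  shows "ft (conv \<psi> \<phi>) \<xi> v z = ft \<psi> \<xi> v z * ft \<phi> \<xi> v z"
proof -
  define A where "A = {x. \<psi> x \<noteq> 0}"
  define B where "B = {x. \<phi> x \<noteq> 0}"
  define e where "e = (\<lambda>x. wave (real_vec x) \<xi> v z)"
  have e_add: "e (x + y) = e x * e y" for x y
    by (simp add: e_def real_vec_add inner_add_left algebra_simps flip: exp_add)
  have fin: "finite A" "finite B" using assms by (auto simp: A_def B_def finitely_supported_def)
  define S where "S = (\<lambda>(a, b). a + b) ` (A \<times> B)"
  have S: "finite S" using fin by (simp add: S_def)
  have conv_eq: "conv \<psi> \<phi> x = (\<Sum>y\<in>B. \<psi> (x - y) * \<phi> y)" for x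
    unfolding conv_def using fin by (intro infsum_finite_support) (auto simp: B_def)
  have supp: "{x. conv \<psi> \<phi> x \<noteq> 0} \<subseteq> S"
  proof
    fix x assume "x \<in> {x. conv \<psi> \<phi> x \<noteq> 0}"
    then obtain y where "y \<in> B" "\<psi> (x - y) * \<phi> y \<noteq> 0"
      unfolding conv_eq mem_Collect_eq by (rule sum.not_neutral_contains_not_neutral)
    then have "(x - y, y) \<in> A \<times> B" by (auto simp: A_def)
    then have "(\<lambda>(a, b). a + b) (x - y, y) \<in> S" unfolding S_def by (rule imageI)
    then show "x \<in> S" by simp
  qed
  have "ft (conv \<psi> \<phi>) \<xi> v z = (\<Sum>x\<in>S. (\<Sum>y\<in>B. \<psi> (x - y) * \<phi> y) * e x)"
    unfolding ft_eq_expsum[OF S supp] expsum_def conv_eq e_def ..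
  also have "\<dots> = (\<Sum>y\<in>B. \<Sum>x\<in>S. \<psi> (x - y) * \<phi> y * e x)"
    unfolding sum_distrib_right by (rule sum.swap)
  also have "\<dots> = (\<Sum>y\<in>B. \<Sum>a\<in>A. \<psi> a * \<phi> y * e (a + y))"
  proof (rule sum.cong[OF refl])
    fix y assume y: "y \<in> B"
    have "(\<Sum>a\<in>A. \<psi> a * \<phi> y * e (a + y)) = (\<Sum>x\<in>(\<lambda>a. a + y) ` A. \<psi> (x - y) * \<phi> y * e x)"
      by (subst sum.reindex) (auto simp: inj_on_def)
    also have "\<dots> = (\<Sum>x\<in>S. \<psi> (x - y) * \<phi> y * e x)"
    proof (intro sum.mono_neutral_left S ballI)
      show "(\<lambda>a. a + y) ` A \<subseteq> S" using y by (force simp: S_def)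
      fix x assume "x \<in> S - (\<lambda>a. a + y) ` A"
      then have "x - y \<notin> A" by (metis DiffD2 diff_add_cancel imageI)
      then show "\<psi> (x - y) * \<phi> y * e x = 0" by (simp add: A_def)
    qed
    finally show "(\<Sum>x\<in>S. \<psi> (x - y) * \<phi> y * e x) = (\<Sum>a\<in>A. \<psi> a * \<phi> y * e (a + y))" ..
  qed
  also have "\<dots> = (\<Sum>a\<in>A. \<psi> a * e a) * (\<Sum>y\<in>B. \<phi> y * e y)"
    unfolding sum_product by (subst sum.swap) (intro sum.cong refl, simp add: e_add)
  finally show ?thesis by (simp add: ft_def expsum_def e_def A_def B_def)
qed

lemma ft_conv_pow:
  assumes "finitely_supported \<phi>"
  shows "ft (conv_pow \<phi> (Suc n)) \<xi> v z = ft \<phi> \<xi> v z ^ Suc n"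
  by (induction n)
    (simp_all add: ft_conv assms finitely_supported_conv_pow mult.commute)

text \<open>
  Trigonometric polynomials are handled as functions rather than through their coefficients, so that ring identities
  between them can be checked pointwise.
\<close>

definition trig :: "(real ^ 'd \<Rightarrow> real ^ 'd \<Rightarrow> complex \<Rightarrow> complex) \<Rightarrow> bool" where
  "trig h \<longleftrightarrow> (\<exists>\<psi>. finitely_supported \<psi> \<and> (\<forall>\<xi> v z. ft \<psi> \<xi> v z = h \<xi> v z))"

lemma trig_ft: "finitely_supported \<psi> \<Longrightarrow> trig (ft \<psi>)"
  by (auto simp: trig_def)

lemma trig_monomial: "trig (\<lambda>\<xi> v z. c * wave (real_vec x) \<xi> v z)"
proof -
  define \<psi> where "\<psi> = (\<lambda>y. if y = x then c else 0)"
  have "{y. \<psi> y \<noteq> 0} \<subseteq> {x}" by (auto simp: \<psi>_def)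
  then have "finitely_supported \<psi>" and "ft \<psi> \<xi> v z = c * wave (real_vec x) \<xi> v z" for \<xi> v z
    by (auto simp: finitely_supported_def ft_eq_expsum[of "{x}"] expsum_def \<psi>_def intro: finite_subset)
  then show ?thesis by (auto simp: trig_def)
qed

lemma trig_const: "trig (\<lambda>\<xi> v z. c)"
  using trig_monomial[of c 0] by (simp add: real_vec_def zero_vec_def[symmetric])

lemma trig_coordinate: "trig (\<lambda>\<xi> v z. exp (\<i> * (of_real (\<xi> $ j) + z * of_real (v $ j))))"
proof -
  have "real_vec (axis j 1) = axis j 1" by (auto simp: real_vec_def vec_eq_iff axis_def)
  then show ?thesis using trig_monomial[of 1 "axis j 1"] by (simp add: inner_axis_axis inner_axis')
qed

lemma trig_add:
  assumes "trig g" "trig h"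
  shows "trig (\<lambda>\<xi> v z. g \<xi> v z + h \<xi> v z)"
proof -
  from assms obtain \<psi> \<phi> where *: "finitely_supported \<psi>" "\<And>\<xi> v z. ft \<psi> \<xi> v z = g \<xi> v z"
    "finitely_supported \<phi>" "\<And>\<xi> v z. ft \<phi> \<xi> v z = h \<xi> v z" unfolding trig_def by blast
  define S where "S = {x. \<psi> x \<noteq> 0} \<union> {x. \<phi> x \<noteq> 0}"
  have S: "finite S" "{x. \<psi> x \<noteq> 0} \<subseteq> S" "{x. \<phi> x \<noteq> 0} \<subseteq> S" "{x. \<psi> x + \<phi> x \<noteq> 0} \<subseteq> S"
    using * by (auto simp: S_def finitely_supported_def)
  have "ft (\<lambda>x. \<psi> x + \<phi> x) \<xi> v z = ft \<psi> \<xi> v z + ft \<phi> \<xi> v z" for \<xi> v z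
    by (simp add: ft_eq_expsum[OF S(1)] S expsum_def sum.distrib ring_distribs)
  moreover have "finitely_supported (\<lambda>x. \<psi> x + \<phi> x)"
    unfolding finitely_supported_def using S finite_subset by blast
  ultimately show ?thesis using * unfolding trig_def by metis
qed

lemma trig_mult:
  assumes "trig g" "trig h"
  shows "trig (\<lambda>\<xi> v z. g \<xi> v z * h \<xi> v z)"
  using assms unfolding trig_def by (metis ft_conv finitely_supported_conv)

lemma trig_sum:
  assumes "finite A" "\<And>i. i \<in> A \<Longrightarrow> trig (g i)"
  shows "trig (\<lambda>\<xi> v z. \<Sum>i\<in>A. g i \<xi> v z)"
  using assms by (induction A) (auto intro: trig_const trig_add)

lemma trig_power: "trig g \<Longrightarrow> trig (\<lambda>\<xi> v z. g \<xi> v z ^ n)"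
  by (induction n) (auto intro: trig_const trig_mult)

lemma expsum_bounded:
  fixes y :: "'a \<Rightarrow> real ^ 'd"
  assumes "finite S"
  obtains C where "0 < C" "\<And>\<xi> v z. norm v \<le> 1 \<Longrightarrow> norm z \<le> 1 \<Longrightarrow> norm (expsum S a y \<xi> v z) \<le> C"
proof
  define C where "C = 1 + (\<Sum>x\<in>S. norm (a x) * exp (norm (y x)))"
  show "0 < C" unfolding C_def by (intro add_pos_nonneg sum_nonneg) auto
  fix \<xi> v :: "real ^ 'd" and z :: complex assume v: "norm v \<le> 1" and z: "norm z \<le> 1"
  have "norm (expsum S a y \<xi> v z) \<le> (\<Sum>x\<in>S. norm (a x) * exp (norm (y x)))"
    unfolding expsum_def
  proof (intro sum_norm_le)
    fix x assume "x \<in> S"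
    have "\<bar>Im z * (y x \<bullet> v)\<bar> \<le> 1 * (norm (y x) * 1)"
      unfolding abs_mult
    proof (rule mult_mono)
      show "\<bar>Im z\<bar> \<le> 1" using z abs_Im_le_cmod[of z] by linarith
      show "\<bar>y x \<bullet> v\<bar> \<le> norm (y x) * 1"
        using Cauchy_Schwarz_ineq2[of "y x" v] mult_left_mono[OF v, of "norm (y x)"] by simp
    qed auto
    then have "- (Im z * (y x \<bullet> v)) \<le> norm (y x)" by simp
    then show "norm (a x * wave (y x) \<xi> v z) \<le> norm (a x) * exp (norm (y x))"
      by (simp add: norm_mult mult_left_mono)
  qed
  then show "norm (expsum S a y \<xi> v z) \<le> C" by (simp add: C_def)
qed

section \<open>Partitions of unity by trigonometric polynomials\<close>

text \<open>
  The order of vanishing includes the complex direction \<open>z\<close>, because Cauchy's inequality will be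
  applied on discs around real points.  The bound is required for all real \<open>\<xi>\<close>, which makes order \<open>0\<close> mean boundedness on a strip.
\<close>

definition vanish :: "nat \<Rightarrow> real ^ 'd \<Rightarrow> (real ^ 'd \<Rightarrow> real ^ 'd \<Rightarrow> complex \<Rightarrow> complex) \<Rightarrow> bool" where
  "vanish M p h \<longleftrightarrow> (\<exists>C\<ge>0. \<forall>\<xi> v z. norm v \<le> 1 \<longrightarrow> norm z \<le> 1 \<longrightarrow>
     norm (h \<xi> v z) \<le> C * (norm (\<xi> - p) + norm z) ^ M)"

lemma vanish_0:
  assumes "trig h" shows "vanish 0 p h"
proof -
  from assms obtain \<psi> where \<psi>: "finitely_supported \<psi>" "\<And>\<xi> v z. ft \<psi> \<xi> v z = h \<xi> v z"
    unfolding trig_def by blast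
  then obtain C where "0 < C" "\<And>\<xi> v z. norm v \<le> 1 \<Longrightarrow> norm z \<le> 1 \<Longrightarrow> norm (h \<xi> v z) \<le> C"
    unfolding \<psi>(2)[symmetric] ft_def finitely_supported_def using expsum_bounded by metis
  then show ?thesis unfolding vanish_def by (intro exI[of _ C]) auto
qed

lemma vanish_add:
  assumes "vanish M p g" "vanish M p h"
  shows "vanish M p (\<lambda>\<xi> v z. g \<xi> v z + h \<xi> v z)"
proof -
  from assms obtain C D where C: "C \<ge> 0" "\<And>\<xi> v z. norm v \<le> 1 \<Longrightarrow> norm z \<le> 1 \<Longrightarrow>
      norm (g \<xi> v z) \<le> C * (norm (\<xi> - p) + norm z) ^ M"
    and D: "D \<ge> 0" "\<And>\<xi> v z. norm v \<le> 1 \<Longrightarrow> norm z \<le> 1 \<Longrightarrow>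
      norm (h \<xi> v z) \<le> D * (norm (\<xi> - p) + norm z) ^ M"
    unfolding vanish_def by blast
  have "norm (g \<xi> v z + h \<xi> v z) \<le> (C + D) * (norm (\<xi> - p) + norm z) ^ M"
    if "norm v \<le> 1" "norm z \<le> 1" for \<xi> v z
    using norm_triangle_le[OF add_mono[OF C(2)[OF that] D(2)[OF that]]] by (simp add: distrib_right)
  then show ?thesis unfolding vanish_def using C(1) D(1) by (intro exI[of _ "C + D"]) auto
qed

lemma vanish_mult:
  assumes "vanish M p g" "vanish M' p h"
  shows "vanish (M + M') p (\<lambda>\<xi> v z. g \<xi> v z * h \<xi> v z)"
proof -
  from assms obtain C D where C: "C \<ge> 0" "\<And>\<xi> v z. norm v \<le> 1 \<Longrightarrow> norm z \<le> 1 \<Longrightarrow>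
      norm (g \<xi> v z) \<le> C * (norm (\<xi> - p) + norm z) ^ M"
    and D: "D \<ge> 0" "\<And>\<xi> v z. norm v \<le> 1 \<Longrightarrow> norm z \<le> 1 \<Longrightarrow>
      norm (h \<xi> v z) \<le> D * (norm (\<xi> - p) + norm z) ^ M'"
    unfolding vanish_def by blast
  have "norm (g \<xi> v z * h \<xi> v z) \<le> (C * D) * (norm (\<xi> - p) + norm z) ^ (M + M')"
    if "norm v \<le> 1" "norm z \<le> 1" for \<xi> v z
  proof -
    have "norm (g \<xi> v z * h \<xi> v z) \<le> (C * (norm (\<xi> - p) + norm z) ^ M) * (D * (norm (\<xi> - p) + norm z) ^ M')"
      unfolding norm_mult using C(1) by (intro mult_mono C(2) D(2) that) auto
    then show ?thesis by (simp add: power_add mult_ac)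
  qed
  then show ?thesis unfolding vanish_def using C(1) D(1) by (intro exI[of _ "C * D"]) auto
qed

lemma vanish_mult_trig:
  assumes "vanish M p g" "trig h"
  shows "vanish M p (\<lambda>\<xi> v z. g \<xi> v z * h \<xi> v z)"
  using vanish_mult[OF assms(1) vanish_0[OF assms(2)]] by simp

lemma vanish_power: "vanish 1 p g \<Longrightarrow> vanish n p (\<lambda>\<xi> v z. g \<xi> v z ^ n)"
proof (induction n)
  case 0
  then show ?case unfolding vanish_def by (intro exI[of _ 1]) auto
next
  case (Suc n)
  show ?case using vanish_mult[OF Suc.prems Suc.IH[OF Suc.prems]] by simp
qed

lemma norm_exp_minus_1_le: "norm (exp w - 1) \<le> exp (norm w) * norm w" for w :: complex
  using Taylor_exp_field[of w 0] by simp

lemma vanish_coordinate: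
  "vanish 1 p (\<lambda>\<xi> v z. exp (\<i> * (of_real (\<xi> $ j) + z * of_real (v $ j))) - exp (\<i> * of_real (p $ j)))"
proof -
  have "norm (exp (\<i> * (of_real (\<xi> $ j) + z * of_real (v $ j))) - exp (\<i> * of_real (p $ j)))
      \<le> 3 * (norm (\<xi> - p) + norm z) ^ 1" if v: "norm v \<le> 1" and z: "norm z \<le> 1" for \<xi> v z
  proof -
    define s where "s = complex_of_real (\<xi> $ j - p $ j)"
    define w where "w = \<i> * (z * of_real (v $ j))"
    have w: "norm w \<le> norm z"
      using component_le_norm_cart[of v j] v by (simp add: w_def norm_mult mult_left_le)
    have "exp (\<i> * (of_real (\<xi> $ j) + z * of_real (v $ j))) - exp (\<i> * of_real (p $ j))
      = exp (\<i> * of_real (p $ j)) * (exp (\<i> * s) * (exp w - 1) + (exp (\<i> * s) - 1))"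
      by (simp add: s_def w_def algebra_simps flip: exp_add)
    also have "norm \<dots> = norm (exp (\<i> * s) * (exp w - 1) + (exp (\<i> * s) - 1))"
      by (simp add: norm_mult)
    also have "\<dots> \<le> norm (exp w - 1) + norm (exp (\<i> * s) - 1)"
      by (rule order_trans[OF norm_triangle_ineq]) (simp add: norm_mult s_def)
    also have "norm (exp w - 1) \<le> 3 * norm z"
    proof -
      have "norm (exp w - 1) \<le> exp (norm w) * norm w" by (rule norm_exp_minus_1_le)
      also have "\<dots> \<le> 3 * norm z"
      proof (intro mult_mono w)
        have "exp (norm w) \<le> exp 1" using w z by simp
        then show "exp (norm w) \<le> 3" using exp_le by linarith
      qed auto
      finally show ?thesis .
    qed
    also have "norm (exp (\<i> * s) - 1) \<le> norm (\<xi> - p)"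
    proof -
      have "norm (exp (\<i> * s) - 1) \<le> \<bar>\<xi> $ j - p $ j\<bar>"
        unfolding s_def dist_exp_i_1 using abs_sin_x_le_abs_x[of "(\<xi> $ j - p $ j) / 2"] by simp
      also have "\<dots> \<le> norm (\<xi> - p)" using component_le_norm_cart[of "\<xi> - p" j] by simp
      finally show ?thesis .
    qed
    finally show ?thesis
      using norm_ge_zero[of "\<xi> - p"] unfolding power_one_right distrib_left by linarith
  qed
  then show ?thesis unfolding vanish_def by (intro exI[of _ 3]) auto
qed

text \<open>
  The function \<open>1 - (1 - h)\<^sup>n\<close> is a multiple of \<open>h\<close>.
\<close>

lemma vanish_one_minus_power:
  fixes h :: "real ^ 'd \<Rightarrow> real ^ 'd \<Rightarrow> complex \<Rightarrow> complex"
  assumes "trig h" "vanish M p h"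
  shows "vanish M p (\<lambda>\<xi> v z. 1 - (1 - h \<xi> v z) ^ n)"
proof -
  have "trig (\<lambda>\<xi> v z. 1 + (- 1) * h \<xi> v z)"
    by (intro trig_add trig_mult trig_const assms)
  then have "trig (\<lambda>\<xi> v z. \<Sum>i<n. (1 - h \<xi> v z) ^ i)"
    by (intro trig_sum trig_power) auto
  then have "vanish M p (\<lambda>\<xi> v z. h \<xi> v z * (\<Sum>i<n. (1 - h \<xi> v z) ^ i))"
    by (rule vanish_mult_trig[OF assms(2)])
  moreover have "1 - (1 - h \<xi> v z) ^ n = h \<xi> v z * (\<Sum>i<n. (1 - h \<xi> v z) ^ i)" for \<xi> v z
    using one_diff_power_eq[of "1 - h \<xi> v z" n] by simp
  ultimately show ?thesis by simp
qed

lemma exp_i_torus_inj: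
  assumes "p \<in> torus" "q \<in> torus" "p \<noteq> q"
  obtains j where "exp (\<i> * complex_of_real (p $ j)) \<noteq> exp (\<i> * complex_of_real (q $ j))"
proof -
  from assms(3) obtain j where j: "p $ j \<noteq> q $ j" by (auto simp: vec_eq_iff)
  have "- pi < p $ j" "p $ j \<le> pi" "- pi < q $ j" "q $ j \<le> pi"
    using assms by (auto simp: torus_def)
  then have "\<bar>p $ j - q $ j\<bar> < 2 * pi" by (auto simp: abs_if)
  then have "exp (\<i> * complex_of_real (p $ j)) \<noteq> exp (\<i> * complex_of_real (q $ j))"
    using j exp_complex_eqI[of "\<i> * complex_of_real (p $ j)" "\<i> * complex_of_real (q $ j)"] by auto
  then show ?thesis using that by blast
qed

text \<open>
  Some coordinate exponential takes different values at \<open>p\<close> and \<open>q\<close>; an affine function \<open>a\<close> of it vanishes at \<open>q\<close>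
  and equals \<open>1\<close> at \<open>p\<close>.  Then \<open>(1 - a\<^sup>M)\<^sup>M\<close> is a multiple of \<open>(1 - a)\<^sup>M\<close>, and its complement to \<open>1\<close> is a
  multiple of \<open>a\<^sup>M\<close>.
\<close>

lemma trig_separation:
  fixes p q :: "real ^ 'd"
  assumes "p \<in> torus" "q \<in> torus" "p \<noteq> q"
  obtains u w where "trig u" "trig w" "\<And>\<xi> v z. u \<xi> v z + w \<xi> v z = 1" "vanish M q u" "vanish M p w"
proof -
  obtain j where j: "exp (\<i> * complex_of_real (p $ j)) \<noteq> exp (\<i> * complex_of_real (q $ j))"
    using exp_i_torus_inj[OF assms] .
  define c where "c = exp (\<i> * complex_of_real (p $ j)) - exp (\<i> * complex_of_real (q $ j))"
  have c: "c \<noteq> 0" using j by (simp add: c_def)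
  define e where "e = (\<lambda>(\<xi> :: real ^ 'd) (v :: real ^ 'd) z. exp (\<i> * (of_real (\<xi> $ j) + z * of_real (v $ j))))"
  define a where "a = (\<lambda>\<xi> v z. (e \<xi> v z - exp (\<i> * complex_of_real (q $ j))) * (1 / c))"
  define b where "b = (\<lambda>\<xi> v z. (e \<xi> v z - exp (\<i> * complex_of_real (p $ j))) * (- 1 / c))"
  have ab: "1 - a \<xi> v z = b \<xi> v z" for \<xi> v z
  proof -
    have gen: "x * (- 1 / c) = - x / c" for x by simp
    have eq: "c - (e \<xi> v z - exp (\<i> * complex_of_real (q $ j))) = - (e \<xi> v z - exp (\<i> * complex_of_real (p $ j)))"
      by (simp add: c_def)
    have "1 - a \<xi> v z = (c - (e \<xi> v z - exp (\<i> * complex_of_real (q $ j)))) / c"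
      using c by (simp add: a_def diff_divide_distrib)
    also have "\<dots> = b \<xi> v z" unfolding eq b_def by (rule gen[symmetric])
    finally show ?thesis .
  qed
  have e: "trig e" unfolding e_def by (rule trig_coordinate)
  have tr: "trig (\<lambda>\<xi> v z. (e \<xi> v z + (- k)) * l)" for k l
    by (intro trig_mult trig_add trig_const e)
  have ta: "trig a" unfolding a_def
    using tr[of "exp (\<i> * complex_of_real (q $ j))" "1 / c"] by (simp only: add_uminus_conv_diff)
  have tb: "trig b" unfolding b_def
    using tr[of "exp (\<i> * complex_of_real (p $ j))" "- 1 / c"] by (simp only: add_uminus_conv_diff)
  have va: "vanish 1 q a" unfolding a_def e_def
    by (intro vanish_mult_trig vanish_coordinate trig_const)
  have vb: "vanish 1 p b" unfolding b_def e_def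
    by (intro vanish_mult_trig vanish_coordinate trig_const)
  define w where "w = (\<lambda>\<xi> v z. (1 - a \<xi> v z ^ M) ^ M)"
  define u where "u = (\<lambda>\<xi> v z. 1 - w \<xi> v z)"
  have "vanish 1 p (\<lambda>\<xi> v z. 1 - (1 - b \<xi> v z) ^ M)" by (rule vanish_one_minus_power[OF tb vb])
  then have "vanish 1 p (\<lambda>\<xi> v z. 1 - a \<xi> v z ^ M)" by (simp add: ab[symmetric])
  then have vw: "vanish M p w" unfolding w_def by (rule vanish_power)
  have vu: "vanish M q u" unfolding u_def w_def
    by (rule vanish_one_minus_power[OF trig_power[OF ta] vanish_power[OF va]])
  have "trig (\<lambda>\<xi> v z. (1 + (- 1) * a \<xi> v z ^ M) ^ M)"
    by (intro trig_power trig_add trig_mult trig_const ta)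
  then have tw: "trig w" by (simp add: w_def)
  then have "trig (\<lambda>\<xi> v z. 1 + (- 1) * w \<xi> v z)"
    by (intro trig_add trig_mult trig_const)
  then have tu: "trig u" by (simp add: u_def)
  have "u \<xi> v z + w \<xi> v z = 1" for \<xi> v z by (simp add: u_def)
  then show ?thesis by (rule that[OF tu tw _ vu vw])
qed

text \<open>
  This is the Chinese remainder theorem for the \<open>M\<close>-th powers of the maximal ideals at the points of \<open>A\<close>.
  When a new point \<open>r\<close> is added, every old function \<open>\<eta> q\<close> is split by
  a separation \<open>u + w = 1\<close> of \<open>r\<close> and \<open>q\<close>; the parts \<open>\<eta> q * w\<close> vanish at all old points and together form the
  function of \<open>r\<close>.
\<close>

lemma trig_partition_of_unity:
  fixes A :: "(real ^ 'd) set"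
  assumes "finite A" "A \<noteq> {}" "A \<subseteq> torus"
  shows "\<exists>\<eta>. (\<forall>q\<in>A. trig (\<eta> q)) \<and> (\<forall>\<xi> v z. (\<Sum>q\<in>A. \<eta> q \<xi> v z) = 1) \<and>
    (\<forall>q\<in>A. \<forall>p\<in>A. p \<noteq> q \<longrightarrow> vanish M p (\<eta> q))"
  using assms
proof (induction A rule: finite_ne_induct)
  case (singleton q)
  then show ?case using trig_const by (intro exI[of _ "\<lambda>_ _ _ _. 1"]) auto
next
  case (insert r A)
  then obtain \<eta> where \<eta>: "\<And>q. q \<in> A \<Longrightarrow> trig (\<eta> q)" "\<And>\<xi> v z. (\<Sum>q\<in>A. \<eta> q \<xi> v z) = 1"
    "\<And>p q. p \<in> A \<Longrightarrow> q \<in> A \<Longrightarrow> p \<noteq> q \<Longrightarrow> vanish M p (\<eta> q)"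
    by (metis insert_subset)
  have "\<exists>u w. trig u \<and> trig w \<and> (\<forall>\<xi> v z. u \<xi> v z + w \<xi> v z = 1) \<and> vanish M r u \<and> vanish M q w"
    if "q \<in> A" for q
    using trig_separation[of q r M] insert that by (metis insert_subset subsetD)
  then obtain u w where uw: "\<And>q. q \<in> A \<Longrightarrow> trig (u q)" "\<And>q. q \<in> A \<Longrightarrow> trig (w q)"
    "\<And>q \<xi> v z. q \<in> A \<Longrightarrow> u q \<xi> v z + w q \<xi> v z = 1"
    "\<And>q. q \<in> A \<Longrightarrow> vanish M r (u q)" "\<And>q. q \<in> A \<Longrightarrow> vanish M q (w q)" by metis
  define X where "X = (\<lambda>q \<xi> v z. if q = r then \<Sum>q\<in>A. \<eta> q \<xi> v z * w q \<xi> v z else \<eta> q \<xi> v z * u q \<xi> v z)"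
  have Xr: "X r = (\<lambda>\<xi> v z. \<Sum>q\<in>A. \<eta> q \<xi> v z * w q \<xi> v z)" by (simp add: X_def)
  have XA: "X q = (\<lambda>\<xi> v z. \<eta> q \<xi> v z * u q \<xi> v z)" if "q \<in> A" for q
  proof -
    have "q \<noteq> r" using that insert.hyps by auto
    then show ?thesis by (simp add: X_def)
  qed
  have trig: "trig (X q)" if "q \<in> insert r A" for q
  proof (cases "q = r")
    case True
    then show ?thesis unfolding True Xr using insert \<eta> uw by (intro trig_sum trig_mult) auto
  next
    case False
    then have "q \<in> A" using that by simp
    then show ?thesis unfolding XA[OF \<open>q \<in> A\<close>] using \<eta> uw by (intro trig_mult) auto
  qed
  have sum: "(\<Sum>q\<in>insert r A. X q \<xi> v z) = 1" for \<xi> v z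
  proof -
    have "(\<Sum>q\<in>insert r A. X q \<xi> v z) = (\<Sum>q\<in>A. \<eta> q \<xi> v z * w q \<xi> v z) + (\<Sum>q\<in>A. \<eta> q \<xi> v z * u q \<xi> v z)"
      using insert by (simp add: Xr XA)
    also have "\<dots> = (\<Sum>q\<in>A. \<eta> q \<xi> v z * (u q \<xi> v z + w q \<xi> v z))"
      by (simp add: sum.distrib ring_distribs add.commute)
    also have "\<dots> = 1" using uw \<eta> by simp
    finally show ?thesis .
  qed
  have vsum: "vanish M p (\<lambda>\<xi> v z. \<Sum>q\<in>B. \<eta> q \<xi> v z * w q \<xi> v z)"
    if "finite B" "B \<subseteq> A" "p \<in> A" for B p
    using that
  proof (induction B rule: finite_induct)
    case empty
    then show ?case unfolding vanish_def by (intro exI[of _ 0]) auto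
  next
    case (insert q B)
    have "vanish M p (\<lambda>\<xi> v z. \<eta> q \<xi> v z * w q \<xi> v z)"
    proof (cases "p = q")
      case True
      have "vanish M p (\<lambda>\<xi> v z. w q \<xi> v z * \<eta> q \<xi> v z)"
        unfolding True using insert uw \<eta> by (intro vanish_mult_trig) auto
      then show ?thesis by (simp add: mult.commute)
    next
      case False
      then show ?thesis using insert uw \<eta> by (intro vanish_mult_trig) auto
    qed
    then show ?case using insert by (simp add: vanish_add)
  qed
  have "vanish M p (X q)" if "q \<in> insert r A" "p \<in> insert r A" "p \<noteq> q" for p q
  proof (cases "q = r")
    case True
    then have "p \<in> A" using that by auto
    then show ?thesis unfolding True Xr using vsum[OF insert.hyps(1) order_refl] by simp
  next
    case False
    then have q: "q \<in> A" using that by simp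
    show ?thesis
    proof (cases "p = r")
      case True
      have "vanish M r (\<lambda>\<xi> v z. u q \<xi> v z * \<eta> q \<xi> v z)"
        using q uw \<eta> by (intro vanish_mult_trig) auto
      then show ?thesis unfolding True XA[OF q] by (simp add: mult.commute)
    next
      case False
      then show ?thesis unfolding XA[OF q] using that q uw \<eta> by (intro vanish_mult_trig) auto
    qed
  qed
  with trig sum show ?case by blast
qed

section \<open>Parseval's identity on a finite grid\<close>

definition gbox :: "nat \<Rightarrow> (int ^ 'd) set" where
  "gbox N = {g. \<forall>i. 0 \<le> g $ i \<and> g $ i < int N}"

definition grid :: "nat \<Rightarrow> int ^ 'd \<Rightarrow> real ^ 'd" where
  "grid N g = (2 * pi / real N) *\<^sub>R real_vec g"

abbreviation period :: "int ^ 'd \<Rightarrow> real ^ 'd" where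
  "period m \<equiv> (2 * pi) *\<^sub>R real_vec m"

lemma gbox_bij: "bij_betw vec_lambda (PiE UNIV (\<lambda>_. {0..<int N})) (gbox N)"
proof (rule bij_betwI[where g = vec_nth])
  show "vec_lambda \<in> (UNIV \<rightarrow>\<^sub>E {0..<int N}) \<rightarrow> (gbox N :: (int ^ 'd) set)"
    by (auto simp: gbox_def PiE_def Pi_def)
  show "vec_nth \<in> (gbox N :: (int ^ 'd) set) \<rightarrow> UNIV \<rightarrow>\<^sub>E {0..<int N}"
    by (auto simp: gbox_def PiE_def Pi_def)
qed auto

lemma finite_gbox: "finite (gbox N :: (int ^ 'd) set)"
proof -
  have *: "bij_betw vec_lambda (PiE UNIV (\<lambda>_. {0..<int N})) (gbox N :: (int ^ 'd) set)"
    by (rule gbox_bij)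
  show ?thesis unfolding bij_betw_finite[OF *, symmetric] by (intro finite_PiE) auto
qed

lemma card_gbox: "card (gbox N :: (int ^ 'd) set) = N ^ CARD('d)"
proof -
  have "bij_betw vec_lambda (PiE UNIV (\<lambda>_. {0..<int N})) (gbox N :: (int ^ 'd) set)"
    by (rule gbox_bij)
  then show ?thesis using bij_betw_same_card by (fastforce simp: card_PiE)
qed

lemma root_of_unity_sum:
  assumes "0 < N"
  shows "(\<Sum>g\<in>{0..<int N}. exp (\<i> * (2 * pi * of_int m * of_int g / of_nat N))) =
    (if int N dvd m then of_nat N else 0)"
proof -
  define \<omega> where "\<omega> = exp (\<i> * (2 * complex_of_real pi * of_int m / of_nat N))"
  have "(\<Sum>g\<in>{0..<int N}. exp (\<i> * (2 * pi * of_int m * of_int g / of_nat N))) = (\<Sum>g\<in>int ` {..<N}. \<omega> ^ nat g)"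
  proof (rule sum.cong)
    show "{0..<int N} = int ` {..<N}" using image_int_atLeastLessThan[of 0 N] by (simp add: lessThan_atLeast0)
    fix g assume "g \<in> int ` {..<N}"
    then obtain k where k: "g = int k" by blast
    show "exp (\<i> * (2 * pi * of_int m * of_int g / of_nat N)) = \<omega> ^ nat g"
      unfolding \<omega>_def k by (simp add: exp_of_nat_mult[symmetric] algebra_simps)
  qed
  also have "\<dots> = (\<Sum>k<N. \<omega> ^ k)" by (subst sum.reindex) auto
  also have "\<dots> = (if int N dvd m then of_nat N else 0)"
  proof (cases "int N dvd m")
    case True
    then obtain k where k: "m = int N * k" by blast
    have "\<omega> = exp (2 * of_int k * complex_of_real pi * \<i>)"
      unfolding \<omega>_def k using assms by (simp add: algebra_simps)
    also have "\<dots> = 1" using exp_integer_2pi[of "of_int k"] by simp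
    finally show ?thesis using True by simp
  next
    case False
    have "\<omega> \<noteq> 1"
    proof
      assume "\<omega> = 1"
      then obtain k :: int where "2 * pi * of_int m / of_nat N = of_int (2 * k) * pi"
        unfolding \<omega>_def exp_eq_1 by auto
      then have "real_of_int m = of_int (k * int N)" using assms by (simp add: field_simps)
      then have "m = k * int N" by linarith
      with False show False by simp
    qed
    moreover have "\<omega> ^ N = 1"
    proof -
      have "\<omega> ^ N = exp (2 * of_int m * complex_of_real pi * \<i>)"
        unfolding \<omega>_def using assms by (simp add: exp_of_nat_mult[symmetric] algebra_simps)
      also have "\<dots> = 1" using exp_integer_2pi[of "of_int m"] by simp
      finally show ?thesis .
    qed
    ultimately show ?thesis using False by (simp add: geometric_sum)
  qed
  finally show ?thesis .
qed

lemma character_sum: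
  fixes m :: "int ^ 'd"
  assumes "0 < N"
  shows "(\<Sum>g\<in>gbox N. character (real_vec m) (grid N g)) =
    (if \<forall>i. int N dvd m $ i then of_nat (N ^ CARD('d)) else 0)"
proof -
  have "(\<Sum>g\<in>gbox N. character (real_vec m) (grid N g))
    = (\<Sum>f\<in>PiE UNIV (\<lambda>_. {0..<int N}). exp (\<i> * of_real (real_vec m \<bullet> grid N (vec_lambda f))))"
    by (rule sum.reindex_bij_betw[OF gbox_bij, symmetric])
  also have "\<dots> = (\<Sum>f\<in>PiE UNIV (\<lambda>_. {0..<int N}). \<Prod>i\<in>UNIV. exp (\<i> * (2 * pi * of_int (m $ i) * of_int (f i) / of_nat N)))"
    by (intro sum.cong refl)
      (simp add: grid_def real_vec_def inner_vec_def exp_sum[symmetric] sum_distrib_left mult_ac)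
  also have "\<dots> = (\<Prod>i\<in>UNIV. \<Sum>g\<in>{0..<int N}. exp (\<i> * (2 * pi * of_int (m $ i) * of_int g / of_nat N)))"
    by (rule prod_sum_PiE[symmetric]) auto
  also have "\<dots> = (\<Prod>i\<in>UNIV. if int N dvd m $ i then of_nat N else 0)"
    by (intro prod.cong refl root_of_unity_sum assms)
  also have "\<dots> = (if \<forall>i. int N dvd m $ i then of_nat (N ^ CARD('d)) else 0)"
    by auto
  finally show ?thesis .
qed

text \<open>
  On a grid of mesh \<open>2 \<pi> / N\<close> two characters are orthogonal unless they agree modulo \<open>N\<close>, and frequencies from a fixed
  finite set are distinct modulo every large \<open>N\<close>.
\<close>

lemma discrete_Parseval:
  fixes S :: "(int ^ 'd) set"
  assumes "finite S"
  obtains N0 where "0 < N0" "\<And>N c. N \<ge> N0 \<Longrightarrow>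
    (\<Sum>g\<in>gbox N. (norm (\<Sum>x\<in>S. c x * character (real_vec x) (grid N g)))\<^sup>2)
      = real N ^ CARD('d) * (\<Sum>x\<in>S. (norm (c x))\<^sup>2)"
proof -
  define T where "T = (\<Sum>x\<in>S. \<Sum>x'\<in>S. \<Sum>i\<in>UNIV. \<bar>x $ i - x' $ i\<bar>)"
  have "0 \<le> T" unfolding T_def by (intro sum_nonneg) auto
  define N0 where "N0 = Suc (nat T)"
  have N0T: "int N0 = 1 + T" using \<open>0 \<le> T\<close> by (simp add: N0_def)
  have N0: "\<bar>x $ i - x' $ i\<bar> < int N0" if "x \<in> S" "x' \<in> S" for x x' i
  proof -
    have "\<bar>x $ i - x' $ i\<bar> \<le> (\<Sum>i\<in>UNIV. \<bar>x $ i - x' $ i\<bar>)" by (rule member_le_sum) auto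
    also have "\<dots> \<le> (\<Sum>x'\<in>S. \<Sum>i\<in>UNIV. \<bar>x $ i - x' $ i\<bar>)"
      using that assms by (intro member_le_sum[of x' S "\<lambda>x'. \<Sum>i\<in>UNIV. \<bar>x $ i - x' $ i\<bar>"]) (auto intro: sum_nonneg)
    also have "\<dots> \<le> (\<Sum>x\<in>S. \<Sum>x'\<in>S. \<Sum>i\<in>UNIV. \<bar>x $ i - x' $ i\<bar>)"
      using that assms by (intro member_le_sum[of x S "\<lambda>x. \<Sum>x'\<in>S. \<Sum>i\<in>UNIV. \<bar>x $ i - x' $ i\<bar>"]) (auto intro!: sum_nonneg)
    finally show ?thesis using N0T unfolding T_def by linarith
  qed
  have "(\<Sum>g\<in>gbox N. (norm (\<Sum>x\<in>S. c x * character (real_vec x) (grid N g)))\<^sup>2)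
      = real N ^ CARD('d) * (\<Sum>x\<in>S. (norm (c x))\<^sup>2)" if N: "N \<ge> N0" for N and c :: "int ^ 'd \<Rightarrow> complex"
  proof -
    have "0 < N" using N by (simp add: N0_def)
    have dvd: "(\<forall>i. int N dvd (x - x') $ i) \<longleftrightarrow> x = x'" if "x \<in> S" "x' \<in> S" for x x'
    proof
      assume *: "\<forall>i. int N dvd (x - x') $ i"
      have "x $ i - x' $ i = 0" for i
        using N0[OF that, of i] N *[rule_format, of i] dvd_imp_le_int[of "x $ i - x' $ i" "int N"] by fastforce
      then show "x = x'" by (simp add: vec_eq_iff)
    qed auto
    have "complex_of_real (\<Sum>g\<in>gbox N. (norm (\<Sum>x\<in>S. c x * character (real_vec x) (grid N g)))\<^sup>2)
       = (\<Sum>g\<in>gbox N. \<Sum>x\<in>S. \<Sum>x'\<in>S. c x * cnj (c x') * character (real_vec (x - x')) (grid N g))"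
      unfolding of_real_sum complex_norm_square cnj_sum sum_product
      by (intro sum.cong refl) (simp add: exp_cnj real_vec_diff inner_diff_left right_diff_distrib exp_diff exp_minus divide_inverse mult_ac)
    also have "\<dots> = (\<Sum>x\<in>S. \<Sum>x'\<in>S. c x * cnj (c x') * (\<Sum>g\<in>gbox N. character (real_vec (x - x')) (grid N g)))"
      unfolding sum_distrib_left by (subst sum.swap, rule sum.cong[OF refl], rule sum.swap)
    also have "\<dots> = (\<Sum>x\<in>S. \<Sum>x'\<in>S. if x = x' then c x * cnj (c x') * of_nat (N ^ CARD('d)) else 0)"
      using dvd by (intro sum.cong refl) (simp add: character_sum[OF \<open>0 < N\<close>])
    also have "\<dots> = (\<Sum>x\<in>S. c x * cnj (c x) * of_nat (N ^ CARD('d)))" using assms by simp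
    also have "\<dots> = complex_of_real (real N ^ CARD('d) * (\<Sum>x\<in>S. (norm (c x))\<^sup>2))"
      unfolding of_real_mult of_real_sum complex_norm_square by (simp add: sum_distrib_left mult_ac)
    finally show ?thesis by (simp only: of_real_eq_iff)
  qed
  moreover have "0 < N0" by (simp add: N0_def)
  ultimately show ?thesis using that by blast
qed

lemma expsum_eq_0_imp_coefficient_eq_0:
  fixes c :: "int ^ 'd \<Rightarrow> complex"
  assumes "finite S" "{x. c x \<noteq> 0} \<subseteq> S" "\<And>\<xi>. expsum S c real_vec \<xi> 0 0 = 0"
  shows "c x = 0"
proof (cases "x \<in> S")
  case True
  obtain N0 where N0: "0 < N0" "\<And>N c. N \<ge> N0 \<Longrightarrow>
    (\<Sum>g\<in>gbox N. (norm (\<Sum>x\<in>S. c x * character (real_vec x) (grid N g)))\<^sup>2)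
      = real N ^ CARD('d) * (\<Sum>x\<in>S. (norm (c x))\<^sup>2)"
    using discrete_Parseval[OF assms(1)] by blast
  have "real N0 ^ CARD('d) * (\<Sum>x\<in>S. (norm (c x))\<^sup>2) = 0"
    using N0(2)[of N0 c] assms(3) by (simp add: expsum_def)
  then have "(\<Sum>x\<in>S. (norm (c x))\<^sup>2) = 0" using N0 by simp
  then have "(norm (c x))\<^sup>2 = 0" by (rule sum_nonneg_0[OF assms(1) zero_le_power2 _ True])
  then show ?thesis by simp
qed (use assms in blast)

section \<open>Counting lattice points in linear images of balls\<close>

text \<open>
  Numbering the coordinates by an initial segment of the natural numbers supplies the well-order by which linear maps are
  decomposed into elementary ones in the change of variables formula.  It changes neither determinants nor norms.
\<close>

typedef ('a :: finite) index = "{..<CARD('a)}"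
  by (intro exI[of _ 0]) simp

instance index :: (finite) finite
proof
  have "(UNIV :: 'a index set) = Abs_index ` {..<CARD('a)}"
    by (rule type_definition.Abs_image[OF type_definition_index, symmetric])
  then show "finite (UNIV :: 'a index set)" by (metis finite_imageI finite_lessThan)
qed

instantiation index :: (finite) wellorder
begin

definition less_eq_index :: "'a index \<Rightarrow> 'a index \<Rightarrow> bool" where
  "less_eq_index i j \<longleftrightarrow> Rep_index i \<le> Rep_index j"

definition less_index :: "'a index \<Rightarrow> 'a index \<Rightarrow> bool" where
  "less_index i j \<longleftrightarrow> Rep_index i < Rep_index j"

instance
proof
  fix i j k :: "'a index"
  show "i < j \<longleftrightarrow> i \<le> j \<and> \<not> j \<le> i" unfolding less_eq_index_def less_index_def by linarith
  show "i \<le> i" unfolding less_eq_index_def by simp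
  show "i \<le> k" if "i \<le> j" "j \<le> k" using that unfolding less_eq_index_def by simp
  show "i = j" if "i \<le> j" "j \<le> i"
    using that unfolding less_eq_index_def by (metis Rep_index_inject le_antisym)
  show "i \<le> j \<or> j \<le> i" unfolding less_eq_index_def by linarith
next
  fix P :: "'a index \<Rightarrow> bool" and a :: "'a index"
  assume step: "\<And>i. (\<And>j. j < i \<Longrightarrow> P j) \<Longrightarrow> P i"
  have "\<forall>i. Rep_index i = n \<longrightarrow> P i" for n
  proof (induction n rule: less_induct)
    case (less n)
    show ?case
    proof (intro allI impI)
      fix i :: "'a index" assume "Rep_index i = n"
      then show "P i" using less by (auto simp: less_index_def intro: step[of i])
    qed
  qed
  then show "P a" by blast
qed

end

lemma index_bij: "\<exists>f :: 'a :: finite index \<Rightarrow> 'a. bij f"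
proof -
  have "card (UNIV :: 'a index set) = card (UNIV :: 'a set)"
    unfolding type_definition.card[OF type_definition_index[where 'a = 'a]] by (rule card_lessThan)
  then have "\<exists>f. bij_betw f (UNIV :: 'a index set) (UNIV :: 'a set)"
    by (intro finite_same_card_bij finite)
  then show ?thesis by simp
qed

lemma det_reindex:
  fixes f :: "'a :: finite \<Rightarrow> 'b :: finite" and M :: "'c :: comm_ring_1 ^ 'b ^ 'b"
  assumes f: "bij f"
  shows "det (\<chi> i j. M $ f i $ f j) = det M"
proof -
  have inv_f: "inv f (f i) = i" "f (inv f k) = k" for i k
    using f by (simp_all add: bij_is_inj bij_is_surj surj_f_inv_f)
  define g where "g = (\<lambda>q. f \<circ> q \<circ> inv f)"
  have g_map: "g q = map_permutation UNIV f q" for q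
    using f by (simp add: g_def map_permutation_def restrict_id_def bij_is_surj o_def)
  have bij_g: "bij_betw g {q. q permutes UNIV} {p. p permutes UNIV}"
  proof (rule bij_betwI[where g = "\<lambda>p. inv f \<circ> p \<circ> f"])
    show "g \<in> {q. q permutes UNIV} \<rightarrow> {p. p permutes UNIV}"
      using f unfolding g_def permutes_altdef by (auto intro!: bij_comp bij_imp_bij_inv)
    show "(\<lambda>p. inv f \<circ> p \<circ> f) \<in> {p. p permutes UNIV} \<rightarrow> {q. q permutes UNIV}"
      using f unfolding permutes_altdef by (auto intro!: bij_comp bij_imp_bij_inv)
  qed (auto simp: g_def fun_eq_iff inv_f)
  have "det M = (\<Sum>q | q permutes (UNIV :: 'a set). of_int (sign (g q)) * (\<Prod>k\<in>UNIV. M $ k $ g q k))"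
    unfolding det_def by (rule sum.reindex_bij_betw[OF bij_g, symmetric])
  also have "\<dots> = (\<Sum>q | q permutes (UNIV :: 'a set). of_int (sign q) * (\<Prod>i\<in>UNIV. M $ f i $ f (q i)))"
  proof (rule sum.cong[OF refl])
    fix q :: "'a \<Rightarrow> 'a" assume "q \<in> {q. q permutes UNIV}"
    then have "sign (g q) = sign q"
      unfolding g_map using f by (intro sign_map_permutation) (auto simp: bij_is_inj)
    moreover have "(\<Prod>k\<in>UNIV. M $ k $ g q k) = (\<Prod>i\<in>UNIV. M $ f i $ g q (f i))"
      using f by (rule prod.reindex_bij_betw[symmetric])
    ultimately show "of_int (sign (g q)) * (\<Prod>k\<in>UNIV. M $ k $ g q k) =
        of_int (sign q) * (\<Prod>i\<in>UNIV. M $ f i $ f (q i))"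
      by (simp add: g_def inv_f)
  qed
  finally show ?thesis by (simp add: det_def)
qed

text \<open>
  The unit cubes at the lattice points are disjoint.  Their images under the contraction \<open>A\<close> have volume \<open>|det A|\<close> each and lie in
  a ball that is larger than the given one by a bound for the diameter of a cube.
\<close>

lemma lattice_count_wellorder:
  fixes A :: "real ^ 'n :: {finite, wellorder} \<Rightarrow> real ^ 'n :: _" and S :: "(int ^ 'n :: _) set"
  assumes A: "linear A" "\<And>x. norm (A x) \<le> norm x"
    and r: "0 \<le> r"
    and S: "finite S" "\<And>x. x \<in> S \<Longrightarrow> norm (A (real_vec x) - y) \<le> r"
  shows "\<bar>det (matrix A)\<bar> * card S \<le> unit_ball_vol (CARD('n :: _)) * (r + CARD('n :: _)) ^ CARD('n :: _)"
proof -
  define Q where "Q = (box 0 (vec 1) :: (real ^ 'n :: _) set)"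
  define T where "T = (\<lambda>x. (+) (real_vec x) ` Q)"
  have Q: "u \<in> Q \<longleftrightarrow> (\<forall>i. 0 < u $ i \<and> u $ i < 1)" for u by (simp add: Q_def mem_box_cart)
  have Qnorm: "norm u \<le> CARD('n)" if "u \<in> Q" for u
  proof -
    have "norm u \<le> (\<Sum>i\<in>UNIV. \<bar>u $ i\<bar>)" by (rule norm_le_l1_cart)
    also have "\<dots> \<le> (\<Sum>i\<in>(UNIV :: 'n set). 1)" using that by (intro sum_mono) (auto simp: Q less_imp_le)
    finally show ?thesis by simp
  qed
  have Tm: "T x \<in> lmeasurable" for x unfolding T_def Q_def by (intro measurable_translation) auto
  have "measure lebesgue Q = 1"
    unfolding Q_def
    by (subst measure_completion, simp, subst measure_lborel_box)
      (auto simp: Basis_vec_def inner_axis intro!: prod.neutral)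
  then have T1: "measure lebesgue (T x) = 1" for x unfolding T_def by (simp add: measure_translation)
  have disj: "pairwise (\<lambda>x x'. disjnt (T x) (T x')) S"
  proof (intro pairwiseI)
    fix x x' :: "int ^ 'n :: _" assume "x \<noteq> x'"
    then obtain i where i: "x $ i \<noteq> x' $ i" by (auto simp: vec_eq_iff)
    show "disjnt (T x) (T x')"
    proof (rule ccontr)
      assume "\<not> disjnt (T x) (T x')"
      then obtain u u' where u: "u \<in> Q" "u' \<in> Q" "real_vec x + u = real_vec x' + u'"
        by (auto simp: disjnt_def T_def)
      then have "of_int (x $ i) + u $ i = of_int (x' $ i) + u' $ i"
        by (metis real_vec_def vec_lambda_beta vector_add_component)
      moreover have "0 < u $ i" "u $ i < 1" "0 < u' $ i" "u' $ i < 1" using u Q by auto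
      ultimately have "\<bar>real_of_int (x $ i - x' $ i)\<bar> < 1" by auto
      then have "\<bar>x $ i - x' $ i\<bar> < 1" by linarith
      with i show False by simp
    qed
  qed
  define U where "U = (\<Union>x\<in>S. T x)"
  have Um: "U \<in> lmeasurable" unfolding U_def using S Tm by (intro fmeasurable.finite_UN) auto
  have "measure lebesgue U = card S"
    unfolding U_def using measure_UNION'[OF S(1) Tm disj] by (simp add: T1)
  then have "\<bar>det (matrix A)\<bar> * card S = measure lebesgue (A ` U)"
    using measure_linear_image[OF A(1) Um] by simp
  also have "\<dots> \<le> measure lebesgue (cball y (r + CARD('n)))"
  proof (rule measure_mono_fmeasurable)
    show "A ` U \<subseteq> cball y (r + CARD('n))"
    proof
      fix w assume "w \<in> A ` U"
      then obtain x u where x: "x \<in> S" "u \<in> Q" "w = A (real_vec x + u)" by (auto simp: U_def T_def)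
      have "w - y = (A (real_vec x) - y) + A u" using x by (simp add: linear_add[OF A(1)])
      then have "norm (w - y) \<le> norm (A (real_vec x) - y) + norm (A u)" by (metis norm_triangle_ineq)
      also have "\<dots> \<le> r + CARD('n)" using S(2)[OF x(1)] A(2)[of u] Qnorm[OF x(2)] by linarith
      finally show "w \<in> cball y (r + CARD('n))" by (simp add: dist_norm norm_minus_commute)
    qed
    show "A ` U \<in> sets lebesgue" using measurable_linear_image[OF A(1) Um] by auto
  qed auto
  also have "\<dots> = unit_ball_vol (CARD('n)) * (r + CARD('n)) ^ CARD('n)"
    using content_cball[of "r + CARD('n)" y] r by simp
  finally show ?thesis .
qed

lemma lattice_count:
  fixes A :: "real ^ 'd \<Rightarrow> real ^ 'd" and S :: "(int ^ 'd) set"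
  assumes A: "linear A" "\<And>x. norm (A x) \<le> norm x"
    and r: "0 \<le> r"
    and S: "finite S" "\<And>x. x \<in> S \<Longrightarrow> norm (A (real_vec x) - y) \<le> r"
  shows "\<bar>det (matrix A)\<bar> * card S \<le> unit_ball_vol (CARD('d)) * (r + CARD('d)) ^ CARD('d)"
proof -
  obtain f :: "'d index \<Rightarrow> 'd" where f: "bij f" using index_bij by blast
  have inv_f: "inv f (f i) = i" "f (inv f k) = k" for i k
    using f by (simp_all add: bij_is_inj bij_is_surj surj_f_inv_f)
  define \<Phi> where "\<Phi> = (\<lambda>x :: real ^ 'd. \<chi> i. x $ f i)"
  define \<Psi> where "\<Psi> = (\<lambda>x :: real ^ 'd index. \<chi> k. x $ inv f k)"
  define \<phi> where "\<phi> = (\<lambda>x :: int ^ 'd. \<chi> i. x $ f i)"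
  have lin: "linear \<Phi>" "linear \<Psi>" by (auto simp: \<Phi>_def \<Psi>_def vec_eq_iff intro!: linearI)
  have \<Psi>\<Phi>: "\<Psi> (\<Phi> x) = x" and \<Phi>\<Psi>: "\<Phi> (\<Psi> z) = z" for x z
    by (simp_all add: \<Phi>_def \<Psi>_def vec_eq_iff inv_f)
  have norm_\<Phi>: "norm (\<Phi> x) = norm x" for x
    unfolding norm_vec_def L2_set_def \<Phi>_def
    using sum.reindex_bij_betw[OF f, of "\<lambda>k. (norm (x $ k))\<^sup>2"] by simp
  have norm_\<Psi>: "norm (\<Psi> z) = norm z" for z using norm_\<Phi>[of "\<Psi> z"] \<Phi>\<Psi> by simp
  have \<Phi>_real_vec: "\<Phi> (real_vec x) = real_vec (\<phi> x)" for x
    by (simp add: \<Phi>_def \<phi>_def real_vec_def vec_eq_iff)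
  have inj_\<phi>: "inj \<phi>"
  proof (rule injI)
    fix x x' assume "\<phi> x = \<phi> x'"
    then have "x $ f i = x' $ f i" for i by (simp add: \<phi>_def vec_eq_iff)
    then show "x = x'" by (metis inv_f(2) vec_eq_iff)
  qed
  define A' where "A' = \<Phi> \<circ> (A \<circ> \<Psi>)"
  have A': "linear A'" unfolding A'_def by (intro linear_compose lin A)
  have "matrix A' = (\<chi> i j. matrix A $ f i $ f j)"
  proof -
    have ax: "\<Psi> (axis j 1) = axis (f j) 1" for j
      by (auto simp: \<Psi>_def vec_eq_iff axis_def inv_f)
    show ?thesis by (simp add: A'_def matrix_def \<Phi>_def ax)
  qed
  then have "det (matrix A') = det (matrix A)" using det_reindex[OF f] by simp
  moreover have "\<bar>det (matrix A')\<bar> * card (\<phi> ` S) \<le>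
    unit_ball_vol (CARD('d index)) * (r + CARD('d index)) ^ CARD('d index)"
  proof (rule lattice_count_wellorder[OF A' _ r, where y = "\<Phi> y"])
    show "norm (A' z) \<le> norm z" for z
      using A(2)[of "\<Psi> z"] by (simp add: A'_def norm_\<Phi> norm_\<Psi>)
    show "finite (\<phi> ` S)" using S by simp
    fix z assume "z \<in> \<phi> ` S"
    then obtain x where x: "x \<in> S" "z = \<phi> x" by blast
    have "A' (real_vec z) - \<Phi> y = \<Phi> (A (real_vec x) - y)"
      unfolding x(2) \<Phi>_real_vec[symmetric] A'_def by (simp add: \<Psi>\<Phi> linear_diff[OF lin(1)])
    then show "norm (A' (real_vec z) - \<Phi> y) \<le> r" using S(2)[OF x(1)] by (simp add: norm_\<Phi>)
  qed
  moreover have "card (\<phi> ` S) = card S" using inj_\<phi> by (intro card_image) (simp add: inj_on_def)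
  moreover have "CARD('d index) = CARD('d)" using bij_betw_same_card[OF f] .
  ultimately show ?thesis by simp
qed

definition lattice_const :: "nat \<Rightarrow> real" where
  "lattice_const d = unit_ball_vol (real d) * (1 + real d) ^ d * (\<Sum>r. 1 / (1 + real r)\<^sup>2) + 1"

lemma summable_inverse_Suc_squares: "summable (\<lambda>r. 1 / (1 + real r)\<^sup>2)"
  using summable_Suc_iff[of "\<lambda>n. inverse (real n ^ 2)"] inverse_power_summable[of 2, where 'a = real]
  by (simp add: inverse_eq_divide add.commute)

lemma lattice_const_pos: "0 < lattice_const d"
  unfolding lattice_const_def
  by (intro add_nonneg_pos mult_nonneg_nonneg suminf_nonneg summable_inverse_Suc_squares)
    (auto simp: unit_ball_vol_nonneg)

text \<open>
  There are \<open>O ((1 + r)\<^sup>d / |det A|)\<close> lattice points at distance about \<open>r\<close>, so the exponent \<open>d + 2\<close> leaves a convergent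
  series of \<open>(1 + r)\<^bsup>-2\<^esup>\<close>.
\<close>

lemma lattice_sum:
  fixes A :: "real ^ 'd \<Rightarrow> real ^ 'd"
  assumes A: "linear A" "\<And>x. norm (A x) \<le> norm x" and S: "finite S"
  shows "\<bar>det (matrix A)\<bar> * (\<Sum>x\<in>S. 1 / (1 + norm (A (real_vec x) - y)) ^ (CARD('d) + 2)) \<le> lattice_const CARD('d)"
proof -
  define d where "d = CARD('d)"
  define V where "V = unit_ball_vol (real d) * (1 + real d) ^ d"
  define \<Sigma> where "\<Sigma> = (\<Sum>r. 1 / (1 + real r)\<^sup>2)"
  note summ = summable_inverse_Suc_squares
  have V0: "0 \<le> V" unfolding V_def by (simp add: unit_ball_vol_nonneg)
  have "\<bar>det (matrix A)\<bar> * (\<Sum>x\<in>S. 1 / (1 + norm (A (real_vec x) - y)) ^ (d + 2)) \<le> V * \<Sigma>"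
  proof -
    define D where "D = \<bar>det (matrix A)\<bar>"
    define F where "F = (\<lambda>x. nat \<lfloor>norm (A (real_vec x) - y)\<rfloor>)"
    have F: "real (F x) \<le> norm (A (real_vec x) - y)" "norm (A (real_vec x) - y) \<le> real (F x) + 1" for x
      unfolding F_def by auto
    have "(\<Sum>x\<in>S. 1 / (1 + norm (A (real_vec x) - y)) ^ (d + 2)) \<le> (\<Sum>x\<in>S. 1 / (1 + real (F x)) ^ (d + 2))"
      using F by (intro sum_mono divide_left_mono power_mono mult_pos_pos zero_less_power)
        (auto simp: add_pos_nonneg)
    also have "\<dots> = (\<Sum>r\<in>F ` S. \<Sum>x\<in>{x\<in>S. F x = r}. 1 / (1 + real (F x)) ^ (d + 2))"
      using S by (intro sum.group[symmetric]) auto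
    also have "\<dots> = (\<Sum>r\<in>F ` S. card {x\<in>S. F x = r} / (1 + real r) ^ (d + 2))"
      by (intro sum.cong) auto
    finally have "D * (\<Sum>x\<in>S. 1 / (1 + norm (A (real_vec x) - y)) ^ (d + 2)) \<le>
        (\<Sum>r\<in>F ` S. D * card {x\<in>S. F x = r} / (1 + real r) ^ (d + 2))"
      unfolding D_def by (simp add: mult_left_mono sum_distrib_left[symmetric] flip: times_divide_eq_right)
    also have "\<dots> \<le> (\<Sum>r\<in>F ` S. V * (1 / (1 + real r)\<^sup>2))"
    proof (rule sum_mono)
      fix r assume "r \<in> F ` S"
      have "D * card {x\<in>S. F x = r} \<le> unit_ball_vol (CARD('d)) * ((real r + 1) + CARD('d)) ^ CARD('d)"
        unfolding D_def using S F(2) by (intro lattice_count[where y = y] A) auto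
      also have "\<dots> \<le> unit_ball_vol (real d) * ((1 + real d) * (1 + real r)) ^ d"
        unfolding d_def[symmetric]
        by (intro mult_left_mono power_mono) (auto simp: unit_ball_vol_nonneg algebra_simps)
      also have "\<dots> = V * (1 + real r) ^ d" by (simp add: V_def power_mult_distrib)
      finally have "D * card {x\<in>S. F x = r} / (1 + real r) ^ (d + 2) \<le> V * (1 + real r) ^ d / (1 + real r) ^ (d + 2)"
        by (intro divide_right_mono) auto
      also have "\<dots> = V * (1 / (1 + real r)\<^sup>2)"
        by (simp add: power_add divide_simps power2_eq_square)
      finally show "D * card {x\<in>S. F x = r} / (1 + real r) ^ (d + 2) \<le> V * (1 / (1 + real r)\<^sup>2)" .
    qed
    also have "\<dots> \<le> V * \<Sigma>"
      unfolding sum_distrib_left[symmetric] \<Sigma>_def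
      using S V0 by (intro mult_left_mono sum_le_suminf summ) auto
    finally show ?thesis by (simp add: D_def)
  qed
  then show ?thesis by (simp add: lattice_const_def V_def \<Sigma>_def d_def)
qed

section \<open>Weighted square sums and sums over the grid\<close>

lemma norm_adjoint_le:
  fixes B :: "real ^ 'd \<Rightarrow> real ^ 'd"
  assumes "linear B" "\<And>x. norm (B x) \<le> norm x"
  shows "norm (adjoint B x) \<le> norm x"
proof (cases "adjoint B x = 0")
  case False
  have "norm (adjoint B x) * norm (adjoint B x) = adjoint B x \<bullet> adjoint B x"
    by (simp add: dot_square_norm power2_eq_square)
  also have "\<dots> = B (adjoint B x) \<bullet> x" by (rule adjoint_works[OF assms(1)])
  also have "\<dots> \<le> norm (B (adjoint B x)) * norm x" by (rule norm_cauchy_schwarz)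
  also have "\<dots> \<le> norm (adjoint B x) * norm x" using assms(2) by (intro mult_right_mono) auto
  finally show ?thesis using False by simp
qed simp

lemma det_matrix_adjoint:
  fixes B :: "real ^ 'd \<Rightarrow> real ^ 'd"
  assumes "linear B"
  shows "det (matrix (adjoint B)) = det (matrix B)"
  by (simp add: matrix_adjoint[OF assms])

lemma power_norm_le_sum_powers:
  fixes u :: "real ^ 'd"
  shows "(1 + norm u) ^ (2 * s) \<le> (4 * (real CARD('d))\<^sup>2) ^ s * (1 + (\<Sum>j\<in>UNIV. \<bar>u $ j\<bar> ^ (2 * s)))"
proof -
  define d where "d = real CARD('d)"
  have d: "1 \<le> d" unfolding d_def using zero_less_card_finite[where 'a = 'd] by simp
  obtain j where j: "norm u \<le> d * \<bar>u $ j\<bar>"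
  proof -
    obtain j where j: "\<And>i. \<bar>u $ i\<bar> \<le> \<bar>u $ j\<bar>"
      using Max_ge[of "range (\<lambda>i. \<bar>u $ i\<bar>)"] Max_in[of "range (\<lambda>i. \<bar>u $ i\<bar>)"] by fastforce
    have "norm u \<le> (\<Sum>i\<in>UNIV. \<bar>u $ i\<bar>)" by (rule norm_le_l1_cart)
    also have "\<dots> \<le> (\<Sum>i\<in>(UNIV :: 'd set). \<bar>u $ j\<bar>)" using j by (intro sum_mono)
    finally show ?thesis using that by (simp add: d_def)
  qed
  have "(1 + norm u) ^ (2 * s) \<le> (2 * d * max 1 \<bar>u $ j\<bar>) ^ (2 * s)"
  proof (intro power_mono)
    have "d * \<bar>u $ j\<bar> \<le> d * max 1 \<bar>u $ j\<bar>" using d by (intro mult_left_mono) auto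
    moreover have "1 * 1 \<le> d * max 1 \<bar>u $ j\<bar>" using d by (intro mult_mono) auto
    ultimately show "1 + norm u \<le> 2 * d * max 1 \<bar>u $ j\<bar>" using j by linarith
  qed auto
  also have "\<dots> = (4 * d\<^sup>2) ^ s * max 1 \<bar>u $ j\<bar> ^ (2 * s)"
    by (simp add: power_mult_distrib power_mult)
  also have "\<dots> \<le> (4 * d\<^sup>2) ^ s * (1 + (\<Sum>j\<in>UNIV. \<bar>u $ j\<bar> ^ (2 * s)))"
  proof (intro mult_left_mono)
    have "\<bar>u $ j\<bar> ^ (2 * s) \<le> (\<Sum>j\<in>UNIV. \<bar>u $ j\<bar> ^ (2 * s))"
      by (rule member_le_sum) auto
    then show "max 1 \<bar>u $ j\<bar> ^ (2 * s) \<le> 1 + (\<Sum>j\<in>UNIV. \<bar>u $ j\<bar> ^ (2 * s))"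
      by (cases "1 \<le> \<bar>u $ j\<bar>") (simp_all add: max_def sum_nonneg)
  qed (use d in auto)
  finally show ?thesis by (simp add: d_def)
qed

text \<open>
  Cauchy--Schwarz with the weight \<open>1 + \<Sum>\<^sub>j |(x - b) \<bullet> B e\<^sub>j|\<^bsup>2s\<^esup>\<close>.  As \<open>(x - b) \<bullet> B e\<^sub>j\<close> is the \<open>j\<close>-th
  coordinate of \<open>B\<^sup>* (x - b)\<close>, the reciprocals of the weights form a lattice sum for the adjoint of \<open>B\<close>, which has the same determinant.
  The determinant in the hypotheses cancels against the one in that sum.
\<close>

lemma l1_bound_from_weighted_l2:
  fixes B :: "real ^ 'd \<Rightarrow> real ^ 'd" and c :: "int ^ 'd \<Rightarrow> complex"
  assumes B: "linear B" "\<And>x. norm (B x) \<le> norm x" "det (matrix B) \<noteq> 0" and S: "finite S" and X: "0 \<le> X"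
    and s: "s = CARD('d) + 2"
    and c0: "(\<Sum>x\<in>S. (norm (c x))\<^sup>2) \<le> X * \<bar>det (matrix B)\<bar>"
    and c1: "\<And>j. (\<Sum>x\<in>S. (norm (c x))\<^sup>2 * \<bar>(real_vec x - b) \<bullet> B (axis j 1)\<bar> ^ (2 * s)) \<le> X * \<bar>det (matrix B)\<bar>"
  shows "(\<Sum>x\<in>S. norm (c x)) \<le>
    sqrt ((1 + real CARD('d)) * (4 * (real CARD('d))\<^sup>2) ^ (CARD('d) + 2) * lattice_const CARD('d) * X)"
proof -
  define d where "d = CARD('d)"
  define Kl where "Kl = lattice_const d"
  define Q where "Q = (4 * (real d)\<^sup>2) ^ (d + 2)"
  have "0 < d" by (simp add: d_def)
  then have Q: "0 < Q" by (simp add: Q_def)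
  define K where "K = (1 + real d) * Q * Kl"
  have "(\<Sum>x\<in>S. norm (c x)) \<le> sqrt (K * X)"
  proof -
    define D where "D = \<bar>det (matrix B)\<bar>"
    have D: "0 < D" using B by (simp add: D_def)
    define u where "u = (\<lambda>x. adjoint B (real_vec x) - adjoint B b)"
    have u: "u x $ j = (real_vec x - b) \<bullet> B (axis j 1)" for x j
    proof -
      have "u x $ j = adjoint B (real_vec x - b) \<bullet> axis j 1"
        by (simp add: u_def linear_diff[OF adjoint_linear[OF B(1)]] inner_axis)
      then show ?thesis by (simp add: adjoint_works[OF B(1)] inner_commute)
    qed
    define W where "W = (\<lambda>x. 1 + (\<Sum>j\<in>UNIV. \<bar>u x $ j\<bar> ^ (2 * s)))"
    have W: "1 \<le> W x" for x unfolding W_def by (simp add: sum_nonneg)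
    have "(\<Sum>x\<in>S. (norm (c x))\<^sup>2 * W x) = (\<Sum>x\<in>S. (norm (c x))\<^sup>2) + (\<Sum>j\<in>UNIV. \<Sum>x\<in>S. (norm (c x))\<^sup>2 * \<bar>u x $ j\<bar> ^ (2 * s))"
      unfolding W_def distrib_left sum.distrib sum_distrib_left by (subst (2) sum.swap) simp
    also have "\<dots> \<le> X * D + (\<Sum>j\<in>(UNIV :: 'd set). X * D)"
      using c0 c1 unfolding u D_def by (intro add_mono sum_mono)
    also have "\<dots> = (1 + real d) * X * D" by (simp add: d_def algebra_simps)
    finally have 1: "(\<Sum>x\<in>S. (norm (c x))\<^sup>2 * W x) \<le> (1 + real d) * X * D" .
    have "(\<Sum>x\<in>S. 1 / W x) \<le> (\<Sum>x\<in>S. Q * (1 / (1 + norm (u x)) ^ (d + 2)))"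
    proof (rule sum_mono)
      fix x
      have "(1 + norm (u x)) ^ (d + 2) \<le> (1 + norm (u x)) ^ (2 * s)"
        by (intro power_increasing) (auto simp: s d_def)
      also have "\<dots> \<le> Q * W x"
        using power_norm_le_sum_powers[of "u x" s] by (simp add: Q_def W_def s d_def)
      finally have "(1 + norm (u x)) ^ (d + 2) \<le> Q * W x" .
      moreover have "0 < (1 + norm (u x)) ^ (d + 2)" by (simp add: add_pos_nonneg)
      moreover have "0 < W x" using W[of x] by linarith
      ultimately show "1 / W x \<le> Q * (1 / (1 + norm (u x)) ^ (d + 2))" by (simp add: field_simps)
    qed
    also have "\<dots> = Q * (\<Sum>x\<in>S. 1 / (1 + norm (u x)) ^ (d + 2))" by (rule sum_distrib_left[symmetric])
    also have "\<dots> \<le> Q * (Kl / D)"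
    proof -
      have "D * (\<Sum>x\<in>S. 1 / (1 + norm (u x)) ^ (d + 2)) \<le> Kl"
        using lattice_sum[OF adjoint_linear[OF B(1)] norm_adjoint_le[OF B(1,2)] S, of "adjoint B b"]
        unfolding u_def D_def d_def Kl_def det_matrix_adjoint[OF B(1)] .
      then show ?thesis using D Q by (intro mult_left_mono) (auto simp: field_simps)
    qed
    finally have 2: "(\<Sum>x\<in>S. 1 / W x) \<le> Q * (Kl / D)" .
    have "(\<Sum>x\<in>S. norm (c x))\<^sup>2 = (\<Sum>x\<in>S. (norm (c x) * sqrt (W x)) * (1 / sqrt (W x)))\<^sup>2"
    proof -
      have "W x \<noteq> 0" for x using W[of x] by auto
      then show ?thesis by simp
    qed
    also have "\<dots> \<le> (\<Sum>x\<in>S. (norm (c x) * sqrt (W x))\<^sup>2) * (\<Sum>x\<in>S. (1 / sqrt (W x))\<^sup>2)"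
      by (rule Cauchy_Schwarz_ineq_sum)
    also have "\<dots> = (\<Sum>x\<in>S. (norm (c x))\<^sup>2 * W x) * (\<Sum>x\<in>S. 1 / W x)"
    proof -
      have "0 \<le> W x" for x using W[of x] by linarith
      then show ?thesis by (simp add: power_mult_distrib power_divide)
    qed
    also have "\<dots> \<le> ((1 + real d) * X * D) * (Q * (Kl / D))"
      using 1 2 W X D by (intro mult_mono sum_nonneg) (auto intro: order_trans[OF zero_le_one])
    also have "\<dots> = K * X" using D by (simp add: K_def)
    finally show ?thesis by (rule real_le_rsqrt)
  qed
  then show ?thesis by (simp only: K_def Q_def Kl_def d_def)
qed

text \<open>
  The points of the second kind, shifted by suitable periods, are distinct points of a fine lattice around \<open>q\<close>.  Their
  contribution is a lattice sum for \<open>(2 \<pi> / N) B\<^sup>-\<^sup>1\<close>, which is a contraction once \<open>N\<close> is large.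
\<close>

lemma grid_sum_bound:
  fixes B :: "real ^ 'd \<Rightarrow> real ^ 'd" and f :: "real ^ 'd \<Rightarrow> real"
  assumes B: "linear B" "bij B" and X: "0 \<le> X" and Y: "0 \<le> Y"
    and f: "\<And>\<xi>. f \<xi> \<le> Y * \<bar>det (matrix B)\<bar> \<or>
      (\<exists>m \<xi>'. \<xi> = q + period m + \<xi>' \<and> f \<xi> \<le> X / (1 + norm (inv B \<xi>')) ^ (CARD('d) + 2))"
  shows "\<exists>N1. \<forall>N\<ge>N1. (\<Sum>g\<in>gbox N. f (grid N g)) \<le>
    real N ^ CARD('d) * (\<bar>det (matrix B)\<bar> * (Y + X * lattice_const CARD('d)))"
proof -
  define d where "d = CARD('d)"
  define Kl where "Kl = lattice_const d"
  define D where "D = \<bar>det (matrix B)\<bar>"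
  have D: "0 < D" using det_nz_iff_inj[OF B(1)] B(2) by (simp add: D_def bij_def)
  define Bi where "Bi = inv B"
  have Bi: "linear Bi" unfolding Bi_def using B by (intro inj_linear_imp_inv_linear) (auto simp: bij_def)
  have "B \<circ> Bi = id" unfolding Bi_def using B by (simp add: bij_def surj_iff)
  then have "matrix B ** matrix Bi = mat 1"
    by (metis matrix_compose[OF Bi B(1)] matrix_id_mat_1)
  then have "det (matrix B) * det (matrix Bi) = 1" by (metis det_mul det_I)
  then have detBi: "D * \<bar>det (matrix Bi)\<bar> = 1" by (simp add: D_def flip: abs_mult)
  obtain b where b: "0 < b" "\<And>x. norm (Bi x) \<le> b * norm x"
    using linear_bounded_pos[OF Bi] by blast
  define N1 where "N1 = Suc (nat \<lceil>2 * pi * b\<rceil>)"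
  have main: "(\<Sum>g\<in>gbox N. f (grid N g)) \<le> real N ^ d * (D * (Y + X * Kl))" if N: "N \<ge> N1" for N
  proof -
    have N0: "0 < N" using N by (simp add: N1_def)
    have Nb: "2 * pi * b \<le> real N" using N by (simp add: N1_def) linarith
    define A where "A = (\<lambda>x. Bi ((2 * pi / real N) *\<^sub>R x))"
    define c where "c = 2 * pi / real N"
    have c: "0 < c" using N0 by (simp add: c_def)
    have A_eq: "A = Bi \<circ> (\<lambda>x. c *\<^sub>R x)" by (auto simp: A_def c_def)
    have lin_c: "linear (\<lambda>x :: real ^ 'd. c *\<^sub>R x)" by (rule linear_scaleR)
    have A: "linear A" unfolding A_eq by (rule linear_compose[OF lin_c Bi])
    have A_le: "norm (A x) \<le> norm x" for x
    proof -
      have "norm (A x) \<le> b * (c * norm x)" unfolding A_def c_def[symmetric] using b(2)[of "c *\<^sub>R x"] c by simp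
      also have "\<dots> = (2 * pi * b / real N) * norm x" by (simp add: c_def)
      also have "\<dots> \<le> 1 * norm x" using Nb N0 by (intro mult_right_mono) auto
      finally show ?thesis by simp
    qed
    have "matrix A = matrix Bi ** matrix (\<lambda>x. c *\<^sub>R x)" unfolding A_eq by (rule matrix_compose[OF lin_c Bi])
    then have "\<bar>det (matrix A)\<bar> = \<bar>det (matrix Bi)\<bar> * c ^ d"
      using c by (simp add: det_mul abs_mult d_def)
    then have detA: "D * \<bar>det (matrix A)\<bar> = c ^ d" using detBi by (simp add: mult.assoc[symmetric])
    define G where "G = {g \<in> gbox N. \<not> f (grid N g) \<le> Y * D}"
    have G: "finite G" "G \<subseteq> gbox N" by (auto simp: G_def finite_gbox)
    have "\<forall>g\<in>G. \<exists>m e. grid N g = q + period m + e \<and> f (grid N g) \<le> X / (1 + norm (Bi e)) ^ (d + 2)"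
      using f unfolding G_def D_def d_def Bi_def by blast
    then obtain m e where me: "\<And>g. g \<in> G \<Longrightarrow> grid N g = q + period (m g) + e g"
      "\<And>g. g \<in> G \<Longrightarrow> f (grid N g) \<le> X / (1 + norm (Bi (e g))) ^ (d + 2)" by metis
    \<comment> \<open>Translating the grid points by periods keeps them distinct.\<close>
    define t :: "int ^ 'd \<Rightarrow> int ^ 'd" where "t = (\<lambda>g. \<chi> i. g $ i - int N * m g $ i)"
    have At: "A (real_vec (t g)) - Bi q = Bi (e g)" if "g \<in> G" for g
    proof -
      have "c *\<^sub>R real_vec (t g) = grid N g - period (m g)"
        using N0 by (simp add: grid_def t_def real_vec_def vec_eq_iff c_def field_simps)
      also have "\<dots> = q + e g" using me(1)[OF that] by simp
      finally show ?thesis by (simp add: A_def c_def[symmetric] linear_add[OF Bi])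
    qed
    have inj: "inj_on t G"
    proof (rule inj_onI)
      fix g g' assume g: "g \<in> G" "g' \<in> G" "t g = t g'"
      have "g $ i = g' $ i" for i
      proof -
        have "g $ i - int N * m g $ i = g' $ i - int N * m g' $ i"
          using arg_cong[OF g(3), of "\<lambda>x. x $ i"] by (simp add: t_def)
        then have "g $ i mod int N = g' $ i mod int N"
          by (metis mod_mult_self2 add_diff_cancel_left' diff_add_cancel mult.commute mod_mult_self1)
        moreover have "0 \<le> g $ i" "g $ i < int N" "0 \<le> g' $ i" "g' $ i < int N"
          using g G by (auto simp: gbox_def)
        ultimately show ?thesis by simp
      qed
      then show "g = g'" by (simp add: vec_eq_iff)
    qed
    have "(\<Sum>g\<in>G. f (grid N g)) \<le> (\<Sum>g\<in>G. X * (1 / (1 + norm (A (real_vec (t g)) - Bi q)) ^ (d + 2)))"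
      using me(2) by (intro sum_mono) (simp add: At)
    also have "\<dots> = X * (\<Sum>x\<in>t ` G. 1 / (1 + norm (A (real_vec x) - Bi q)) ^ (d + 2))"
      by (simp add: sum.reindex[OF inj] sum_distrib_left)
    also have "\<dots> \<le> X * (real N ^ d * D * Kl)"
    proof (intro mult_left_mono X)
      define \<Sigma> where "\<Sigma> = (\<Sum>x\<in>t ` G. 1 / (1 + norm (A (real_vec x) - Bi q)) ^ (d + 2))"
      have "\<bar>det (matrix A)\<bar> * \<Sigma> \<le> Kl"
        unfolding \<Sigma>_def d_def Kl_def using G by (intro lattice_sum A A_le) auto
      then have "D * (\<bar>det (matrix A)\<bar> * \<Sigma>) \<le> D * Kl" using D by simp
      then have "c ^ d * \<Sigma> \<le> D * Kl" by (simp add: mult.assoc[symmetric] detA)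
      moreover have "1 / real N ^ d \<le> c ^ d"
      proof -
        have "1 \<le> 2 * pi" using pi_gt3 by simp
        then have "(1 / real N) ^ d \<le> c ^ d" unfolding c_def by (intro power_mono divide_right_mono) auto
        then show ?thesis by (simp add: power_divide)
      qed
      moreover have "0 \<le> \<Sigma>" unfolding \<Sigma>_def by (intro sum_nonneg) auto
      ultimately have "1 / real N ^ d * \<Sigma> \<le> D * Kl" by (meson mult_right_mono order_trans)
      then show "\<Sigma> \<le> real N ^ d * D * Kl" using N0 by (simp add: field_simps)
    qed
    finally have near: "(\<Sum>g\<in>G. f (grid N g)) \<le> X * (real N ^ d * D * Kl)" .
    have "(\<Sum>g\<in>gbox N - G. f (grid N g)) \<le> (\<Sum>g\<in>gbox N - G. Y * D)"
      by (intro sum_mono) (auto simp: G_def)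
    also have "\<dots> \<le> (\<Sum>g\<in>(gbox N :: (int ^ 'd) set). Y * D)"
      using Y D finite_gbox by (intro sum_mono2) auto
    also have "\<dots> = real N ^ d * (Y * D)" by (simp add: card_gbox d_def)
    finally have "(\<Sum>g\<in>gbox N - G. f (grid N g)) \<le> real N ^ d * (Y * D)" .
    moreover have "(\<Sum>g\<in>gbox N. f (grid N g)) = (\<Sum>g\<in>gbox N - G. f (grid N g)) + (\<Sum>g\<in>G. f (grid N g))"
      using G finite_gbox by (intro sum.subset_diff) auto
    ultimately show ?thesis using near by (simp add: algebra_simps)
  qed
  show ?thesis
    unfolding D_def[symmetric] d_def[symmetric] Kl_def[symmetric]
  proof (intro exI[of _ N1] allI impI)
    fix N assume "N1 \<le> N"
    then show "(\<Sum>g\<in>gbox N. f (grid N g)) \<le> real N ^ d * (D * (Y + X * Kl))" by (rule main)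
  qed
qed


section \<open>The absolute sum of a single packet\<close>

abbreviation near_mod :: "real ^ 'd \<Rightarrow> real \<Rightarrow> real ^ 'd \<Rightarrow> bool" where
  "near_mod q \<delta> \<xi> \<equiv> \<exists>m \<xi>'. \<xi> = q + period m + \<xi>' \<and> norm \<xi>' < \<delta>"

text \<open>
  The disc of radius \<open>1 / n\<close> is the one on which Cauchy's inequality is applied away from \<open>q\<close>: moving by \<open>O (1 / n)\<close> into
  the complex domain changes the \<open>n\<close>-th power of a function of modulus close to \<open>1\<close> by a bounded factor.
\<close>

definition small_away :: "(int ^ 'd \<Rightarrow> complex) \<Rightarrow> (real ^ 'd \<Rightarrow> real ^ 'd \<Rightarrow> complex \<Rightarrow> complex) \<Rightarrow>
    real ^ 'd \<Rightarrow> real \<Rightarrow> nat \<Rightarrow> bool" where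
  "small_away \<phi> h q \<delta> M \<longleftrightarrow> (\<exists>C\<ge>0. \<forall>\<xi>.
     (near_mod q \<delta> \<xi>) \<or>
     (\<forall>n\<ge>1. \<forall>v z. norm v \<le> 1 \<longrightarrow> norm z \<le> 1 / real n \<longrightarrow>
        norm (h \<xi> v z) * norm (ft \<phi> \<xi> v z) ^ n \<le> C / real n ^ M))"

lemma exp_periodic:
  "character (real_vec x) (\<xi> + period m) = character (real_vec x) \<xi>"
proof -
  define k where "k = (\<Sum>i\<in>UNIV. x $ i * m $ i)"
  have "real_vec x \<bullet> real_vec m = of_int k"
    by (simp add: k_def inner_vec_def real_vec_def)
  then have "character (real_vec x) (\<xi> + period m)
    = character (real_vec x) \<xi> * exp (2 * of_int k * complex_of_real pi * \<i>)"
    by (simp add: inner_add_right exp_add[symmetric] algebra_simps)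
  also have "exp (2 * of_int k * complex_of_real pi * \<i>) = 1"
    using exp_integer_2pi[of "of_int k"] by simp
  finally show ?thesis by simp
qed

context contracting_scaling
begin

lemma det_pow: "\<bar>det (matrix (L ^^ k))\<bar> = \<bar>det (matrix L)\<bar> ^ k"
proof (induction k)
  case 0
  then show ?case by (simp add: matrix_id_mat_1[unfolded id_def] id_def)
next
  case (Suc k)
  have "matrix (L ^^ Suc k) = matrix L ** matrix (L ^^ k)"
    using matrix_compose[OF linear_pow[of k] linear_L] by (simp add: o_def)
  then show ?case using Suc by (simp add: det_mul abs_mult del: funpow.simps)
qed

lemma det_pow_pos: "0 < \<bar>det (matrix (L ^^ k))\<bar>"
  using det_nz_iff_inj[OF linear_pow[of k]] inj_pow[of k] by simp

text \<open>
  This \<open>k\<close> is the scale reached at time \<open>n\<close>: the power \<open>L\<^sup>k\<close> will be the shape of the packet.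
\<close>

lemma scale_index_exists:
  obtains n0 where "\<And>n. n \<ge> n0 \<Longrightarrow> \<exists>k\<ge>k0. 1 \<le> real n * \<tau> ^ k \<and> real n * \<tau> ^ Suc k \<le> 1"
proof -
  define n0 where "n0 = Suc (nat \<lceil>1 / \<tau> ^ k0\<rceil>)"
  have "\<exists>k\<ge>k0. 1 \<le> real n * \<tau> ^ k \<and> real n * \<tau> ^ Suc k \<le> 1" if n: "n \<ge> n0" for n
  proof -
    have "1 / \<tau> ^ k0 < real n" using n unfolding n0_def by linarith
    then have nk0: "1 < real n * \<tau> ^ k0" using tau_pos by (simp add: field_simps)
    have npos: "0 < real n" using n by (simp add: n0_def)
    obtain j where "\<tau> ^ j < 1 / real n" using real_arch_pow_inv[of "1 / real n" \<tau>] npos tau_less_1 by auto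
    then have "real n * \<tau> ^ j \<le> 1" using npos by (simp add: field_simps)
    moreover have "real n * \<tau> ^ Suc j \<le> real n * \<tau> ^ j"
      using tau_pos tau_less_1 by (intro mult_left_mono power_decreasing) auto
    ultimately have ex: "\<exists>j. real n * \<tau> ^ Suc j \<le> 1" using order_trans by blast
    define k where "k = (LEAST j. real n * \<tau> ^ Suc j \<le> 1)"
    have k: "real n * \<tau> ^ Suc k \<le> 1" "\<And>j. j < k \<Longrightarrow> \<not> real n * \<tau> ^ Suc j \<le> 1"
      unfolding k_def using LeastI_ex[OF ex] not_less_Least by blast+
    have "k0 \<le> k"
    proof (rule ccontr)
      assume "\<not> k0 \<le> k"
      then have "\<tau> ^ k0 \<le> \<tau> ^ Suc k" using tau_pos tau_less_1 by (intro power_decreasing) auto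
      then have "real n * \<tau> ^ k0 \<le> real n * \<tau> ^ Suc k" using npos by simp
      with k nk0 show False by linarith
    qed
    moreover have "1 \<le> real n * \<tau> ^ k"
    proof (cases k)
      case 0
      then show ?thesis using npos by simp
    next
      case (Suc j)
      then show ?thesis using k(2)[of j] by simp
    qed
    ultimately show ?thesis using k by blast
  qed
  then show ?thesis using that by blast
qed

text \<open>
  The sums \<open>Q s v\<close> in the proof are the absolute values of the derivatives of order \<open>s\<close> along \<open>v\<close> of the modulated
  transform.  Near \<open>q\<close> they are bounded with Cauchy's inequality on the disc of radius \<open>\<kappa>\<close>, elsewhere on the disc of radius
  \<open>1 / n\<close>, which costs a factor \<open>n\<^sup>s\<close>.  The exponent \<open>M\<close> has to beat this factor and also \<open>1 / |det B|\<close>, which is at most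
  \<open>n\<^sup>a\<close>.
\<close>

lemma uniform_l1_bound_one_packet:
  fixes \<phi> :: "int ^ 'd \<Rightarrow> complex"
  assumes fin: "finitely_supported \<phi>"
    and \<kappa>: "0 < \<kappa>" "\<kappa> \<le> 1" and C1: "0 \<le> C1"
    and loc: "\<And>k n \<xi> v z. k0 \<le> k \<Longrightarrow> 1 \<le> real n * \<tau> ^ k \<Longrightarrow> real n * \<tau> ^ Suc k \<le> 1 \<Longrightarrow>
      norm \<xi> < \<delta> \<Longrightarrow> norm v \<le> 1 \<Longrightarrow> norm z \<le> \<kappa> \<Longrightarrow>
      norm (drift \<alpha> (q + \<xi>) ((L ^^ k) v) z * ft \<phi> (q + \<xi>) ((L ^^ k) v) z) ^ n
        \<le> C1 / (1 + norm (inv (L ^^ k) \<xi>)) ^ (CARD('d) + 2)"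
  obtains M where "\<And>h. trig h \<Longrightarrow> small_away \<phi> h q \<delta> M \<Longrightarrow>
    \<exists>C n0. \<forall>n\<ge>n0. \<forall>c. finitely_supported c \<longrightarrow> (\<forall>\<xi> v z. ft c \<xi> v z = h \<xi> v z * ft \<phi> \<xi> v z ^ n) \<longrightarrow>
      l1_norm c \<le> C"
proof -
  define p where "p = CARD('d) + 2"
  obtain a where a: "\<tau> ^ a < \<bar>det (matrix L)\<bar>"
    using real_arch_pow_inv[of "\<bar>det (matrix L)\<bar>" \<tau>] det_pow_pos[of 1] tau_less_1 by auto
  define Kg where "Kg = lattice_const CARD('d)"
  have Kg: "0 < Kg" unfolding Kg_def by (rule lattice_const_pos)
  define Kw where "Kw = (1 + real CARD('d)) * (4 * (real CARD('d))\<^sup>2) ^ (CARD('d) + 2) * lattice_const CARD('d)"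
  obtain n0 where n0: "\<And>n. n \<ge> n0 \<Longrightarrow> \<exists>k\<ge>k0. 1 \<le> real n * \<tau> ^ k \<and> real n * \<tau> ^ Suc k \<le> 1"
    using scale_index_exists by blast
  show ?thesis
  proof (rule that[of "p + a"])
    fix h :: "real ^ 'd \<Rightarrow> real ^ 'd \<Rightarrow> complex \<Rightarrow> complex"
    assume h: "trig h" and away: "small_away \<phi> h q \<delta> (p + a)"
    obtain Ch where Ch: "0 \<le> Ch" "\<And>\<xi> v z. norm v \<le> 1 \<Longrightarrow> norm z \<le> 1 \<Longrightarrow> norm (h \<xi> v z) \<le> Ch"
      using vanish_0[OF h, of 0] by (auto simp: vanish_def)
    from away obtain C2 where C2: "0 \<le> C2" "\<And>\<xi>.
      (near_mod q \<delta> \<xi>) \<or>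
      (\<forall>n\<ge>1. \<forall>v z. norm v \<le> 1 \<longrightarrow> norm z \<le> 1 / real n \<longrightarrow>
        norm (h \<xi> v z) * norm (ft \<phi> \<xi> v z) ^ n \<le> C2 / real n ^ (p + a))"
      unfolding small_away_def by blast
    define Ka where "Ka = fact p * (Ch * C1) / \<kappa> ^ p"
    define Kb where "Kb = fact p * (exp (norm \<alpha>) * C2)"
    define X where "X = Kb\<^sup>2 + Ka\<^sup>2 * Kg"
    have X: "0 \<le> X" using Kg by (simp add: X_def)
    have Ka: "0 \<le> Ka" using Ch C1 \<kappa> by (simp add: Ka_def)
    have Kb: "0 \<le> Kb" using C2 by (simp add: Kb_def)
    have "l1_norm c \<le> sqrt (Kw * X)"
      if n: "n \<ge> n0" and c: "finitely_supported c" and ftc: "\<And>\<xi> v z. ft c \<xi> v z = h \<xi> v z * ft \<phi> \<xi> v z ^ n" for n c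
    proof -
      obtain k where k: "k0 \<le> k" "1 \<le> real n * \<tau> ^ k" "real n * \<tau> ^ Suc k \<le> 1" using n0[OF n] by blast
      have npos: "1 \<le> n" using k(2) by (cases n) auto
      define B where "B = L ^^ k"
      define D where "D = \<bar>det (matrix B)\<bar>"
      have D: "0 < D" unfolding D_def B_def by (rule det_pow_pos)
      have nD: "1 / real n ^ a \<le> D"
      proof -
        have "1 / real n \<le> \<tau> ^ k" using k(2) npos by (simp add: field_simps)
        then have "(1 / real n) ^ a \<le> (\<tau> ^ k) ^ a" by (intro power_mono) auto
        also have "\<dots> = (\<tau> ^ a) ^ k" by (simp add: power_mult[symmetric] mult.commute)
        also have "\<dots> \<le> \<bar>det (matrix L)\<bar> ^ k" using a tau_pos by (intro power_mono) auto
        finally show ?thesis by (simp add: D_def B_def det_pow power_divide)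
      qed
      define S where "S = {x. c x \<noteq> 0}"
      have S: "finite S" using c by (simp add: S_def finitely_supported_def)
      define y where "y = (\<lambda>x. real_vec x - real n *\<^sub>R \<alpha>)"
      have packet: "norm (expsum S c y \<xi> v z) = norm (h \<xi> v z) *
          norm (drift \<alpha> \<xi> v z * ft \<phi> \<xi> v z) ^ n" for \<xi> v z
      proof -
        define e where "e = drift \<alpha> \<xi> v z"
        have e: "e ^ n = exp (- (\<i> * (of_nat n * (of_real (\<alpha> \<bullet> \<xi>) + z * of_real (\<alpha> \<bullet> v)))))"
          by (simp add: e_def exp_of_nat_mult[symmetric] algebra_simps)
        have "expsum S c y \<xi> v z = e ^ n * ft c \<xi> v z"
          unfolding expsum_def ft_def S_def[symmetric] sum_distrib_left e
          by (intro sum.cong refl)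
            (simp add: y_def inner_diff_left algebra_simps flip: exp_add)
        also have "\<dots> = h \<xi> v z * (e * ft \<phi> \<xi> v z) ^ n" by (simp add: ftc power_mult_distrib)
        finally show ?thesis by (simp add: e_def norm_mult norm_power)
      qed
      define Q where "Q = (\<lambda>s v \<xi>. norm (\<Sum>x\<in>S. c x * (\<i> * of_real (y x \<bullet> v)) ^ s * character (real_vec x) \<xi>))"
      have Q: "Q s v \<xi> = norm (expsum S (\<lambda>x. c x * (\<i> * of_real (y x \<bullet> v)) ^ s) y \<xi> v 0)" for s v \<xi>
      proof -
        have "expsum S (\<lambda>x. c x * (\<i> * of_real (y x \<bullet> v)) ^ s) y \<xi> v 0 = exp (\<i> * of_real (- (real n * (\<alpha> \<bullet> \<xi>)))) *
            (\<Sum>x\<in>S. c x * (\<i> * of_real (y x \<bullet> v)) ^ s * character (real_vec x) \<xi>)"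
          unfolding expsum_def sum_distrib_left
        proof (rule sum.cong[OF refl])
          fix x
          have "wave (y x) \<xi> v 0 =
            exp (\<i> * of_real (- (real n * (\<alpha> \<bullet> \<xi>)))) * character (real_vec x) \<xi>"
            unfolding exp_add[symmetric] by (simp add: y_def inner_diff_left algebra_simps)
          then show "c x * (\<i> * of_real (y x \<bullet> v)) ^ s * wave (y x) \<xi> v 0 =
            exp (\<i> * of_real (- (real n * (\<alpha> \<bullet> \<xi>)))) * (c x * (\<i> * of_real (y x \<bullet> v)) ^ s * character (real_vec x) \<xi>)"
            by (simp only: mult_ac)
        qed
        then show ?thesis unfolding Q_def by (simp only: norm_mult norm_exp_i_times mult_1)
      qed
      have Q_periodic: "Q s v (\<xi> + period m) = Q s v \<xi>" for s v \<xi> m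
        by (simp only: Q_def exp_periodic)
      have near: "(Q s (B w) (q + period m + \<xi>))\<^sup>2 \<le> Ka\<^sup>2 / (1 + norm (inv B \<xi>)) ^ p"
        if s: "s \<le> p" and w: "norm w \<le> 1" and \<xi>: "norm \<xi> < \<delta>" for s w m \<xi>
      proof -
        define t where "t = 1 / (1 + norm (inv B \<xi>)) ^ p"
        have ge1: "1 \<le> (1 + norm (inv B \<xi>)) ^ p" by (intro one_le_power) simp
        have "1 / x \<le> 1" if "1 \<le> x" for x :: real using that by simp
        from this[OF ge1] have t: "0 \<le> t" "t \<le> 1" by (simp_all add: t_def)
        have "Q s (B w) (q + period m + \<xi>) = Q s (B w) ((q + \<xi>) + period m)"
          by (simp only: add.assoc add.commute[of \<xi>])
        also have "\<dots> = norm (expsum S (\<lambda>x. c x * (\<i> * of_real (y x \<bullet> B w)) ^ s) y (q + \<xi>) (B w) 0)"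
          unfolding Q_periodic by (rule Q)
        also have "\<dots> \<le> fact s * (Ch * (C1 * t)) / \<kappa> ^ s"
        proof (rule expsum_Cauchy[OF \<kappa>(1)])
          fix z :: complex assume z: "norm z = \<kappa>"
          have Bw: "norm (B w) \<le> 1" unfolding B_def using norm_pow_le_norm w order_trans by blast
          show "norm (expsum S c y (q + \<xi>) (B w) z) \<le> Ch * (C1 * t)"
            unfolding packet
          proof (rule mult_mono)
            show "norm (h (q + \<xi>) (B w) z) \<le> Ch" using Ch Bw z \<kappa> by simp
            show "norm (drift \<alpha> (q + \<xi>) (B w) z * ft \<phi> (q + \<xi>) (B w) z) ^ n \<le> C1 * t"
              using loc[OF k \<xi> w, of z] z unfolding B_def t_def p_def by simp
          qed (use Ch in auto)
        qed
        also have "\<dots> \<le> fact p * (Ch * (C1 * t)) / \<kappa> ^ p"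
          using s \<kappa> Ch C1 t by (intro frac_le mult_right_mono mult_nonneg_nonneg fact_mono power_decreasing) auto
        also have "\<dots> = Ka * t" by (simp add: Ka_def)
        finally have "(Q s (B w) (q + period m + \<xi>))\<^sup>2 \<le> (Ka * t)\<^sup>2"
          by (intro power_mono) (auto simp: Q_def)
        also have "\<dots> = Ka\<^sup>2 * (t * t)" by (simp add: power2_eq_square)
        also have "\<dots> \<le> Ka\<^sup>2 * (t * 1)" using t by (intro mult_left_mono) auto
        finally show ?thesis by (simp add: t_def)
      qed
      have far: "(Q s (B w) \<xi>)\<^sup>2 \<le> Kb\<^sup>2 * D"
        if s: "s \<le> p" and w: "norm w \<le> 1"
          and \<xi>: "\<not> (near_mod q \<delta> \<xi>)" for s w \<xi>
      proof -
        have Bw: "norm (B w) \<le> 1" unfolding B_def using norm_pow_le_norm w order_trans by blast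
        have "Q s (B w) \<xi> \<le> fact s * (exp (norm \<alpha>) * (C2 / real n ^ (p + a))) / (1 / real n) ^ s"
          unfolding Q
        proof (rule expsum_Cauchy)
          show "0 < 1 / real n" using npos by simp
          fix z :: complex assume z: "norm z = 1 / real n"
          have "norm (drift \<alpha> \<xi> (B w) z) ^ n = exp (real n * (Im z * (\<alpha> \<bullet> B w)))"
            by (simp add: exp_of_nat_mult)
          also have "\<dots> \<le> exp (norm \<alpha>)"
          proof -
            have "\<bar>Im z\<bar> * \<bar>\<alpha> \<bullet> B w\<bar> \<le> (1 / real n) * (norm \<alpha> * 1)"
            proof (intro mult_mono)
              show "\<bar>Im z\<bar> \<le> 1 / real n" using abs_Im_le_cmod[of z] z by simp
              show "\<bar>\<alpha> \<bullet> B w\<bar> \<le> norm \<alpha> * 1"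
                using Cauchy_Schwarz_ineq2[of \<alpha> "B w"] mult_left_mono[OF Bw, of "norm \<alpha>"] by simp
            qed auto
            then have "real n * (\<bar>Im z\<bar> * \<bar>\<alpha> \<bullet> B w\<bar>) \<le> real n * ((1 / real n) * (norm \<alpha> * 1))"
              by (intro mult_left_mono) auto
            also have "\<dots> = norm \<alpha>" using npos by simp
            finally have "real n * \<bar>Im z * (\<alpha> \<bullet> B w)\<bar> \<le> norm \<alpha>" by (simp add: abs_mult)
            moreover have "real n * (Im z * (\<alpha> \<bullet> B w)) \<le> real n * \<bar>Im z * (\<alpha> \<bullet> B w)\<bar>"
              by (intro mult_left_mono) auto
            ultimately show ?thesis by simp
          qed
          finally have 1: "norm (drift \<alpha> \<xi> (B w) z) ^ n \<le> exp (norm \<alpha>)" .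
          have 2: "norm (h \<xi> (B w) z) * norm (ft \<phi> \<xi> (B w) z) ^ n \<le> C2 / real n ^ (p + a)"
            using C2(2)[of \<xi>] \<xi> npos Bw z by auto
          have "norm (expsum S c y \<xi> (B w) z) =
              norm (drift \<alpha> \<xi> (B w) z) ^ n *
              (norm (h \<xi> (B w) z) * norm (ft \<phi> \<xi> (B w) z) ^ n)"
            unfolding packet norm_mult power_mult_distrib by (simp only: mult_ac)
          also have "\<dots> \<le> exp (norm \<alpha>) * (C2 / real n ^ (p + a))"
            using 1 2 by (intro mult_mono) auto
          finally show "norm (expsum S c y \<xi> (B w) z) \<le> exp (norm \<alpha>) * (C2 / real n ^ (p + a))" .
        qed
        also have "\<dots> = fact s * (exp (norm \<alpha>) * C2) * (real n ^ s / real n ^ (p + a))"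
          using npos by (simp add: power_divide)
        also have "\<dots> \<le> Kb * (1 / real n ^ a)"
          unfolding Kb_def
        proof (intro mult_mono)
          have "real n ^ s \<le> real n ^ p" using s npos by (intro power_increasing) auto
          then show "real n ^ s / real n ^ (p + a) \<le> 1 / real n ^ a"
            using npos by (simp add: power_add field_simps)
        qed (use s C2 in \<open>auto intro: fact_mono\<close>)
        finally have "(Q s (B w) \<xi>)\<^sup>2 \<le> (Kb * (1 / real n ^ a))\<^sup>2"
          by (intro power_mono) (auto simp: Q_def)
        also have "\<dots> = Kb\<^sup>2 * ((1 / real n ^ a) * (1 / real n ^ a))" by (simp add: power2_eq_square)
        also have "\<dots> \<le> Kb\<^sup>2 * (D * 1)"
          using nD npos D by (intro mult_left_mono mult_mono) auto
        finally show ?thesis by simp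
      qed
      obtain N0 where N0: "0 < N0" "\<And>N c. N \<ge> N0 \<Longrightarrow>
        (\<Sum>g\<in>gbox N. (norm (\<Sum>x\<in>S. c x * character (real_vec x) (grid N g)))\<^sup>2)
          = real N ^ CARD('d) * (\<Sum>x\<in>S. (norm (c x))\<^sup>2)"
        using discrete_Parseval[OF S] by blast
      have l2: "(\<Sum>x\<in>S. (norm (c x))\<^sup>2 * \<bar>y x \<bullet> B w\<bar> ^ (2 * s)) \<le> X * D"
        if s: "s \<le> p" and w: "norm w \<le> 1" for s w
      proof -
        have B: "linear B" "bij B" unfolding B_def by (rule linear_pow, rule bij_pow)
        have "\<exists>N1. \<forall>N\<ge>N1. (\<Sum>g\<in>gbox N. (Q s (B w) (grid N g))\<^sup>2) \<le> real N ^ CARD('d) * (D * (Kb\<^sup>2 + Ka\<^sup>2 * Kg))"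
          unfolding D_def Kg_def
        proof (rule grid_sum_bound[OF B, where q = q])
          fix \<xi>
          show "(Q s (B w) \<xi>)\<^sup>2 \<le> Kb\<^sup>2 * \<bar>det (matrix B)\<bar> \<or>
            (\<exists>m \<xi>'. \<xi> = q + period m + \<xi>' \<and> (Q s (B w) \<xi>)\<^sup>2 \<le> Ka\<^sup>2 / (1 + norm (inv B \<xi>')) ^ (CARD('d) + 2))"
            using near[OF s w] far[OF s w, of \<xi>] unfolding D_def p_def by metis
        qed auto
        then obtain N1 where N1: "\<And>N. N \<ge> N1 \<Longrightarrow>
          (\<Sum>g\<in>gbox N. (Q s (B w) (grid N g))\<^sup>2) \<le> real N ^ CARD('d) * (D * (Kb\<^sup>2 + Ka\<^sup>2 * Kg))" by blast
        define N where "N = max N0 N1"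
        have Npos: "0 < real N ^ CARD('d)" using N0(1) by (simp add: N_def)
        have "real N ^ CARD('d) * (\<Sum>x\<in>S. (norm (c x * (\<i> * of_real (y x \<bullet> B w)) ^ s))\<^sup>2) =
            (\<Sum>g\<in>gbox N. (Q s (B w) (grid N g))\<^sup>2)"
          unfolding Q_def by (rule N0(2)[symmetric]) (simp add: N_def)
        also have "\<dots> \<le> real N ^ CARD('d) * (D * X)" unfolding X_def by (rule N1) (simp add: N_def)
        finally have "(\<Sum>x\<in>S. (norm (c x * (\<i> * of_real (y x \<bullet> B w)) ^ s))\<^sup>2) \<le> D * X"
          using Npos by (simp only: mult_le_cancel_left_pos)
        then show ?thesis
          by (simp add: norm_mult norm_power power_mult_distrib power_mult[symmetric] mult.commute)
      qed
      have "(\<Sum>x\<in>S. norm (c x)) \<le> sqrt (Kw * X)"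
        unfolding Kw_def
      proof (rule l1_bound_from_weighted_l2[where B = B and b = "real n *\<^sub>R \<alpha>" and s = p])
        show "(\<Sum>x\<in>S. (norm (c x))\<^sup>2) \<le> X * \<bar>det (matrix B)\<bar>"
          using l2[of 0 0] by (simp add: D_def)
        show "(\<Sum>x\<in>S. (norm (c x))\<^sup>2 * \<bar>(real_vec x - real n *\<^sub>R \<alpha>) \<bullet> B (axis j 1)\<bar> ^ (2 * p)) \<le> X * \<bar>det (matrix B)\<bar>" for j
          using l2[of p "axis j 1"] by (simp add: D_def y_def norm_axis_1)
        show "linear B" unfolding B_def by (rule linear_pow)
        show "norm (B x) \<le> norm x" for x unfolding B_def by (rule norm_pow_le_norm)
        show "det (matrix B) \<noteq> 0" using D by (simp add: D_def)
      qed (use S X in \<open>auto simp: p_def\<close>)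
      then show ?thesis using l1_norm_eq_sum[OF S, of c] by (simp add: S_def)
    qed
    then show "\<exists>C n0. \<forall>n\<ge>n0. \<forall>c. finitely_supported c \<longrightarrow>
        (\<forall>\<xi> v z. ft c \<xi> v z = h \<xi> v z * ft \<phi> \<xi> v z ^ n) \<longrightarrow> l1_norm c \<le> C" by blast
  qed
qed

end

section \<open>The Fourier transform at and away from its maxima\<close>

lemma torus_representative:
  fixes \<xi> :: "real ^ 'd"
  obtains p m where "p \<in> torus" "\<xi> = p + period m"
proof -
  define m :: "int ^ 'd" where "m = (\<chi> i. \<lceil>(\<xi> $ i - pi) / (2 * pi)\<rceil>)"
  define p where "p = \<xi> - period m"
  have "- pi < p $ i \<and> p $ i \<le> pi" for i
  proof -
    have "(\<xi> $ i - pi) / (2 * pi) \<le> of_int (m $ i)" "of_int (m $ i) < (\<xi> $ i - pi) / (2 * pi) + 1"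
      unfolding m_def by (simp_all, linarith)
    then have "\<xi> $ i - pi \<le> 2 * pi * of_int (m $ i)" "2 * pi * of_int (m $ i) < \<xi> $ i - pi + 2 * pi"
      by (simp_all add: field_simps)
    then show ?thesis by (simp add: p_def real_vec_def)
  qed
  then have "p \<in> torus" by (simp add: torus_def)
  moreover have "\<xi> = p + period m" by (simp add: p_def)
  ultimately show ?thesis by (rule that)
qed

lemma ft_periodic: "ft \<psi> (\<xi> + period m) v z = ft \<psi> \<xi> v z"
proof -
  have "wave (real_vec x) (\<xi> + period m) v z =
      wave (real_vec x) \<xi> v z" for x
    unfolding distrib_left exp_add exp_periodic ..
  then show ?thesis by (simp add: ft_def expsum_def)
qed

lemma trig_periodic: "trig h \<Longrightarrow> h (\<xi> + period m) v z = h \<xi> v z"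
  unfolding trig_def by (metis ft_periodic)

lemma continuous_on_ft: "continuous_on A (\<lambda>\<xi>. ft \<psi> \<xi> 0 0)"
  unfolding ft_def expsum_def by (intro continuous_intros)

lemma ft_Lipschitz_imaginary:
  fixes \<phi> :: "int ^ 'd \<Rightarrow> complex"
  assumes "finitely_supported \<phi>"
  obtains \<Lambda> where "0 < \<Lambda>"
    "\<And>\<xi> v z. norm v \<le> 1 \<Longrightarrow> norm z \<le> 1 \<Longrightarrow> norm (ft \<phi> \<xi> v z) \<le> norm (ft \<phi> \<xi> 0 0) + \<Lambda> * norm z"
proof
  define S where "S = {x. \<phi> x \<noteq> 0}"
  define \<Lambda> where "\<Lambda> = 1 + (\<Sum>x\<in>S. norm (\<phi> x) * (exp (norm (real_vec x)) * norm (real_vec x)))"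
  show "0 < \<Lambda>" unfolding \<Lambda>_def by (intro add_pos_nonneg sum_nonneg) auto
  fix \<xi> v :: "real ^ 'd" and z :: complex assume v: "norm v \<le> 1" and z: "norm z \<le> 1"
  have "norm (ft \<phi> \<xi> v z - ft \<phi> \<xi> 0 0) \<le> (\<Sum>x\<in>S. norm (\<phi> x) * (exp (norm (real_vec x)) * norm (real_vec x)) * norm z)"
    unfolding ft_def expsum_def S_def[symmetric] sum_subtractf[symmetric]
  proof (intro sum_norm_le)
    fix x assume "x \<in> S"
    define w where "w = \<i> * (z * of_real (real_vec x \<bullet> v))"
    have "\<bar>real_vec x \<bullet> v\<bar> \<le> norm (real_vec x) * 1"
      using Cauchy_Schwarz_ineq2[of "real_vec x" v] mult_left_mono[OF v, of "norm (real_vec x)"] by simp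
    then have w: "norm w \<le> norm (real_vec x) * norm z"
      by (simp add: w_def norm_mult mult.commute mult_left_mono)
    moreover have "norm (real_vec x) * norm z \<le> norm (real_vec x) * 1" using z by (intro mult_left_mono) auto
    ultimately have w1: "norm w \<le> norm (real_vec x)" by simp
    have "\<phi> x * wave (real_vec x) \<xi> v z -
        \<phi> x * wave (real_vec x) \<xi> 0 0 =
        \<phi> x * character (real_vec x) \<xi> * (exp w - 1)"
      by (simp add: w_def distrib_left exp_add algebra_simps)
    also have "norm \<dots> = norm (\<phi> x) * norm (exp w - 1)" by (simp add: norm_mult)
    also have "\<dots> \<le> norm (\<phi> x) * (exp (norm (real_vec x)) * (norm (real_vec x) * norm z))"
    proof (intro mult_left_mono)
      have "norm (exp w - 1) \<le> exp (norm w) * norm w" by (rule norm_exp_minus_1_le)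
      also have "\<dots> \<le> exp (norm (real_vec x)) * (norm (real_vec x) * norm z)"
        using w w1 by (intro mult_mono) auto
      finally show "norm (exp w - 1) \<le> exp (norm (real_vec x)) * (norm (real_vec x) * norm z)" .
    qed auto
    finally show "norm (\<phi> x * wave (real_vec x) \<xi> v z -
        \<phi> x * wave (real_vec x) \<xi> 0 0) \<le>
        norm (\<phi> x) * (exp (norm (real_vec x)) * norm (real_vec x)) * norm z"
      by (simp add: mult.assoc)
  qed
  also have "\<dots> \<le> \<Lambda> * norm z" by (simp add: \<Lambda>_def sum_distrib_right[symmetric] mult_right_mono)
  finally show "norm (ft \<phi> \<xi> v z) \<le> norm (ft \<phi> \<xi> 0 0) + \<Lambda> * norm z"
    using norm_triangle_sub[of "ft \<phi> \<xi> v z" "ft \<phi> \<xi> 0 0"] by linarith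
qed

definition exp_power_decay :: "(int ^ 'd \<Rightarrow> complex) \<Rightarrow> real ^ 'd \<Rightarrow> real \<Rightarrow> real \<Rightarrow> nat \<Rightarrow> bool" where
  "exp_power_decay \<phi> p \<delta> c K \<longleftrightarrow> 0 < \<delta> \<and> \<delta> \<le> 1 \<and> 0 < c \<and> 1 \<le> K \<and>
     (\<forall>\<xi>. norm \<xi> < \<delta> \<longrightarrow> norm (ft \<phi> (p + \<xi>) 0 0) \<le> exp (- (c * norm \<xi> ^ K)))"

definition packet_bound :: "(int ^ 'd \<Rightarrow> complex) \<Rightarrow> real ^ 'd \<Rightarrow> real \<Rightarrow> nat \<Rightarrow> bool" where
  "packet_bound \<phi> q \<delta> M \<longleftrightarrow> (\<forall>h. trig h \<longrightarrow> small_away \<phi> h q \<delta> M \<longrightarrow>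
    (\<exists>C n0. \<forall>n\<ge>n0. \<forall>c. finitely_supported c \<longrightarrow> (\<forall>\<xi> v z. ft c \<xi> v z = h \<xi> v z * ft \<phi> \<xi> v z ^ n) \<longrightarrow>
      l1_norm c \<le> C))"

text \<open>
  The normalised sum \<open>exp (- i \<alpha> \<bullet> \<xi>) F (p + \<xi>) / F (p)\<close> is again an exponential sum, with the frequencies \<open>x - \<alpha>\<close>.  By the
  Taylor expansion of \<open>\<Gamma>\<close> it equals \<open>exp (\<Upsilon> - P)\<close> on real vectors near \<open>0\<close>, so the estimates for powers near a
  maximum apply to it.
\<close>

lemma positive_homogeneous_type_local:
  fixes \<phi> :: "int ^ 'd \<Rightarrow> complex"
  assumes fin: "finitely_supported \<phi>" and p1: "norm (fourier \<phi> p) = 1"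
    and type: "positive_homogeneous_type \<phi> p"
  shows "\<exists>\<delta> c K M. exp_power_decay \<phi> p \<delta> c K \<and> packet_bound \<phi> p \<delta> M"
proof -
  from type obtain U \<alpha> P \<Upsilon> where U: "open U" "0 \<in> U"
    and quot: "\<And>\<xi>. \<xi> \<in> U \<Longrightarrow> fourier \<phi> (\<xi> + p) / fourier \<phi> p \<notin> \<real>\<^sub>\<le>\<^sub>0"
    and hom: "positive_homogeneous P"
    and Gam: "\<And>\<xi>. \<xi> \<in> U \<Longrightarrow> Gamma_log \<phi> p \<xi> = \<i> * complex_of_real (\<alpha> \<bullet> \<xi>) - P \<xi> + \<Upsilon> \<xi>"
    and o: "\<Upsilon> \<in> o[at 0](\<lambda>\<xi>. complex_of_real (Re (P \<xi>)))"
    unfolding positive_homogeneous_type_def by blast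
  obtain L \<tau> \<rho> \<mu> where "contracting_scaling L \<tau> \<rho> \<mu> P" using positive_homogeneous_imp_scaling[OF hom] by blast
  then interpret contracting_scaling L \<tau> \<rho> \<mu> P .
  define S where "S = {x. \<phi> x \<noteq> 0}"
  have S: "finite S" using fin by (simp add: S_def finitely_supported_def)
  define a where "a = (\<lambda>x. \<phi> x * character (real_vec x) p / fourier \<phi> p)"
  define y where "y = (\<lambda>x. real_vec x - \<alpha>)"
  have G_eq: "expsum S a y \<xi> v z = drift \<alpha> \<xi> v z * ft \<phi> (p + \<xi>) v z / fourier \<phi> p"
    for \<xi> v z
    unfolding expsum_def ft_def S_def[symmetric] sum_distrib_left sum_divide_distrib
  proof (rule sum.cong[OF refl])
    fix x
    have "character (real_vec x) p * wave (y x) \<xi> v z =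
      drift \<alpha> \<xi> v z * wave (real_vec x) (p + \<xi>) v z"
      unfolding exp_add[symmetric] by (simp add: y_def inner_diff_left inner_add_right algebra_simps)
    then show "a x * wave (y x) \<xi> v z =
      drift \<alpha> \<xi> v z *
        (\<phi> x * wave (real_vec x) (p + \<xi>) v z) / fourier \<phi> p"
      unfolding a_def by (simp add: field_simps)
  qed
  have p0: "fourier \<phi> p \<noteq> 0" using p1 by auto
  have norm_G: "norm (expsum S a y \<xi> v z) =
     norm (drift \<alpha> (p + \<xi>) v z * ft \<phi> (p + \<xi>) v z)" for \<xi> v z
  proof -
    have "drift \<alpha> (p + \<xi>) v z =
        exp (\<i> * of_real (- (\<alpha> \<bullet> p))) * drift \<alpha> \<xi> v z"
      unfolding exp_add[symmetric] by (simp add: inner_add_right algebra_simps)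
    then show ?thesis unfolding G_eq by (simp only: norm_mult norm_divide p1 norm_exp_i_times mult_1 div_by_1)
  qed
  have G: "expsum S a y \<xi> 0 0 = exp (\<Upsilon> \<xi> - P \<xi>)" if "\<xi> \<in> U" for \<xi>
  proof -
    have "fourier \<phi> (\<xi> + p) / fourier \<phi> p \<noteq> 0" using quot[OF that] by auto
    then have "fourier \<phi> (\<xi> + p) / fourier \<phi> p = exp (\<i> * complex_of_real (\<alpha> \<bullet> \<xi>) - P \<xi> + \<Upsilon> \<xi>)"
      using exp_Ln Gam[OF that] unfolding Gamma_log_def by metis
    moreover have "expsum S a y \<xi> 0 0 = exp (- (\<i> * of_real (\<alpha> \<bullet> \<xi>))) * (fourier \<phi> (\<xi> + p) / fourier \<phi> p)"
      unfolding G_eq by (simp add: fourier_eq_ft[OF fin] add.commute)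
    ultimately show ?thesis by (simp add: exp_add[symmetric] algebra_simps)
  qed
  have G0: "expsum S a y 0 0 0 = 1"
    unfolding G_eq using p0 by (simp add: fourier_eq_ft[OF fin])
  obtain c K where cK: "0 < c" "1 \<le> K" "\<And>x. norm x \<le> 1 \<Longrightarrow> c * norm x ^ K \<le> Re (P x)"
    using Re_P_power_lower_bound by blast
  have "eventually (\<lambda>x. norm (\<Upsilon> x) \<le> (1 / 2) * norm (complex_of_real (Re (P x)))) (at 0)"
    using landau_o.smallD[OF o, of "1 / 2"] by simp
  moreover have "eventually (\<lambda>x. x \<in> U) (at 0)" using U by (simp add: eventually_at_topological) blast
  ultimately have "eventually (\<lambda>x. x \<in> U \<and> norm (\<Upsilon> x) \<le> Re (P x) / 2) (at 0)"
    by eventually_elim (simp add: Re_P_nonneg)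
  then obtain r where r: "0 < r"
    "\<And>x. x \<noteq> 0 \<Longrightarrow> norm x < r \<Longrightarrow> x \<in> U \<and> norm (\<Upsilon> x) \<le> Re (P x) / 2"
    unfolding eventually_at by (auto simp: dist_norm)
  have "\<exists>\<delta>>0. \<exists>\<kappa>>0. \<exists>C>0. \<exists>k0. \<kappa> \<le> 1 \<and> (\<forall>k\<ge>k0. \<forall>n \<xi> v z.
    real n * \<tau> ^ Suc k \<le> 1 \<longrightarrow> norm \<xi> < \<delta> \<longrightarrow> norm v \<le> 1 \<longrightarrow> norm z \<le> \<kappa> \<longrightarrow>
    norm (expsum S a y \<xi> ((L ^^ k) v) z) ^ n \<le> C * exp (- (real n * Re (P \<xi>) / 2)))"
    by (rule power_estimate_near_maximum[OF S U _ G0 o]) (rule G)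
  then obtain \<delta> \<kappa> C k0
    where loc: "0 < \<delta>" "0 < \<kappa>" "0 < C" "\<kappa> \<le> 1"
    and bound: "\<forall>k\<ge>k0. \<forall>n \<xi> v z. real n * \<tau> ^ Suc k \<le> 1 \<longrightarrow> norm \<xi> < \<delta> \<longrightarrow> norm v \<le> 1 \<longrightarrow> norm z \<le> \<kappa> \<longrightarrow>
      norm (expsum S a y \<xi> ((L ^^ k) v) z) ^ n \<le> C * exp (- (real n * Re (P \<xi>) / 2))"
    by (elim exE conjE)
  obtain C' where C': "0 < C'" "\<And>x. exp (- ((1 / 2) * Re (P x))) \<le> C' / (1 + norm x) ^ (CARD('d) + 2)"
    using exp_Re_P_decay[of "1 / 2" "CARD('d) + 2"] by auto
  define \<delta>' where "\<delta>' = min 1 (min \<delta> r)"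
  have \<delta>': "0 < \<delta>'" "\<delta>' \<le> 1" "\<delta>' \<le> \<delta>" "\<delta>' \<le> r" using loc r by (auto simp: \<delta>'_def)
  have decay: "exp_power_decay \<phi> p \<delta>' (c / 2) K"
    unfolding exp_power_decay_def
  proof (intro conjI allI impI)
    fix \<xi> :: "real ^ 'd" assume \<xi>: "norm \<xi> < \<delta>'"
    have "norm (ft \<phi> (p + \<xi>) 0 0) = norm (expsum S a y \<xi> 0 0)"
      unfolding norm_G by (simp add: norm_mult)
    also have "\<dots> \<le> exp (- (c / 2 * norm \<xi> ^ K))"
    proof (cases "\<xi> = 0")
      case True
      then show ?thesis using G0 cK by (simp add: power_0_left)
    next
      case False
      then have u: "\<xi> \<in> U" "norm (\<Upsilon> \<xi>) \<le> Re (P \<xi>) / 2" using r \<xi> \<delta>' by auto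
      have "Re (\<Upsilon> \<xi> - P \<xi>) \<le> - (Re (P \<xi>) / 2)" using u(2) complex_Re_le_cmod[of "\<Upsilon> \<xi>"] by simp
      moreover have "c * norm \<xi> ^ K \<le> Re (P \<xi>)" using cK \<xi> \<delta>' by simp
      ultimately show ?thesis using G[OF u(1)] by simp
    qed
    finally show "norm (ft \<phi> (p + \<xi>) 0 0) \<le> exp (- (c / 2 * norm \<xi> ^ K))" .
  qed (use \<delta>' cK in auto)
  have "0 \<le> C * C'" using loc C' by simp
  have est: "norm (drift \<alpha> (p + \<xi>) ((L ^^ k) v) z * ft \<phi> (p + \<xi>) ((L ^^ k) v) z) ^ n
      \<le> (C * C') / (1 + norm (inv (L ^^ k) \<xi>)) ^ (CARD('d) + 2)"
    if k: "k0 \<le> k" "1 \<le> real n * \<tau> ^ k" "real n * \<tau> ^ Suc k \<le> 1" and \<xi>: "norm \<xi> < \<delta>'"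
      and v: "norm v \<le> 1" and z: "norm z \<le> \<kappa>" for k n \<xi> v z
  proof -
    define \<eta> where "\<eta> = inv (L ^^ k) \<xi>"
    have \<eta>: "\<xi> = (L ^^ k) \<eta>" using bij_pow[of k] by (simp add: \<eta>_def bij_is_surj surj_f_inv_f)
    have "norm (expsum S a y \<xi> ((L ^^ k) v) z) ^ n \<le> C * exp (- (real n * Re (P \<xi>) / 2))"
      using bound[rule_format, OF k(1,3) _ v z, of \<xi>] \<xi> \<delta>' by simp
    also have "\<dots> \<le> C * exp (- ((1 / 2) * Re (P \<eta>)))"
    proof -
      have "1 * Re (P \<eta>) \<le> (real n * \<tau> ^ k) * Re (P \<eta>)" using k(2) Re_P_nonneg by (rule mult_right_mono)
      also have "\<dots> = real n * Re (P \<xi>)" by (simp add: \<eta> P_pow flip: of_real_power)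
      finally show ?thesis using loc by simp
    qed
    also have "\<dots> \<le> C * (C' / (1 + norm \<eta>) ^ (CARD('d) + 2))" using C'(2) loc by (intro mult_left_mono) auto
    finally show ?thesis unfolding norm_G[symmetric] \<eta>_def by simp
  qed
  obtain M where "\<And>h. trig h \<Longrightarrow> small_away \<phi> h p \<delta>' M \<Longrightarrow>
    \<exists>C n0. \<forall>n\<ge>n0. \<forall>c. finitely_supported c \<longrightarrow> (\<forall>\<xi> v z. ft c \<xi> v z = h \<xi> v z * ft \<phi> \<xi> v z ^ n) \<longrightarrow>
      l1_norm c \<le> C"
    using uniform_l1_bound_one_packet[OF fin loc(2) loc(4) \<open>0 \<le> C * C'\<close> est] by blast
  then have "packet_bound \<phi> p \<delta>' M" unfolding packet_bound_def by blast
  with decay show ?thesis by blast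
qed

text \<open>
  With \<open>r\<close> the distance to \<open>p\<close>, the product is at most a constant times \<open>(r + 1 / n)\<^sup>N exp (- c n r\<^sup>K)\<close>; as \<open>N \<ge> K M\<close>,
  the power of \<open>r\<close> is bounded by \<open>(r\<^sup>K)\<^sup>M\<close>, and \<open>(n r\<^sup>K)\<^sup>M\<close> is absorbed by the exponential.
\<close>

lemma small_away_near_other:
  assumes fin: "finitely_supported \<phi>" and h: "trig h" and decay: "exp_power_decay \<phi> p \<delta> c K"
    and van: "vanish N p h" and N: "K * M \<le> N" "M \<le> N"
  shows "\<exists>C\<ge>0. \<forall>m \<xi> n v z. norm \<xi> < \<delta> \<longrightarrow> 1 \<le> n \<longrightarrow> norm v \<le> 1 \<longrightarrow> norm z \<le> 1 / real n \<longrightarrow>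
    norm (h (p + period m + \<xi>) v z) * norm (ft \<phi> (p + period m + \<xi>) v z) ^ n
      \<le> C / real n ^ M"
proof -
  obtain \<Lambda> where \<Lambda>: "0 < \<Lambda>"
    "\<And>\<xi> v z. norm v \<le> 1 \<Longrightarrow> norm z \<le> 1 \<Longrightarrow> norm (ft \<phi> \<xi> v z) \<le> norm (ft \<phi> \<xi> 0 0) + \<Lambda> * norm z"
    using ft_Lipschitz_imaginary[OF fin] by blast
  from van obtain A where A: "0 \<le> A" "\<And>\<xi> v z. norm v \<le> 1 \<Longrightarrow> norm z \<le> 1 \<Longrightarrow>
     norm (h \<xi> v z) \<le> A * (norm (\<xi> - p) + norm z) ^ N" unfolding vanish_def by blast
  have d: "0 < \<delta>" "\<delta> \<le> 1" "0 < c" "1 \<le> K"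
    "\<And>\<xi>. norm \<xi> < \<delta> \<Longrightarrow> norm (ft \<phi> (p + \<xi>) 0 0) \<le> exp (- (c * norm \<xi> ^ K))"
    using decay by (auto simp: exp_power_decay_def)
  define B where "B = \<Lambda> * exp c"
  define C where "C = A * 2 ^ N * exp B * (fact M / c ^ M + 1)"
  have "norm (h (p + period m + \<xi>) v z) * norm (ft \<phi> (p + period m + \<xi>) v z) ^ n
      \<le> C / real n ^ M"
    if \<xi>: "norm \<xi> < \<delta>" and n: "1 \<le> n" and v: "norm v \<le> 1" and z: "norm z \<le> 1 / real n" for m \<xi> n v z
  proof -
    define r where "r = norm \<xi>"
    have r: "0 \<le> r" "r \<le> 1" using \<xi> d by (auto simp: r_def)
    have n1: "1 / real n \<le> 1" "0 < 1 / real n" using n by auto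
    have z1: "norm z \<le> 1" using z n1 by linarith
    have shift: "p + period m + \<xi> = (p + \<xi>) + period m" by simp
    have rK: "r ^ K \<le> 1" using r by (intro power_le_one)
    have "norm (h (p + \<xi>) v z) \<le> A * (r + norm z) ^ N" using A(2)[OF v z1, of "p + \<xi>"] by (simp add: r_def)
    also have "\<dots> \<le> A * (2 * max r (1 / real n)) ^ N"
      using A z r by (intro mult_left_mono power_mono) auto
    also have "\<dots> = A * 2 ^ N * max r (1 / real n) ^ N" by (simp add: power_mult_distrib)
    also have "\<dots> \<le> A * 2 ^ N * (r ^ (K * M) + 1 / real n ^ M)"
    proof (intro mult_left_mono)
      have "r ^ N \<le> r ^ (K * M)" using N r by (intro power_decreasing)
      moreover have "(1 / real n) ^ N \<le> (1 / real n) ^ M" using N n1 by (intro power_decreasing) auto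
      moreover have "0 \<le> r ^ (K * M)" using r by simp
      ultimately show "max r (1 / real n) ^ N \<le> r ^ (K * M) + 1 / real n ^ M"
        unfolding power_one_over[symmetric] by (auto simp: max_def intro: add_increasing add_increasing2)
    qed (use A in auto)
    finally have h1: "norm (h (p + \<xi>) v z) \<le> A * 2 ^ N * (r ^ (K * M) + 1 / real n ^ M)" .
    have "norm (ft \<phi> (p + \<xi>) v z) \<le> exp (- (c * r ^ K)) + \<Lambda> * (1 / real n)"
      using \<Lambda>(2)[OF v z1, of "p + \<xi>"] d(5)[OF \<xi>] mult_left_mono[OF z, of \<Lambda>] \<Lambda>(1) unfolding r_def by linarith
    also have "\<dots> \<le> exp (- (c * r ^ K)) * (1 + B / real n)"
    proof -
      have "1 \<le> exp (- (c * r ^ K)) * exp c"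
        using rK d by (simp add: exp_add[symmetric])
      then have "\<Lambda> * (1 / real n) * 1 \<le> \<Lambda> * (1 / real n) * (exp (- (c * r ^ K)) * exp c)"
        using \<Lambda>(1) n by (intro mult_left_mono) auto
      then show ?thesis by (simp add: B_def algebra_simps)
    qed
    also have "\<dots> \<le> exp (- (c * r ^ K)) * exp (B / real n)"
      by (intro mult_left_mono exp_ge_add_one_self) auto
    finally have "norm (ft \<phi> (p + \<xi>) v z) ^ n \<le> (exp (- (c * r ^ K)) * exp (B / real n)) ^ n"
      by (intro power_mono) auto
    also have "\<dots> = exp (- (real n * (c * r ^ K))) * exp B"
      using n by (simp add: power_mult_distrib exp_of_nat_mult[symmetric])
    finally have f1: "norm (ft \<phi> (p + \<xi>) v z) ^ n \<le> exp (- (real n * (c * r ^ K))) * exp B" .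
    have "r ^ (K * M) * exp (- (real n * (c * r ^ K))) \<le> fact M / c ^ M / real n ^ M"
    proof -
      have "(real n * (c * r ^ K)) ^ M \<le> fact M * exp (real n * (c * r ^ K))"
        using d r by (intro power_le_fact_mult_exp) simp
      then have "r ^ (K * M) * (c ^ M * real n ^ M) \<le> fact M * exp (real n * (c * r ^ K))"
        by (simp add: power_mult_distrib power_mult mult_ac)
      then have "r ^ (K * M) \<le> fact M / (c ^ M * real n ^ M) * exp (real n * (c * r ^ K))"
        using d n by (simp add: field_simps)
      then show ?thesis by (simp add: exp_minus field_simps)
    qed
    moreover have "exp (- (real n * (c * r ^ K))) \<le> 1" using d r by simp
    ultimately have rn: "(r ^ (K * M) + 1 / real n ^ M) * exp (- (real n * (c * r ^ K))) \<le> (fact M / c ^ M + 1) / real n ^ M"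
      using mult_left_mono[of "exp (- (real n * (c * r ^ K)))" 1 "1 / real n ^ M"]
      by (simp add: distrib_right add_divide_distrib)
    have "norm (h (p + \<xi>) v z) * norm (ft \<phi> (p + \<xi>) v z) ^ n \<le>
        (A * 2 ^ N * (r ^ (K * M) + 1 / real n ^ M)) * (exp (- (real n * (c * r ^ K))) * exp B)"
      using h1 f1 A r by (intro mult_mono) auto
    also have "\<dots> = A * 2 ^ N * exp B * ((r ^ (K * M) + 1 / real n ^ M) * exp (- (real n * (c * r ^ K))))"
      by (simp only: mult_ac)
    also have "\<dots> \<le> A * 2 ^ N * exp B * ((fact M / c ^ M + 1) / real n ^ M)"
      using rn A by (intro mult_left_mono) auto
    also have "\<dots> = C / real n ^ M" by (simp add: C_def)
    finally show ?thesis unfolding shift ft_periodic trig_periodic[OF h] .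
  qed
  moreover have "0 \<le> C" using A d by (simp add: C_def)
  ultimately show ?thesis by blast
qed

lemma small_away_gap:
  assumes fin: "finitely_supported \<phi>" and h: "trig h" and \<eta>: "0 < \<eta>"
  shows "\<exists>C\<ge>0. \<forall>\<xi> n v z. norm (ft \<phi> \<xi> 0 0) \<le> 1 - \<eta> \<longrightarrow> 1 \<le> n \<longrightarrow> norm v \<le> 1 \<longrightarrow> norm z \<le> 1 / real n \<longrightarrow>
    norm (h \<xi> v z) * norm (ft \<phi> \<xi> v z) ^ n \<le> C / real n ^ M"
proof -
  obtain \<Lambda> where \<Lambda>: "0 < \<Lambda>"
    "\<And>\<xi> v z. norm v \<le> 1 \<Longrightarrow> norm z \<le> 1 \<Longrightarrow> norm (ft \<phi> \<xi> v z) \<le> norm (ft \<phi> \<xi> 0 0) + \<Lambda> * norm z"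
    using ft_Lipschitz_imaginary[OF fin] by blast
  obtain A where A: "0 \<le> A" "\<And>\<xi> v z. norm v \<le> 1 \<Longrightarrow> norm z \<le> 1 \<Longrightarrow> norm (h \<xi> v z) \<le> A"
    using vanish_0[OF h, of 0] by (auto simp: vanish_def)
  define C where "C = A * exp \<Lambda> * (fact M / \<eta> ^ M)"
  have "norm (h \<xi> v z) * norm (ft \<phi> \<xi> v z) ^ n \<le> C / real n ^ M"
    if \<xi>: "norm (ft \<phi> \<xi> 0 0) \<le> 1 - \<eta>" and n: "1 \<le> n" and v: "norm v \<le> 1" and z: "norm z \<le> 1 / real n" for \<xi> n v z
  proof -
    have "1 / real n \<le> 1" using n by simp
    then have z1: "norm z \<le> 1" using z by linarith
    have "norm (ft \<phi> \<xi> v z) \<le> 1 + (\<Lambda> / real n - \<eta>)"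
      using \<Lambda>(2)[OF v z1, of \<xi>] \<xi> mult_left_mono[OF z, of \<Lambda>] \<Lambda>(1) by simp
    also have "\<dots> \<le> exp (\<Lambda> / real n - \<eta>)" by (rule exp_ge_add_one_self)
    finally have "norm (ft \<phi> \<xi> v z) ^ n \<le> exp (\<Lambda> / real n - \<eta>) ^ n" by (intro power_mono) auto
    also have "\<dots> = exp \<Lambda> * exp (- (real n * \<eta>))"
      using n by (simp add: exp_of_nat_mult[symmetric] exp_add[symmetric] algebra_simps)
    also have "\<dots> \<le> exp \<Lambda> * (fact M / (real n * \<eta>) ^ M)"
    proof (intro mult_left_mono)
      have "0 < (real n * \<eta>) ^ M" using n \<eta> by simp
      moreover have "(real n * \<eta>) ^ M \<le> fact M * exp (real n * \<eta>)" using \<eta> by (intro power_le_fact_mult_exp) simp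
      ultimately show "exp (- (real n * \<eta>)) \<le> fact M / (real n * \<eta>) ^ M"
        by (simp add: exp_minus field_simps)
    qed auto
    finally have "norm (h \<xi> v z) * norm (ft \<phi> \<xi> v z) ^ n \<le> A * (exp \<Lambda> * (fact M / (real n * \<eta>) ^ M))"
      using A v z1 by (intro mult_mono) auto
    also have "\<dots> = C / real n ^ M" by (simp add: C_def power_mult_distrib mult_ac)
    finally show ?thesis .
  qed
  moreover have "0 \<le> C" using A \<eta> by (simp add: C_def)
  ultimately show ?thesis by blast
qed

lemma maximum_of_fourier:
  fixes \<phi> :: "int ^ 'd \<Rightarrow> complex"
  assumes fin: "finitely_supported \<phi>" and sup: "(SUP \<xi>. cmod (fourier \<phi> \<xi>)) = 1"
  shows "\<And>\<xi>. norm (ft \<phi> \<xi> 0 0) \<le> 1" and "Omega \<phi> \<noteq> {}"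
proof -
  have eq: "fourier \<phi> \<xi> = ft \<phi> \<xi> 0 0" for \<xi> by (rule fourier_eq_ft[OF fin])
  obtain C where "\<And>\<xi> v z. norm v \<le> 1 \<Longrightarrow> norm z \<le> 1 \<Longrightarrow> norm (ft \<phi> \<xi> v z) \<le> C"
    using fin expsum_bounded unfolding ft_def finitely_supported_def by metis
  then have bdd: "bdd_above (range (\<lambda>\<xi>. cmod (fourier \<phi> \<xi>)))"
    unfolding eq by (intro bdd_aboveI[of _ C]) auto
  show le: "norm (ft \<phi> \<xi> 0 0) \<le> 1" for \<xi>
    using cSUP_upper[OF UNIV_I bdd, of \<xi>] sup by (simp add: eq)
  define K where "K = (cbox (\<chi> i. - pi) (\<chi> i. pi) :: (real ^ 'd) set)"
  have "0 \<in> K" by (simp add: K_def mem_box_cart)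
  then obtain \<xi> where \<xi>: "\<And>\<eta>. \<eta> \<in> K \<Longrightarrow> norm (ft \<phi> \<eta> 0 0) \<le> norm (ft \<phi> \<xi> 0 0)"
    using continuous_attains_sup[of K "\<lambda>\<xi>. norm (ft \<phi> \<xi> 0 0)"]
    by (metis K_def compact_cbox continuous_on_norm continuous_on_ft empty_iff)
  have torus_K: "torus \<subseteq> K" by (auto simp: torus_def K_def mem_box_cart less_imp_le)
  have "norm (ft \<phi> \<eta> 0 0) \<le> norm (ft \<phi> \<xi> 0 0)" for \<eta>
  proof -
    obtain p m where "p \<in> torus" "\<eta> = p + period m" by (rule torus_representative)
    then show ?thesis using \<xi>[of p] torus_K by (auto simp: ft_periodic)
  qed
  then have "(SUP \<xi>. cmod (fourier \<phi> \<xi>)) \<le> norm (ft \<phi> \<xi> 0 0)"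
    unfolding eq by (intro cSUP_least) auto
  then have \<xi>1: "norm (ft \<phi> \<xi> 0 0) = 1" using le[of \<xi>] sup by linarith
  obtain p m where p: "p \<in> torus" "\<xi> = p + period m" by (rule torus_representative)
  have "norm (ft \<phi> p 0 0) = 1" using \<xi>1 unfolding p(2) ft_periodic .
  then have "p \<in> Omega \<phi>" using p by (simp add: Omega_def eq)
  then show "Omega \<phi> \<noteq> {}" by blast
qed

lemma Omega_representative:
  fixes \<phi> :: "int ^ 'd \<Rightarrow> complex"
  assumes fin: "finitely_supported \<phi>" and "norm (ft \<phi> \<xi> 0 0) = 1"
  obtains p m where "p \<in> Omega \<phi>" "\<xi> = p + period m"
proof -
  obtain p m where p: "p \<in> torus" "\<xi> = p + period m" by (rule torus_representative)
  have "norm (ft \<phi> p 0 0) = 1" using assms(2) unfolding p(2) ft_periodic .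
  then have "p \<in> Omega \<phi>" using p by (simp add: Omega_def fourier_eq_ft[OF fin])
  then show ?thesis using p(2) by (rule that)
qed

text \<open>
  At a limit point of \<open>\<Omega>\<close> the modulus would again be \<open>1\<close>, but the decay around the corresponding point of \<open>\<Omega>\<close>
  isolates it.  The limit point itself may lie on the part of the boundary that is excluded from the torus, whence the
  translation by a period.
\<close>

lemma finite_Omega:
  fixes \<phi> :: "int ^ 'd \<Rightarrow> complex"
  assumes fin: "finitely_supported \<phi>"
    and decay: "\<And>p. p \<in> Omega \<phi> \<Longrightarrow> exp_power_decay \<phi> p (\<delta> p) (c p) (K p)"
  shows "finite (Omega \<phi>)"
proof (rule ccontr)
  assume inf: "infinite (Omega \<phi>)"
  define Q where "Q = (cbox (\<chi> i. - pi) (\<chi> i. pi) :: (real ^ 'd) set)"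
  have sub: "Omega \<phi> \<subseteq> Q" by (auto simp: Omega_def torus_def Q_def mem_box_cart less_imp_le)
  have "compact Q" by (simp add: Q_def)
  then obtain x where x: "x islimpt Omega \<phi>"
    using Heine_Borel_imp_Bolzano_Weierstrass[OF _ inf sub] by blast
  have "closed {\<xi>. norm (ft \<phi> \<xi> 0 0) = 1}"
    by (intro closed_Collect_eq continuous_on_norm continuous_on_ft continuous_on_const)
  moreover have "Omega \<phi> \<subseteq> {\<xi>. norm (ft \<phi> \<xi> 0 0) = 1}"
    by (auto simp: Omega_def fourier_eq_ft[OF fin])
  ultimately have "norm (ft \<phi> x 0 0) = 1"
    using x closed_limpt islimpt_subset by blast
  then obtain p m where p: "p \<in> Omega \<phi>" "x = p + period m"
    using Omega_representative[OF fin] by blast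
  note d = decay[OF p(1), unfolded exp_power_decay_def]
  obtain w where w: "w \<in> Omega \<phi>" "w \<noteq> x" "dist w x < \<delta> p"
    using x d by (auto simp: islimpt_approachable)
  have "norm (ft \<phi> (p + (w - x)) 0 0) = norm (ft \<phi> ((p + (w - x)) + period m) 0 0)"
    by (simp only: ft_periodic)
  also have "(p + (w - x)) + period m = w" by (simp add: p(2))
  also have "norm (ft \<phi> w 0 0) = 1" using w by (simp add: Omega_def fourier_eq_ft[OF fin])
  finally have "1 \<le> exp (- (c p * norm (w - x) ^ K p))"
    using d w(3) by (metis dist_norm)
  then have "c p * norm (w - x) ^ K p \<le> 0" by simp
  moreover have "0 < c p * norm (w - x) ^ K p" using d w(2) by simp
  ultimately show False by simp
qed

lemma fourier_gap:
  fixes \<phi> :: "int ^ 'd \<Rightarrow> complex"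
  assumes fin: "finitely_supported \<phi>" and le: "\<And>\<xi>. norm (ft \<phi> \<xi> 0 0) \<le> 1"
    and \<delta>: "\<And>p. p \<in> Omega \<phi> \<Longrightarrow> 0 < \<delta> p"
  shows "\<exists>\<eta>>0. \<forall>\<xi>. (\<exists>p\<in>Omega \<phi>. near_mod p (\<delta> p) \<xi>) \<or>
    norm (ft \<phi> \<xi> 0 0) \<le> 1 - \<eta>"
proof -
  define Q where "Q = (cbox (\<chi> i. - pi) (\<chi> i. pi) :: (real ^ 'd) set)"
  define Z where "Z = Q \<inter> (\<Inter>p\<in>Omega \<phi>. \<Inter>m. {\<xi>. \<delta> p \<le> norm (\<xi> - (p + period m))})"
  have "compact Z" unfolding Z_def Q_def
    by (intro compact_Int_closed compact_cbox closed_INT ballI closed_Collect_le continuous_intros)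
  have torus_Q: "torus \<subseteq> Q" by (auto simp: torus_def Q_def mem_box_cart less_imp_le)
  have "\<exists>\<eta>>0. \<forall>\<xi>\<in>Z. norm (ft \<phi> \<xi> 0 0) \<le> 1 - \<eta>"
  proof (cases "Z = {}")
    case True
    then show ?thesis by (intro exI[of _ 1]) auto
  next
    case False
    obtain x where x: "x \<in> Z" "\<And>\<xi>. \<xi> \<in> Z \<Longrightarrow> norm (ft \<phi> \<xi> 0 0) \<le> norm (ft \<phi> x 0 0)"
      using continuous_attains_sup[OF \<open>compact Z\<close> False continuous_on_norm[OF continuous_on_ft]] by blast
    have "norm (ft \<phi> x 0 0) \<noteq> 1"
    proof
      assume "norm (ft \<phi> x 0 0) = 1"
      then obtain p m where p: "p \<in> Omega \<phi>" "x = p + period m"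
        using Omega_representative[OF fin] by blast
      have "\<delta> p \<le> norm (x - (p + period m))" using x(1) p(1) unfolding Z_def by blast
      then show False using \<delta>[OF p(1)] by (simp add: p(2))
    qed
    then have "norm (ft \<phi> x 0 0) < 1" using le[of x] by linarith
    then show ?thesis using x(2) by (intro exI[of _ "1 - norm (ft \<phi> x 0 0)"]) auto
  qed
  then obtain \<eta> where \<eta>: "0 < \<eta>" "\<And>\<xi>. \<xi> \<in> Z \<Longrightarrow> norm (ft \<phi> \<xi> 0 0) \<le> 1 - \<eta>" by blast
  have "(\<exists>p\<in>Omega \<phi>. near_mod p (\<delta> p) \<xi>) \<or>
    norm (ft \<phi> \<xi> 0 0) \<le> 1 - \<eta>" for \<xi>
  proof -
    obtain t k where t: "t \<in> torus" "\<xi> = t + period k" by (rule torus_representative)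
    show ?thesis
    proof (cases "t \<in> Z")
      case True
      then show ?thesis using \<eta>(2)[of t] unfolding t(2) ft_periodic by blast
    next
      case False
      then obtain p m where p: "p \<in> Omega \<phi>" "\<not> \<delta> p \<le> norm (t - (p + period m))"
        using t(1) torus_Q unfolding Z_def by blast
      have eq: "\<xi> = p + period (m + k) + (t - (p + period m))"
        unfolding t(2) real_vec_add scaleR_right_distrib by simp
      have "norm (t - (p + period m)) < \<delta> p" using p(2) by simp
      with eq p(1) show ?thesis by blast
    qed
  qed
  with \<eta>(1) show ?thesis by blast
qed

lemma small_away_mono:
  assumes "small_away \<phi> h q \<delta> M" "M' \<le> M"
  shows "small_away \<phi> h q \<delta> M'"
proof -
  from assms(1) obtain C where C: "0 \<le> C" "\<And>\<xi>.
     (near_mod q \<delta> \<xi>) \<or>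
     (\<forall>n\<ge>1. \<forall>v z. norm v \<le> 1 \<longrightarrow> norm z \<le> 1 / real n \<longrightarrow>
        norm (h \<xi> v z) * norm (ft \<phi> \<xi> v z) ^ n \<le> C / real n ^ M)" unfolding small_away_def by blast
  have "C / real n ^ M \<le> C / real n ^ M'" if "1 \<le> n" for n
    using that C assms(2) by (intro divide_left_mono power_increasing) auto
  then show ?thesis unfolding small_away_def using C by (meson order_trans)
qed

lemma small_away_vanishing:
  fixes \<phi> :: "int ^ 'd \<Rightarrow> complex"
  assumes fin: "finitely_supported \<phi>" and h: "trig h"
    and decay: "\<And>p. p \<in> Omega \<phi> \<Longrightarrow> exp_power_decay \<phi> p (\<delta> p) (c p) (K p)"
    and van: "\<And>p. p \<in> Omega \<phi> \<Longrightarrow> p \<noteq> q \<Longrightarrow> vanish N p h"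
    and N: "\<And>p. p \<in> Omega \<phi> \<Longrightarrow> K p * M \<le> N" "M \<le> N"
    and finO: "finite (Omega \<phi>)" and le: "\<And>\<xi>. norm (ft \<phi> \<xi> 0 0) \<le> 1"
  shows "small_away \<phi> h q (\<delta> q) M"
proof -
  have \<delta>: "0 < \<delta> p" if "p \<in> Omega \<phi>" for p using decay[OF that] by (simp add: exp_power_decay_def)
  have "\<exists>\<eta>>0. \<forall>\<xi>. (\<exists>p\<in>Omega \<phi>. near_mod p (\<delta> p) \<xi>) \<or>
    norm (ft \<phi> \<xi> 0 0) \<le> 1 - \<eta>" by (rule fourier_gap[OF fin le]) (rule \<delta>)
  then obtain \<eta> where \<eta>: "0 < \<eta>" "\<And>\<xi>. (\<exists>p\<in>Omega \<phi>. near_mod p (\<delta> p) \<xi>) \<or>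
    norm (ft \<phi> \<xi> 0 0) \<le> 1 - \<eta>" by blast
  obtain A where A: "0 \<le> A" "\<And>\<xi> n v z. norm (ft \<phi> \<xi> 0 0) \<le> 1 - \<eta> \<Longrightarrow> 1 \<le> n \<Longrightarrow> norm v \<le> 1 \<Longrightarrow> norm z \<le> 1 / real n \<Longrightarrow>
    norm (h \<xi> v z) * norm (ft \<phi> \<xi> v z) ^ n \<le> A / real n ^ M"
    using small_away_gap[OF fin h \<eta>(1), of M] by blast
  have "\<forall>p\<in>Omega \<phi> - {q}. \<exists>C\<ge>0. \<forall>m \<xi> n v z. norm \<xi> < \<delta> p \<longrightarrow> 1 \<le> n \<longrightarrow> norm v \<le> 1 \<longrightarrow> norm z \<le> 1 / real n \<longrightarrow>
    norm (h (p + period m + \<xi>) v z) * norm (ft \<phi> (p + period m + \<xi>) v z) ^ n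
      \<le> C / real n ^ M"
    using small_away_near_other[OF fin h decay van N(1) N(2)] by blast
  then obtain B where B: "\<And>p. p \<in> Omega \<phi> - {q} \<Longrightarrow> 0 \<le> B p"
    "\<And>p m \<xi> n v z. p \<in> Omega \<phi> - {q} \<Longrightarrow> norm \<xi> < \<delta> p \<Longrightarrow> 1 \<le> n \<Longrightarrow> norm v \<le> 1 \<Longrightarrow> norm z \<le> 1 / real n \<Longrightarrow>
    norm (h (p + period m + \<xi>) v z) * norm (ft \<phi> (p + period m + \<xi>) v z) ^ n
      \<le> B p / real n ^ M" by metis
  define C where "C = A + (\<Sum>p\<in>Omega \<phi> - {q}. B p)"
  have sumB: "0 \<le> (\<Sum>p\<in>Omega \<phi> - {q}. B p)" using B(1) by (rule sum_nonneg)
  have BC: "B p \<le> C" if "p \<in> Omega \<phi> - {q}" for p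
    using member_le_sum[OF that, of B] B(1) finO A(1) by (simp add: C_def)
  have AC: "A \<le> C" using sumB by (simp add: C_def)
  have "norm (h \<xi> v z) * norm (ft \<phi> \<xi> v z) ^ n \<le> C / real n ^ M"
    if far: "\<not> (near_mod q (\<delta> q) \<xi>)"
      and n: "1 \<le> n" and v: "norm v \<le> 1" and z: "norm z \<le> 1 / real n" for \<xi> n v z
    using \<eta>(2)[of \<xi>]
  proof
    assume "\<exists>p\<in>Omega \<phi>. near_mod p (\<delta> p) \<xi>"
    then obtain p m \<xi>' where p: "p \<in> Omega \<phi>" "\<xi> = p + period m + \<xi>'" "norm \<xi>' < \<delta> p" by blast
    have "p \<noteq> q" using far p by blast
    then have pq: "p \<in> Omega \<phi> - {q}" using p by blast
    have "norm (h \<xi> v z) * norm (ft \<phi> \<xi> v z) ^ n \<le> B p / real n ^ M"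
      unfolding p(2) by (rule B(2)[OF pq p(3) n v z])
    also have "\<dots> \<le> C / real n ^ M" using BC[OF pq] by (intro divide_right_mono) auto
    finally show ?thesis .
  next
    assume "norm (ft \<phi> \<xi> 0 0) \<le> 1 - \<eta>"
    then have "norm (h \<xi> v z) * norm (ft \<phi> \<xi> v z) ^ n \<le> A / real n ^ M" by (rule A(2)[OF _ n v z])
    also have "\<dots> \<le> C / real n ^ M" using AC by (intro divide_right_mono) auto
    finally show ?thesis .
  qed
  then show ?thesis unfolding small_away_def using A(1) AC
    by (intro exI[of _ C] conjI allI) (simp, blast)
qed

section \<open>Superposition of the packets\<close>

lemma ft_eq_imp_l1_norm_le:
  fixes b :: "int ^ 'd \<Rightarrow> complex"
  assumes fin: "finitely_supported b" and A: "finite A" "\<And>q. q \<in> A \<Longrightarrow> finitely_supported (c q)"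
    and eq: "\<And>\<xi>. ft b \<xi> 0 0 = (\<Sum>q\<in>A. ft (c q) \<xi> 0 0)"
  shows "l1_norm b \<le> (\<Sum>q\<in>A. l1_norm (c q))"
proof -
  define S where "S = {x. b x \<noteq> 0} \<union> (\<Union>q\<in>A. {x. c q x \<noteq> 0})"
  have S: "finite S" "{x. b x \<noteq> 0} \<subseteq> S" "\<And>q. q \<in> A \<Longrightarrow> {x. c q x \<noteq> 0} \<subseteq> S"
    using fin A by (auto simp: S_def finitely_supported_def)
  have "b x - (\<Sum>q\<in>A. c q x) = 0" for x
  proof (rule expsum_eq_0_imp_coefficient_eq_0[OF S(1), of "\<lambda>x. b x - (\<Sum>q\<in>A. c q x)"])
    have "b x - (\<Sum>q\<in>A. c q x) = 0" if "x \<notin> S" for x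
    proof -
      have "b x = 0" "\<And>q. q \<in> A \<Longrightarrow> c q x = 0" using that S by blast+
      then show ?thesis by simp
    qed
    then show "{x. b x - (\<Sum>q\<in>A. c q x) \<noteq> 0} \<subseteq> S" by blast
    fix \<xi>
    have "expsum S (\<lambda>x. b x - (\<Sum>q\<in>A. c q x)) real_vec \<xi> 0 0 =
        expsum S b real_vec \<xi> 0 0 - (\<Sum>q\<in>A. expsum S (c q) real_vec \<xi> 0 0)"
      unfolding expsum_def left_diff_distrib sum_subtractf sum_distrib_right
      by (subst sum.swap) (rule refl)
    also have "\<dots> = ft b \<xi> 0 0 - (\<Sum>q\<in>A. ft (c q) \<xi> 0 0)"
      using S by (simp add: ft_eq_expsum[OF S(1)])
    finally show "expsum S (\<lambda>x. b x - (\<Sum>q\<in>A. c q x)) real_vec \<xi> 0 0 = 0" by (simp add: eq)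
  qed
  then have b: "b x = (\<Sum>q\<in>A. c q x)" for x by simp
  have "l1_norm b = (\<Sum>x\<in>S. cmod (\<Sum>q\<in>A. c q x))" by (simp add: l1_norm_eq_sum[OF S(1,2)] b)
  also have "\<dots> \<le> (\<Sum>x\<in>S. \<Sum>q\<in>A. cmod (c q x))" by (intro sum_mono norm_sum)
  also have "\<dots> = (\<Sum>q\<in>A. l1_norm (c q))" by (subst sum.swap) (simp add: l1_norm_eq_sum[OF S(1)] S)
  finally show ?thesis .
qed

theorem theorem1p7:
  fixes \<phi> :: "int ^ 'd \<Rightarrow> complex"
  assumes "finitely_supported \<phi>"
    and "(SUP \<xi>. cmod (fourier \<phi> \<xi>)) = 1"
    and "\<forall>\<xi>\<in>Omega \<phi>. positive_homogeneous_type \<phi> \<xi>"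
  shows "\<exists>C>0. \<forall>n\<ge>1. l1_norm (conv_pow \<phi> n) \<le> C"
proof -
  note fin = assms(1)
  have le: "\<And>\<xi>. norm (ft \<phi> \<xi> 0 0) \<le> 1" and ne: "Omega \<phi> \<noteq> {}"
    using maximum_of_fourier[OF assms(1,2)] by blast+
  have "\<forall>p\<in>Omega \<phi>. \<exists>\<delta> c K M. exp_power_decay \<phi> p \<delta> c K \<and> packet_bound \<phi> p \<delta> M"
    using positive_homogeneous_type_local[OF fin] assms(3) by (auto simp: Omega_def)
  then obtain \<delta> c K M where decay: "\<And>p. p \<in> Omega \<phi> \<Longrightarrow> exp_power_decay \<phi> p (\<delta> p) (c p) (K p)"
    and packet: "\<And>p. p \<in> Omega \<phi> \<Longrightarrow> packet_bound \<phi> p (\<delta> p) (M p)" by metis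
  have finO: "finite (Omega \<phi>)" using finite_Omega[OF fin decay] .
  define M' where "M' = (\<Sum>p\<in>Omega \<phi>. M p)"
  \<comment> \<open>An order of vanishing that suffices at all maxima and for the exponents of all packets.\<close>
  define N where "N = M' + (\<Sum>p\<in>Omega \<phi>. K p * M')"
  have M': "M p \<le> M'" if "p \<in> Omega \<phi>" for p
    unfolding M'_def using member_le_sum[OF that, of M] finO by simp
  have N: "K p * M' \<le> N" if "p \<in> Omega \<phi>" for p
    unfolding N_def using member_le_sum[OF that, of "\<lambda>p. K p * M'"] finO by simp
  have torus: "Omega \<phi> \<subseteq> torus" by (auto simp: Omega_def)
  obtain h where h: "\<And>q. q \<in> Omega \<phi> \<Longrightarrow> trig (h q)" "\<And>\<xi> v z. (\<Sum>q\<in>Omega \<phi>. h q \<xi> v z) = 1"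
    "\<And>p q. q \<in> Omega \<phi> \<Longrightarrow> p \<in> Omega \<phi> \<Longrightarrow> p \<noteq> q \<Longrightarrow> vanish N p (h q)"
    using trig_partition_of_unity[OF finO ne torus, of N] by metis
  have "\<exists>C n0. \<forall>n\<ge>n0. \<forall>c. finitely_supported c \<longrightarrow> (\<forall>\<xi> v z. ft c \<xi> v z = h q \<xi> v z * ft \<phi> \<xi> v z ^ n) \<longrightarrow>
      l1_norm c \<le> C" if q: "q \<in> Omega \<phi>" for q
  proof -
    have "small_away \<phi> (h q) q (\<delta> q) M'"
      by (rule small_away_vanishing[OF fin h(1)[OF q] decay h(3)[OF q] N _ finO le]) (simp_all add: N_def)
    then have "small_away \<phi> (h q) q (\<delta> q) (M q)" by (rule small_away_mono[OF _ M'[OF q]])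
    then show ?thesis using packet[OF q] h(1)[OF q] unfolding packet_bound_def by blast
  qed
  then obtain C n0 where bound: "\<And>q n c. q \<in> Omega \<phi> \<Longrightarrow> n \<ge> n0 q \<Longrightarrow> finitely_supported c \<Longrightarrow>
      (\<And>\<xi> v z. ft c \<xi> v z = h q \<xi> v z * ft \<phi> \<xi> v z ^ n) \<Longrightarrow> l1_norm c \<le> C q" by metis
  define n1 where "n1 = (\<Sum>q\<in>Omega \<phi>. n0 q)"
  have n1: "n0 q \<le> n1" if "q \<in> Omega \<phi>" for q
    unfolding n1_def using member_le_sum[OF that, of n0] finO by simp
  have large: "l1_norm (conv_pow \<phi> n) \<le> (\<Sum>q\<in>Omega \<phi>. C q)" if n: "n1 \<le> n" "1 \<le> n" for n
  proof -
    have ftn: "ft (conv_pow \<phi> n) \<xi> v z = ft \<phi> \<xi> v z ^ n" for \<xi> v z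
      using ft_conv_pow[OF fin, of "n - 1"] n(2) by simp
    have "\<forall>q\<in>Omega \<phi>. \<exists>b. finitely_supported b \<and> (\<forall>\<xi> v z. ft b \<xi> v z = h q \<xi> v z * ft \<phi> \<xi> v z ^ n)"
      using trig_mult[OF h(1) trig_power[OF trig_ft[OF fin]]] unfolding trig_def by blast
    then obtain b where b: "\<And>q. q \<in> Omega \<phi> \<Longrightarrow> finitely_supported (b q)"
      "\<And>q \<xi> v z. q \<in> Omega \<phi> \<Longrightarrow> ft (b q) \<xi> v z = h q \<xi> v z * ft \<phi> \<xi> v z ^ n" by metis
    have "l1_norm (conv_pow \<phi> n) \<le> (\<Sum>q\<in>Omega \<phi>. l1_norm (b q))"
    proof (rule ft_eq_imp_l1_norm_le[OF finitely_supported_conv_pow[OF fin] finO b(1)])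
      show "ft (conv_pow \<phi> n) \<xi> 0 0 = (\<Sum>q\<in>Omega \<phi>. ft (b q) \<xi> 0 0)" for \<xi>
        by (simp add: ftn b(2) sum_distrib_right[symmetric] h(2))
    qed
    also have "\<dots> \<le> (\<Sum>q\<in>Omega \<phi>. C q)"
    proof (rule sum_mono)
      fix q assume q: "q \<in> Omega \<phi>"
      have "n0 q \<le> n" using n1[OF q] n(1) by simp
      then show "l1_norm (b q) \<le> C q" by (rule bound[OF q _ b(1)[OF q] b(2)[OF q]])
    qed
    finally show ?thesis .
  qed
  define D where "D = 1 + \<bar>\<Sum>q\<in>Omega \<phi>. C q\<bar> + (\<Sum>n<n1. \<bar>l1_norm (conv_pow \<phi> n)\<bar>)"
  have sum0: "0 \<le> (\<Sum>n<n1. \<bar>l1_norm (conv_pow \<phi> n)\<bar>)" by (intro sum_nonneg) auto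
  have "l1_norm (conv_pow \<phi> n) \<le> D" if n: "1 \<le> n" for n
  proof (cases "n1 \<le> n")
    case True
    then show ?thesis
      using large[OF True n] sum0 abs_ge_self[of "\<Sum>q\<in>Omega \<phi>. C q"] unfolding D_def by linarith
  next
    case False
    then have "\<bar>l1_norm (conv_pow \<phi> n)\<bar> \<le> (\<Sum>n<n1. \<bar>l1_norm (conv_pow \<phi> n)\<bar>)"
      by (intro member_le_sum[of n "{..<n1}" "\<lambda>n. \<bar>l1_norm (conv_pow \<phi> n)\<bar>"]) auto
    then show ?thesis by (simp add: D_def)
  qed
  moreover have "0 < D" using sum0 unfolding D_def by linarith
  ultimately show ?thesis by blast
qed

end
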